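(* Let $d\ge 1$ and let $u:\mathbb{R}^d\to\mathbb{R}$ be a function satisfying $$u\in W^{2,1}_{\rm loc}(\mathbb{R}^d),\quad \nabla u \text{ is uniformly continuous in }\mathbb{R}^d,\quad \Delta u\in L^\infty(\mathbb{R}^d),\quad \inf_{\mathbb{R}^d}|\nabla u|>0 .$$ Then there exists a positive function $\sigma\in L^\infty_{\rm loc}(\mathbb{R}^d)$ with $\sigma^{-1}\in L^\infty_{\rm loc}(\mathbb{R}^d)$ which is a solution to the conductivity equation $$\operatorname{div}(\sigma\nabla u)=0\quad\text{in }\mathcal{D}'(\mathbb{R}^d);$$ the gradient flow $X(\cdot,x)$ associated with $\nabla u$ is well defined for a.e. $x\in\mathbb{R}^d$; and $\sigma$ satisfies the following: for any $t\in\mathbb{R}$ there exists a set $E_t\subset\mathbb{R}^d$ of Lebesgue measure zero, depending on $t$, such that $$\frac{\sigma(x)}{\sigma\big(X(t,x)\big)}=\exp\left(\int_0^t \Delta u\big(X(s,x)\big)\,ds\right),\quad\forall\,x\in\mathbb{R}^d\setminus E_t .$$ Conversely, if there exist a set $E\subset\mathbb{R}^d$ of Lebesgue measure zero and a positive function $\sigma\in L^\infty_{\rm loc}(\mathbb{R}^d)$ such that $$\frac{\sigma(x)}{\sigma\big(X(t,x)\big)}=\exp\left(\int_0^t \Delta u\big(X(s,x)\big)\,ds\right)$$ holds for any $t\in\mathbb{R}$ and any $x\in\mathbb{R}^d\setminus E$, then $\sigma$ is a solution to $\operatorname{div}(\sigma\nabla u)=0$ in $\mathcal{D}'(\mathb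b{R}^d)$.
   Context: $\mathcal{D}'(\mathbb{R}^d)$ is the space of distributions on $\mathbb{R}^d$. The gradient flow $X=X(t,x)$ associated with $\nabla u$ is defined by $$\frac{\partial X}{\partial t}(t,x)=\nabla u\big(X(t,x)\big),\qquad X(0,x)=x,\qquad t\in\mathbb{R},\ x\in\mathbb{R}^d .$$ It is understood in the almost-everywhere sense of DiPerna and Lions, that is, $X:\mathbb{R}\times\mathbb{R}^d\to\mathbb{R}^d$ is the (unique up to a Lebesgue-null set of points $x$) measurable map such that: (1) for a.e. $x\in\mathbb{R}^d$, the map $t\mapsto X(t,x)$ is in $C^1(\mathbb{R})^d$ and satisfies $\frac{\partial X}{\partial t}(t,x)=\nabla u\big(X(t,x)\big)$ for all $t\in\mathbb{R}$, together with $X(0,x)=x$; (2) for any $t\in\mathbb{R}$ there is a Lebesgue-null set $N_t$ such that $X(s+t,x)=X\big(s,X(t,x)\big)$ for all $s\in\mathbb{R}$ and all $x\in\mathbb{R}^d\setminus N_t$; (3) for any $t\in\mathbb{R}$, the image of Lebesgue measure by $X(t,\cdot)$ has a density $r(t,\cdot)\in L^\infty(\mathbb{R}^d)$ with respect to Lebesgue measure, with $e^{-|t|\,\|\Delta u\|_{L^\infty(\mathbb{R}^d)}}\le r(t,\cdot)\le e^{|t|\,\|\Delta u\|_{L^\infty(\mathbb{R}^d)}}$ a.e. in $\mathbb{R}^d$. "The flow is well defined for a.e. $x$" means that such a map exists and is unique up to a null set of $x$. *)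

theory Defs
  imports "HOL-Analysis.Analysis" "HOL-Probability.Essential_Supremum"
begin

text \<open>
  Functions on \<open>real ^ 'd\<close> that matter only almost everywhere are represented by Lebesgue
  measurable representatives. Null sets, integrals and measurability refer to the
  completed measure \<^const>\<open>lebesgue\<close>, not to \<^const>\<open>lborel\<close>.
\<close>

subsection \<open>Local Lebesgue spaces\<close>

definition L1_loc :: "(real ^ 'd \<Rightarrow> real) \<Rightarrow> bool" where
  "L1_loc f \<longleftrightarrow> (\<forall>K. compact K \<longrightarrow> f absolutely_integrable_on K)"

definition Linf_norm :: "(real ^ 'd \<Rightarrow> real) \<Rightarrow> ereal" where
  "Linf_norm f = esssup lebesgue (\<lambda>x. ereal \<bar>f x\<bar>)"

definition Linf :: "(real ^ 'd \<Rightarrow> real) \<Rightarrow> bool" where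
  "Linf f \<longleftrightarrow> f \<in> borel_measurable lebesgue \<and> Linf_norm f < \<infinity>"

definition Linf_loc :: "(real ^ 'd \<Rightarrow> real) \<Rightarrow> bool" where
  "Linf_loc f \<longleftrightarrow> f \<in> borel_measurable lebesgue \<and>
     (\<forall>K. compact K \<longrightarrow> (\<exists>C::real. AE x in lebesgue. x \<in> K \<longrightarrow> \<bar>f x\<bar> \<le> C))"

subsection \<open>Test functions\<close>

definition partial :: "'d \<Rightarrow> (real ^ 'd \<Rightarrow> real) \<Rightarrow> real ^ 'd \<Rightarrow> real" where
  "partial i f x = frechet_derivative f (at x) (axis i 1)"

definition grad :: "(real ^ 'd \<Rightarrow> real) \<Rightarrow> real ^ 'd \<Rightarrow> real ^ 'd" where
  "grad f x = (\<chi> i. partial i f x)"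

text \<open>All iterated partial derivatives of order at most \<open>k\<close> exist and those of order less
  than \<open>k\<close> are Frechet differentiable; together with continuity at the last level
  this is the class \<open>C\<^sup>k\<close>.\<close>

fun Ck :: "nat \<Rightarrow> (real ^ 'd \<Rightarrow> real) \<Rightarrow> bool" where
  "Ck 0 f \<longleftrightarrow> continuous_on UNIV f"
| "Ck (Suc k) f \<longleftrightarrow> (\<forall>x. f differentiable (at x)) \<and> (\<forall>i. Ck k (partial i f))"

definition test_function :: "(real ^ 'd \<Rightarrow> real) \<Rightarrow> bool" where
  "test_function \<phi> \<longleftrightarrow> (\<forall>k. Ck k \<phi>) \<and> compact (closure {x. \<phi> x \<noteq> 0})"

subsection \<open>Weak derivatives and the divergence in the sense of distributions\<close>

definition weak_partial :: "'d \<Rightarrow> (real ^ 'd \<Rightarrow> real) \<Rightarrow> (real ^ 'd \<Rightarrow> real) \<Rightarrow> bool" where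
  "weak_partial i f g \<longleftrightarrow> L1_loc f \<and> L1_loc g \<and>
     (\<forall>\<phi>. test_function \<phi> \<longrightarrow>
        (LINT x|lebesgue. f x * partial i \<phi> x) = - (LINT x|lebesgue. g x * \<phi> x))"

definition W21_loc :: "(real ^ 'd \<Rightarrow> real) \<Rightarrow> bool" where
  "W21_loc u \<longleftrightarrow> (\<exists>g h. (\<forall>i. weak_partial i u (g i)) \<and> (\<forall>i j. weak_partial j (g i) (h i j)))"

definition weak_gradient :: "(real ^ 'd \<Rightarrow> real) \<Rightarrow> (real ^ 'd \<Rightarrow> real ^ 'd) \<Rightarrow> bool" where
  "weak_gradient u G \<longleftrightarrow> (\<forall>i. weak_partial i u (\<lambda>x. G x $ i))"

definition weak_laplacian :: "(real ^ 'd \<Rightarrow> real) \<Rightarrow> (real ^ 'd \<Rightarrow> real) \<Rightarrow> bool" where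
  "weak_laplacian u L \<longleftrightarrow>
     (\<exists>g h. (\<forall>i. weak_partial i u (g i) \<and> weak_partial i (g i) (h i)) \<and>
            (AE x in lebesgue. L x = (\<Sum>i\<in>UNIV. h i x)))"

text \<open>The distribution \<open>div F\<close> of a locally integrable vector field, as a functional on
  test functions.\<close>

definition distr_div :: "(real ^ 'd \<Rightarrow> real ^ 'd) \<Rightarrow> (real ^ 'd \<Rightarrow> real) \<Rightarrow> real" where
  "distr_div F \<phi> = - (LINT x|lebesgue. F x \<bullet> grad \<phi> x)"

definition conductivity_solution ::
    "(real ^ 'd \<Rightarrow> real) \<Rightarrow> (real ^ 'd \<Rightarrow> real ^ 'd) \<Rightarrow> bool" where
  "conductivity_solution \<sigma> G \<longleftrightarrow>
     (\<forall>\<phi>. test_function \<phi> \<longrightarrow> distr_div (\<lambda>x. \<sigma> x *\<^sub>R G x) \<phi> = 0)"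

subsection \<open>Almost everywhere flows of DiPerna and Lions\<close>

text \<open>\<open>G\<close> is the vector field and \<open>L\<close> its divergence. The image measure is taken on the Borel
  sets, since \<open>X t\<close> is a Lebesgue-to-Borel measurable map.\<close>

definition gradient_flow :: "(real ^ 'd \<Rightarrow> real ^ 'd) \<Rightarrow> (real ^ 'd \<Rightarrow> real) \<Rightarrow>
    (real \<Rightarrow> real ^ 'd \<Rightarrow> real ^ 'd) \<Rightarrow> bool" where
  "gradient_flow G L X \<longleftrightarrow>
     (\<lambda>(t, x). X t x) \<in> borel_measurable lebesgue \<and>
     (\<forall>t. X t \<in> borel_measurable lebesgue) \<and>
     (AE x in lebesgue.
        (\<lambda>t. X t x) C1_differentiable_on UNIV \<and>
        (\<forall>t. ((\<lambda>t. X t x) has_vector_derivative G (X t x)) (at t)) \<and>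
        X 0 x = x) \<and>
     (\<forall>t. AE x in lebesgue. \<forall>s. X (s + t) x = X s (X t x)) \<and>
     (\<forall>t. \<exists>r \<in> borel_measurable borel.
        distr lebesgue lborel (X t) = density lborel (\<lambda>x. ennreal (r x)) \<and>
        (AE x in lborel.
           exp (- \<bar>t\<bar> * real_of_ereal (Linf_norm L)) \<le> r x \<and>
           r x \<le> exp (\<bar>t\<bar> * real_of_ereal (Linf_norm L))))"

definition gradient_flow_well_defined ::
    "(real ^ 'd \<Rightarrow> real ^ 'd) \<Rightarrow> (real ^ 'd \<Rightarrow> real) \<Rightarrow> bool" where
  "gradient_flow_well_defined G L \<longleftrightarrow>
     (\<exists>X. gradient_flow G L X) \<and>
     (\<forall>X Y. gradient_flow G L X \<and> gradient_flow G L Y \<longrightarrow>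
        (AE x in lebesgue. \<forall>t. X t x = Y t x))"

end

theory Submission
  imports Defs
begin

text \<open>
  A uniformly continuous gradient \<open>G\<close> with bounded divergence is log-Lipschitz: for the
  mollifier \<open>\<eta>\<close> below, the derivative of the mollification of \<open>G\<close> in the scale \<open>r\<close> is a first
  derivative of a mollification of \<open>L\<close>, hence bounded, while its gradient is of order
  \<open>1 + ln (1 / r)\<close>. So the flow exists and is unique from every initial point, and it is the
  locally uniform limit of Euler polygons of the mollified fields. The Jacobians of the Euler
  maps are explicit, and in the limit they give the change of variables formula
  \<open>\<integral> f (X\<^sub>t x) * exp (\<integral>\<^sub>0\<^sup>t L (X\<^sub>s x) ds) dx = \<integral> f x dx\<close>. Along trajectories the potential \<open>U\<close> of
  \<open>G\<close> grows at rate \<open>|G|\<^sup>2\<close>, which is bounded below, so each trajectory meets \<open>{U = 0}\<close> at exactly one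
  time \<open>\<tau> x\<close>, and \<open>\<sigma> x = exp (\<integral>\<^sub>0 L (X\<^sub>s x) ds)\<close>, integrated up to \<open>\<tau> x\<close>, has the required ratios.
  Conversely, these ratios and the change of variables make \<open>\<integral> \<sigma> x * \<phi> (X\<^sub>t x) dx\<close>
  independent of \<open>t\<close>, and its derivative at \<open>t = 0\<close> is the weak form of the equation.
\<close>

section \<open>Flows of log-Lipschitz fields\<close>

text \<open>The field is not Lipschitz, so neither Gronwall with a fixed constant nor
  differentiability of the flow in the initial point is available. The former is met by keeping the
  scale \<open>r\<close> free in the log-Lipschitz bound: for each \<open>r\<close> the estimate is
  affine in the distance, and \<open>r\<close> is tied to the defect only at the end. The latter is
  why Euler maps are used: their Jacobians are finite products of determinants near the identity,
  and no derivative of the flow itself is ever formed. The obstacle in the limit is that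
  \<open>L\<close> is merely measurable, so convergence of points does not give convergence of
  \<open>L\<close> along trajectories; a crude density bound, uniform in the approximation, has to
  be in place before the divergences can be compared in \<open>L\<^sup>1\<close>. Fatou's lemma
  yields an inequality only, and reversing time turns it into the equality. Since trajectories are
  unique from every point, a flow in the almost everywhere sense must coincide with the classical
  one, while the exponent depends on \<open>L\<close> only through its class because the flow pulls
  null sets back to null sets.\<close>

lemma has_integral_step_function:
  fixes g :: "nat \<Rightarrow> 'b::banach"
  assumes h: "0 < h" and t: "0 \<le> t"
  shows "((\<lambda>s. g (nat \<lfloor>s / h\<rfloor>)) has_integral
    (h *\<^sub>R (\<Sum>j<nat \<lfloor>t / h\<rfloor>. g j) + (t - h * nat \<lfloor>t / h\<rfloor>) *\<^sub>R g (nat \<lfloor>t / h\<rfloor>))) {0..t}"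
proof -
  have piece: "((\<lambda>s. g (nat \<lfloor>s / h\<rfloor>)) has_integral ((t - real k * h) *\<^sub>R g k)) {real k * h..t}"
    if "real k * h \<le> t" "t \<le> real (Suc k) * h" for k t
  proof (rule has_integral_spike_finite[of "{t}"])
    show "((\<lambda>s. g k) has_integral ((t - real k * h) *\<^sub>R g k)) {real k * h..t}"
      using has_integral_const_real[of "g k" "real k * h" t] that by simp
    fix s assume s: "s \<in> {real k * h..t} - {t}"
    have "real k \<le> s / h" "s / h < real k + 1"
      using s that h by (auto simp: field_simps)
    then have "\<lfloor>s / h\<rfloor> = int k" by linarith
    then show "g (nat \<lfloor>s / h\<rfloor>) = g k" by simp
  qed auto
  have full: "((\<lambda>s. g (nat \<lfloor>s / h\<rfloor>)) has_integral (h *\<^sub>R (\<Sum>j<k. g j))) {0..real k * h}" for k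
  proof (induction k)
    case 0 show ?case using has_integral_refl(2)[of "\<lambda>s. g (nat \<lfloor>s / h\<rfloor>)" "0::real"] by simp
  next
    case (Suc k)
    have "((\<lambda>s. g (nat \<lfloor>s / h\<rfloor>)) has_integral (h *\<^sub>R (\<Sum>j<k. g j) + (real (Suc k) * h - real k * h) *\<^sub>R g k)) {0..real (Suc k) * h}"
      by (rule has_integral_combine[OF _ _ Suc piece]) (use h in \<open>auto simp: algebra_simps\<close>)
    then show ?case by (simp add: algebra_simps)
  qed
  define k where "k = nat \<lfloor>t / h\<rfloor>"
  have "real k \<le> t / h" "t / h < real k + 1"
    using t h by (auto simp: k_def)
  then have k: "real k * h \<le> t" "t \<le> real (Suc k) * h" using h by (auto simp: field_simps)
  have "((\<lambda>s. g (nat \<lfloor>s / h\<rfloor>)) has_integral (h *\<^sub>R (\<Sum>j<k. g j) + (t - real k * h) *\<^sub>R g k)) {0..t}"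
    by (rule has_integral_combine[OF _ _ full piece]) (use h k in \<open>auto\<close>)
  then show ?thesis by (simp add: k_def mult.commute)
qed

text \<open>Piecewise constant in time rather than interpolated: the map at time \<open>t\<close> is
  then an exact iterate of \<open>x + h *\<^sub>R B x\<close>, whose Jacobian is a product of
  explicit determinants. The price is a defect of at most one step in the integral equation.\<close>

definition euler :: "('a::real_vector \<Rightarrow> 'a) \<Rightarrow> real \<Rightarrow> real \<Rightarrow> 'a \<Rightarrow> 'a" where
  "euler B h t x = ((\<lambda>x. x + h *\<^sub>R B x) ^^ nat \<lfloor>t / h\<rfloor>) x"

lemma euler_0 [simp]: "euler B h 0 x = x"
  by (simp add: euler_def)

text \<open>The full steps telescope; the remaining term is the part of the integral over the
  unfinished step.\<close>

lemma euler_has_integral: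
  fixes B :: "'a::banach \<Rightarrow> 'a"
  assumes "0 < h" "0 \<le> t"
  shows "((\<lambda>s. B (euler B h s x)) has_integral
     (euler B h t x - x + (t - h * nat \<lfloor>t / h\<rfloor>) *\<^sub>R B (euler B h t x))) {0..t}"
proof -
  have "h *\<^sub>R (\<Sum>j<k. B (((\<lambda>x. x + h *\<^sub>R B x) ^^ j) x)) = ((\<lambda>x. x + h *\<^sub>R B x) ^^ k) x - x" for k
    by (induction k) (auto simp: scaleR_add_right)
  then show ?thesis
    using has_integral_step_function[OF assms, of "\<lambda>j. B (((\<lambda>x. x + h *\<^sub>R B x) ^^ j) x)"]
    by (simp add: euler_def)
qed

text \<open>Discrete Gronwall: one step multiplies \<open>1 + norm\<close> by at most
  \<open>1 + K * h\<close>, hence by at most \<open>exp (K * h)\<close>.\<close>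

lemma euler_growth:
  fixes B :: "'a::real_normed_vector \<Rightarrow> 'a"
  assumes B: "\<And>z. norm (B z) \<le> K * (1 + norm z)" and K: "0 \<le> K" and h: "0 < h" and t: "t \<in> {0..T}"
  shows "1 + norm (euler B h t x) \<le> exp (K * T) * (1 + norm x)"
proof -
  define k where "k = nat \<lfloor>t / h\<rfloor>"
  have iter: "1 + norm (((\<lambda>x. x + h *\<^sub>R B x) ^^ k) x) \<le> exp (K * (k * h)) * (1 + norm x)" for k
  proof (induction k)
    case (Suc k)
    define z where "z = ((\<lambda>x. x + h *\<^sub>R B x) ^^ k) x"
    have "norm (z + h *\<^sub>R B z) \<le> norm z + norm (h *\<^sub>R B z)" by (rule norm_triangle_ineq)
    also have "norm (h *\<^sub>R B z) \<le> h * (K * (1 + norm z))"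
      using B[of z] h by simp
    finally have "1 + norm (z + h *\<^sub>R B z) \<le> (1 + K * h) * (1 + norm z)" by (simp add: algebra_simps)
    also have "\<dots> \<le> exp (K * h) * (exp (K * (k * h)) * (1 + norm x))"
      using Suc K h unfolding z_def by (intro mult_mono exp_ge_add_one_self) auto
    also have "\<dots> = exp (K * (Suc k * h)) * (1 + norm x)"
      by (simp add: exp_add[symmetric] algebra_simps)
    finally show ?case by (simp add: z_def)
  qed simp
  have "real k \<le> t / h" using t h by (simp add: k_def)
  then have "k * h \<le> T" using t h by (simp add: field_simps)
  then have "exp (K * (k * h)) \<le> exp (K * T)" using K by (simp add: mult_left_mono)
  then have "exp (K * (k * h)) * (1 + norm x) \<le> exp (K * T) * (1 + norm x)"
    by (rule mult_right_mono) simp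
  then show ?thesis using iter[of k] unfolding euler_def k_def[symmetric] by linarith
qed

text \<open>The scale \<open>r\<close> is a free parameter. With \<open>r = norm (x - y)\<close>
  this is, up to the factor \<open>C\<close>, the modulus \<open>s * (2 + ln (1 / s))\<close>. Left
  free, it says that \<open>G\<close> is Lipschitz with constant \<open>C * (1 + ln (1 / r))\<close>
  up to an error \<open>C * r\<close>, and a linear Gronwall argument applies at each
  \<open>r\<close>.\<close>

locale log_lipschitz_field =
  fixes G :: "'a::euclidean_space \<Rightarrow> 'a" and C :: real
  assumes C_pos: "0 < C"
    and log_lip: "\<And>r x y. 0 < r \<Longrightarrow> r \<le> 1 \<Longrightarrow> norm (G x - G y) \<le> C * (r + (1 + ln (1 / r)) * norm (x - y))"
begin

lemma uniformly_continuous: "uniformly_continuous_on UNIV G"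
  unfolding uniformly_continuous_on_def
proof (intro allI impI)
  fix e :: real assume e: "0 < e"
  define r where "r = min 1 (e / (4 * C))"
  have r: "0 < r" "r \<le> 1" "C * r \<le> e / 4" using e C_pos by (auto simp: r_def min_def field_simps)
  define K where "K = C * (1 + ln (1 / r))"
  have K: "K > 0" using r C_pos by (auto simp: K_def intro!: mult_pos_pos add_pos_nonneg)
  have "norm (G x' - G x) < e" if "dist x' x < e / (2 * K)" for x x'
  proof -
    have "norm (G x' - G x) \<le> C * r + K * norm (x' - x)"
      using log_lip[OF r(1,2), of x' x] by (simp add: K_def algebra_simps)
    also have "K * norm (x' - x) \<le> K * (e / (2 * K))"
      using that K by (intro mult_left_mono) (auto simp: dist_norm)
    finally show ?thesis using r(3) e K by simp
  qed
  then show "\<exists>d>0. \<forall>x\<in>UNIV. \<forall>x'\<in>UNIV. dist x' x < d \<longrightarrow> dist (G x') (G x) < e"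
    using e K by (intro exI[of _ "e / (2 * K)"]) (auto simp: dist_norm)
qed

lemma continuous: "continuous_on S G"
  using uniformly_continuous uniformly_continuous_imp_continuous continuous_on_subset by blast

lemma linear_growth: "norm (G x) \<le> (norm (G 0) + C) * (1 + norm x)"
proof -
  have "norm (G x - G 0) \<le> C * (1 + norm x)"
    using log_lip[of 1 x 0] by simp
  then have "norm (G x) \<le> norm (G 0) + C * (1 + norm x)"
    using norm_triangle_ineq2[of "G x" "G 0"] by linarith
  moreover have "norm (G 0) \<le> norm (G 0) * (1 + norm x)" by (simp add: algebra_simps mult_nonneg_nonneg)
  ultimately show ?thesis unfolding distrib_right by linarith
qed

text \<open>The integral form admits the jumps of Euler maps in time. The defect is bounded on every
  subinterval, not only from time 0, so that an approximate solution can be restarted later with the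
  same defect; boundedness makes the weighted supremum in the comparison finite.\<close>

definition approx_sol :: "(real \<Rightarrow> 'a) \<Rightarrow> real \<Rightarrow> real \<Rightarrow> bool" where
  "approx_sol y T \<delta> \<longleftrightarrow> bounded (y ` {0..T}) \<and>
     (\<forall>s t. 0 \<le> s \<and> s \<le> t \<and> t \<le> T \<longrightarrow>
        (\<exists>I. ((\<lambda>\<tau>. G (y \<tau>)) has_integral I) {s..t} \<and> norm (y t - y s - I) \<le> \<delta>))"

lemma approx_sol_mono:
  "approx_sol y T \<delta> \<Longrightarrow> T' \<le> T \<Longrightarrow> \<delta> \<le> \<delta>' \<Longrightarrow> approx_sol y T' \<delta>'"
  unfolding approx_sol_def
  by (meson order.trans image_mono bounded_subset atLeastatMost_subset_iff order.refl)

lemma approx_sol_shift: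
  assumes "approx_sol y T \<delta>" "0 \<le> a"
  shows "approx_sol (\<lambda>s. y (a + s)) (T - a) \<delta>"
  unfolding approx_sol_def
proof (intro conjI allI impI)
  have "(\<lambda>s. y (a + s)) ` {0..T - a} \<subseteq> y ` {0..T}"
    using assms(2) by auto
  then show "bounded ((\<lambda>s. y (a + s)) ` {0..T - a})"
    using assms(1) bounded_subset by (auto simp: approx_sol_def)
  fix s t assume st: "0 \<le> s \<and> s \<le> t \<and> t \<le> T - a"
  then have "0 \<le> s + a \<and> s + a \<le> t + a \<and> t + a \<le> T" using assms(2) by auto
  then obtain I where I: "((\<lambda>\<tau>. G (y \<tau>)) has_integral I) {s + a..t + a}" "norm (y (t + a) - y (s + a) - I) \<le> \<delta>"
    using assms(1) unfolding approx_sol_def by blast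
  then show "\<exists>I. ((\<lambda>\<tau>. G (y (a + \<tau>))) has_integral I) {s..t} \<and> norm (y (a + t) - y (a + s) - I) \<le> \<delta>"
    using has_integral_shift_Icc_real[of "\<lambda>\<tau>. G (y \<tau>)" a I s t] by (auto simp: o_def add.commute)
qed

text \<open>Gronwall's inequality in the norm weighted by \<open>exp (- 2 * \<beta> * t)\<close>: the choice of the
  Lipschitz constant \<open>\<beta> = C * (1 + ln (1 / r))\<close> costs only a factor \<open>1 / sqrt r\<close> on this short
  time interval, while the defect is \<open>C * r\<close>.\<close>

lemma approx_sol_compare_short:
  assumes y: "approx_sol y T \<delta>" and z: "approx_sol z T \<delta>"
    and T: "T \<le> 1 / (4 * C)" and r: "0 < r" "r \<le> 1" and t: "t \<in> {0..T}"
  shows "norm (y t - z t) \<le> 4 * (norm (y 0 - z 0) + 2 * \<delta> + r) / sqrt r"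
proof -
  define \<alpha> where "\<alpha> = norm (y 0 - z 0) + 2 * \<delta>"
  define \<beta> where "\<beta> = C * (1 + ln (1 / r))"
  have \<beta>: "0 < \<beta>" using C_pos r unfolding \<beta>_def by (auto intro!: mult_pos_pos add_pos_nonneg)
  have T0: "0 \<le> T" using t by auto
  define w where "w = (\<lambda>s. exp (- (2 * \<beta> * s)) * norm (y s - z s))"
  have "bounded (y ` {0..T})" "bounded (z ` {0..T})" using y z by (auto simp: approx_sol_def)
  then obtain By Bz where "\<forall>v\<in>y ` {0..T}. norm v \<le> By" "\<forall>v\<in>z ` {0..T}. norm v \<le> Bz"
    unfolding bounded_iff by metis
  then have B: "norm (y s) \<le> By" "norm (z s) \<le> Bz" if "s \<in> {0..T}" for s using that by auto
  have wB: "w s \<le> By + Bz" if "s \<in> {0..T}" for s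
  proof -
    have "w s \<le> 1 * norm (y s - z s)"
      unfolding w_def using that \<beta> by (intro mult_right_mono) auto
    then show ?thesis using B[OF that] norm_triangle_ineq4[of "y s" "z s"] by linarith
  qed
  \<comment> \<open>The supremum is finite because \<open>y\<close> and \<open>z\<close> are
    bounded, so the term \<open>S / 2\<close> produced by integrating
    \<open>\<beta> * S * exp (2 * \<beta> * \<tau>)\<close> can be absorbed on the left.\<close>
  define S where "S = (SUP s\<in>{0..T}. w s)"
  have bdd: "bdd_above (w ` {0..T})" using wB by (intro bdd_aboveI2[where M = "By + Bz"])
  have wS: "w s \<le> S" if "s \<in> {0..T}" for s
    unfolding S_def using bdd that by (intro cSUP_upper)
  have "0 \<le> w 0" by (simp add: w_def)
  then have S0: "0 \<le> S" using wS[of 0] T0 by simp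
  have aS: "norm (y s - z s) \<le> S * exp (2 * \<beta> * s)" if "s \<in> {0..T}" for s
    using wS[OF that] by (simp add: w_def exp_minus field_simps)
  have step: "w s \<le> \<alpha> + C * r * T + S / 2" if s: "s \<in> {0..T}" for s
  proof -
    obtain I where I: "((\<lambda>\<tau>. G (y \<tau>)) has_integral I) {0..s}" "norm (y s - y 0 - I) \<le> \<delta>"
      using y s by (auto simp: approx_sol_def)
    obtain I' where I': "((\<lambda>\<tau>. G (z \<tau>)) has_integral I') {0..s}" "norm (z s - z 0 - I') \<le> \<delta>"
      using z s by (auto simp: approx_sol_def)
    have d: "((\<lambda>\<tau>. G (y \<tau>) - G (z \<tau>)) has_integral (I - I')) {0..s}"
      using I(1) I'(1) by (rule has_integral_diff)
    have e: "((\<lambda>\<tau>. C * r + \<beta> * S * exp (2 * \<beta> * \<tau>)) has_integral (C * r * s + S / 2 * exp (2 * \<beta> * s) - (C * r * 0 + S / 2 * exp (2 * \<beta> * 0)))) {0..s}"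
      using s by (intro fundamental_theorem_of_calculus)
        (auto intro!: derivative_eq_intros simp: has_real_derivative_iff_has_vector_derivative[symmetric])
    have "norm (I - I') \<le> C * r * s + S / 2 * exp (2 * \<beta> * s) - (C * r * 0 + S / 2 * exp (2 * \<beta> * 0))"
    proof (rule integral_norm_bound_integral[of "\<lambda>\<tau>. G (y \<tau>) - G (z \<tau>)" "{0..s}" "\<lambda>\<tau>. C * r + \<beta> * S * exp (2 * \<beta> * \<tau>)", unfolded integral_unique[OF d] integral_unique[OF e]])
      show "(\<lambda>\<tau>. G (y \<tau>) - G (z \<tau>)) integrable_on {0..s}" using d by blast
      show "(\<lambda>\<tau>. C * r + \<beta> * S * exp (2 * \<beta> * \<tau>)) integrable_on {0..s}" using e by blast
      fix \<tau> assume \<tau>: "\<tau> \<in> {0..s}"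
      have "norm (G (y \<tau>) - G (z \<tau>)) \<le> C * r + \<beta> * norm (y \<tau> - z \<tau>)"
        using log_lip[OF r, of "y \<tau>" "z \<tau>"] by (simp add: \<beta>_def algebra_simps)
      also have "\<dots> \<le> C * r + \<beta> * (S * exp (2 * \<beta> * \<tau>))"
        using aS[of \<tau>] \<tau> s \<beta> by auto
      finally show "norm (G (y \<tau>) - G (z \<tau>)) \<le> C * r + \<beta> * S * exp (2 * \<beta> * \<tau>)" by simp
    qed
    moreover have "C * r * s \<le> C * r * T" using s r C_pos by (intro mult_left_mono) auto
    ultimately have II: "norm (I - I') \<le> C * r * T + S / 2 * exp (2 * \<beta> * s)" using S0 by simp
    have decomp: "y s - z s = (y 0 - z 0) + (y s - y 0 - I) - (z s - z 0 - I') + (I - I')" by simp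
    have "norm (y s - z s) \<le> norm (y 0 - z 0) + norm (y s - y 0 - I) + norm (z s - z 0 - I') + norm (I - I')"
      using norm_triangle_ineq[of "(y 0 - z 0) + (y s - y 0 - I) - (z s - z 0 - I')" "I - I'"]
        norm_triangle_ineq4[of "(y 0 - z 0) + (y s - y 0 - I)" "z s - z 0 - I'"]
        norm_triangle_ineq[of "y 0 - z 0" "y s - y 0 - I"] unfolding decomp[symmetric] by linarith
    then have n: "norm (y s - z s) \<le> (\<alpha> + C * r * T) + S / 2 * exp (2 * \<beta> * s)"
      using I(2) I'(2) II by (simp add: \<alpha>_def)
    have \<delta>: "0 \<le> \<delta>" using I(2) norm_ge_zero order_trans by blast
    have e1: "1 \<le> exp (2 * \<beta> * s)" using \<beta> s by auto
    have p: "0 \<le> \<alpha> + C * r * T" using C_pos r T0 \<delta> by (simp add: \<alpha>_def)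
    have "norm (y s - z s) \<le> (\<alpha> + C * r * T + S / 2) * exp (2 * \<beta> * s)"
      using n mult_left_mono[OF e1 p] by (simp add: algebra_simps)
    then show ?thesis by (simp add: w_def exp_minus field_simps)
  qed
  have "(SUP s\<in>{0..T}. w s) \<le> \<alpha> + C * r * T + S / 2"
    using T0 by (intro cSUP_least step) auto
  then have "S \<le> \<alpha> + C * r * T + S / 2" by (simp only: S_def)
  moreover define E where "E = C * r * T"
  ultimately have S: "S \<le> 2 * (\<alpha> + E)" by simp
  have CT: "C * T \<le> 1 / 4" using T C_pos by (simp add: field_simps)
  have "E \<le> r / 4" unfolding E_def using mult_right_mono[OF CT, of r] r by (simp add: algebra_simps)
  then have "E \<le> r" using r by simp
  then have "2 * (\<alpha> + E) \<le> 2 * (\<alpha> + r)" by simp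
  with S have S': "S \<le> 2 * (\<alpha> + r)" by (rule order_trans)
  have "\<beta> * t \<le> \<beta> * T" using \<beta> t by simp
  also have "\<dots> = (1 + ln (1 / r)) * (C * T)" by (simp add: \<beta>_def)
  also have "\<dots> \<le> (1 + ln (1 / r)) * (1 / 4)" using CT r by (intro mult_left_mono) auto
  finally have "2 * \<beta> * t \<le> 1/2 + ln (1 / r) / 2" by (simp add: field_simps)
  then have "exp (2 * \<beta> * t) \<le> exp (1/2 + ln (1 / r) / 2)" by simp
  also have "\<dots> = exp (1/2) * (1 / sqrt r)"
  proof -
    have p: "0 \<le> 1 / r" using r by simp
    have "exp (ln (1 / r) / 2) = sqrt (1 / r)"
      unfolding ln_sqrt[of "1 / r", symmetric, OF p] by (rule exp_ln) (use r in simp)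
    then show ?thesis by (simp add: exp_add real_sqrt_divide)
  qed
  also have "exp (1/2 :: real) \<le> 2"
    using exp_half_le2 by simp
  finally have E: "exp (2 * \<beta> * t) \<le> 2 / sqrt r" using r by (simp add: divide_right_mono)
  have "norm (y t - z t) \<le> S * exp (2 * \<beta> * t)" using aS t by blast
  also have "\<dots> \<le> 2 * (\<alpha> + r) * (2 / sqrt r)"
    using S' E S0 by (intro mult_mono) auto
  finally show ?thesis by (simp add: \<alpha>_def)
qed

lemma approx_sol_compare_short_small:
  assumes "0 < \<epsilon>"
  obtains \<alpha> where "0 < \<alpha>" "\<And>y z T t. approx_sol y T \<alpha> \<Longrightarrow> approx_sol z T \<alpha> \<Longrightarrow> T \<le> 1 / (4 * C) \<Longrightarrow>
     norm (y 0 - z 0) \<le> \<alpha> \<Longrightarrow> t \<in> {0..T} \<Longrightarrow> norm (y t - z t) \<le> \<epsilon>"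
proof -
  \<comment> \<open>With \<open>r = q\<^sup>2\<close>, and data error and defect
    \<open>q\<^sup>2 / 3\<close>, the short-time bound becomes
    \<open>4 * (q\<^sup>2 + q\<^sup>2) / q = 8 * q\<close>, whence
    \<open>\<epsilon> / 8\<close>.\<close>
  define q where "q = min 1 (\<epsilon> / 8)"
  have q: "0 < q" "q \<le> 1" "q \<le> \<epsilon> / 8" using assms by (auto simp: q_def)
  have "norm (y t - z t) \<le> \<epsilon>"
    if "approx_sol y T (q\<^sup>2 / 3)" "approx_sol z T (q\<^sup>2 / 3)" "T \<le> 1 / (4 * C)" "norm (y 0 - z 0) \<le> q\<^sup>2 / 3" "t \<in> {0..T}" for y z T t
  proof -
    have "norm (y t - z t) \<le> 4 * (norm (y 0 - z 0) + 2 * (q\<^sup>2 / 3) + q\<^sup>2) / sqrt (q\<^sup>2)"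
      by (rule approx_sol_compare_short[OF that(1,2,3) _ _ that(5)]) (use q in \<open>auto simp: power_le_one\<close>)
    also have "\<dots> \<le> 4 * (q\<^sup>2 / 3 + 2 * (q\<^sup>2 / 3) + q\<^sup>2) / sqrt (q\<^sup>2)"
      using that(4) q by (intro divide_right_mono) auto
    also have "\<dots> = 8 * q" using q by (simp add: power2_eq_square)
    finally show ?thesis using q by simp
  qed
  then show ?thesis using that[of "q\<^sup>2 / 3"] q by auto
qed

text \<open>Windows of length \<open>1 / (4 * C)\<close> are chained: the tolerance needed at the
  start of the last window becomes the target for the earlier ones. Each window costs about a square
  root of accuracy, so the dependence on the initial error is of Hoelder type, with an exponent that
  decays with \<open>k\<close>.\<close>

lemma approx_sol_compare_steps:
  fixes k :: nat and \<epsilon> :: real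
  assumes "0 < \<epsilon>"
  shows "\<exists>\<alpha>>0. \<forall>y z T t. approx_sol y T \<alpha> \<longrightarrow> approx_sol z T \<alpha> \<longrightarrow> T \<le> real k / (4 * C) \<longrightarrow>
     norm (y 0 - z 0) \<le> \<alpha> \<longrightarrow> t \<in> {0..T} \<longrightarrow> norm (y t - z t) \<le> \<epsilon>"
  using assms
proof (induction k arbitrary: \<epsilon>)
  case 0
  have "norm (y t - z t) \<le> \<epsilon>" if "T \<le> real 0 / (4 * C)" "norm (y 0 - z 0) \<le> \<epsilon>" "t \<in> {0..T}" for y z :: "real \<Rightarrow> 'a" and T t
  proof -
    have "t = 0" using that by auto
    with that show ?thesis by simp
  qed
  then show ?case using 0 by blast
next
  case (Suc k)
  obtain \<alpha>1 where a1: "0 < \<alpha>1" "\<And>y z T t. approx_sol y T \<alpha>1 \<Longrightarrow> approx_sol z T \<alpha>1 \<Longrightarrow> T \<le> 1 / (4 * C) \<Longrightarrow>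
     norm (y 0 - z 0) \<le> \<alpha>1 \<Longrightarrow> t \<in> {0..T} \<Longrightarrow> norm (y t - z t) \<le> \<epsilon>"
    using approx_sol_compare_short_small[OF \<open>0 < \<epsilon>\<close>] by metis
  have "0 < min \<epsilon> \<alpha>1" using a1 Suc.prems by simp
  from Suc.IH[OF this] obtain \<alpha>2 where a2: "0 < \<alpha>2" "\<And>y z T t. approx_sol y T \<alpha>2 \<Longrightarrow> approx_sol z T \<alpha>2 \<Longrightarrow> T \<le> real k / (4 * C) \<Longrightarrow>
     norm (y 0 - z 0) \<le> \<alpha>2 \<Longrightarrow> t \<in> {0..T} \<Longrightarrow> norm (y t - z t) \<le> min \<epsilon> \<alpha>1"
    by metis
  define \<alpha> where "\<alpha> = min \<alpha>1 \<alpha>2"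
  define a where "a = real k / (4 * C)"
  have a0: "0 \<le> a" using C_pos by (simp add: a_def)
  have "norm (y t - z t) \<le> \<epsilon>" if y: "approx_sol y T \<alpha>" and z: "approx_sol z T \<alpha>" and T: "T \<le> real (Suc k) / (4 * C)"
    and yz: "norm (y 0 - z 0) \<le> \<alpha>" and t: "t \<in> {0..T}" for y z T t
  proof -
    have early: "norm (y s - z s) \<le> min \<epsilon> \<alpha>1" if "s \<in> {0..min T a}" for s
      using a2(2)[of y "min T a" z s] approx_sol_mono[OF y, of "min T a" \<alpha>2]
        approx_sol_mono[OF z, of "min T a" \<alpha>2] yz that by (auto simp: \<alpha>_def a_def)
    show ?thesis
    proof (cases "t \<le> a")
      case True then show ?thesis using early[of t] t by auto
    next
      case False
      have "norm (y (a + (t - a)) - z (a + (t - a))) \<le> \<epsilon>"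
      proof (rule a1(2)[of "\<lambda>s. y (a + s)" "T - a" "\<lambda>s. z (a + s)" "t - a"])
        show "approx_sol (\<lambda>s. y (a + s)) (T - a) \<alpha>1" "approx_sol (\<lambda>s. z (a + s)) (T - a) \<alpha>1"
          using approx_sol_shift[OF _ a0] y z approx_sol_mono[of _ "T - a" \<alpha> "T - a" \<alpha>1] by (auto simp: \<alpha>_def)
        show "T - a \<le> 1 / (4 * C)" using T unfolding a_def by (simp add: add_divide_distrib)
        show "norm (y (a + 0) - z (a + 0)) \<le> \<alpha>1" using early[of a] a0 False t by auto
        show "t - a \<in> {0..T - a}" using t False by auto
      qed
      then show ?thesis by simp
    qed
  qed
  then show ?case using a1 a2 by (intro exI[of _ \<alpha>]) (auto simp: \<alpha>_def)
qed

lemma approx_sol_compare: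
  assumes "0 < \<epsilon>"
  obtains \<alpha> where "0 < \<alpha>" "\<And>y z t. approx_sol y T \<alpha> \<Longrightarrow> approx_sol z T \<alpha> \<Longrightarrow>
     norm (y 0 - z 0) \<le> \<alpha> \<Longrightarrow> t \<in> {0..T} \<Longrightarrow> norm (y t - z t) \<le> \<epsilon>"
proof -
  obtain k :: nat where "T * (4 * C) \<le> real k" using real_arch_simple by blast
  then have "T \<le> real k / (4 * C)" using C_pos by (simp add: field_simps)
  then show ?thesis using approx_sol_compare_steps[OF assms, of k] that by metis
qed

text \<open>Two sources of defect: replacing \<open>B\<close> by \<open>G\<close> costs at most
  \<open>\<eta> * T\<close>, and the unfinished steps at the two ends of a subinterval cost
  \<open>h * K\<close> times the growth bound each. The summand 1 in \<open>K\<close> covers the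
  difference between \<open>B\<close> and \<open>G\<close>.\<close>

lemma euler_approx_sol:
  assumes B: "\<And>z. norm (B z - G z) \<le> \<eta>" and \<eta>: "\<eta> \<le> 1" and h: "0 < h"
    and K: "K = norm (G 0) + C + 1" and T: "0 \<le> T"
  shows "approx_sol (\<lambda>t. euler B h t x) T (\<eta> * T + 2 * h * K * (exp (K * T) * (1 + norm x)))"
proof -
  have K0: "0 \<le> K" using K C_pos by simp
  have B': "norm (B z) \<le> K * (1 + norm z)" for z
  proof -
    have "norm (B z) \<le> norm (B z - G z) + norm (G z)" by (metis diff_add_cancel norm_triangle_ineq)
    also have "\<dots> \<le> 1 + (norm (G 0) + C) * (1 + norm z)" using B[of z] \<eta> linear_growth[of z] by linarith
    finally show ?thesis using norm_ge_zero[of z] unfolding K distrib_right mult_1 by linarith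
  qed
  have grow: "1 + norm (euler B h t x) \<le> exp (K * T) * (1 + norm x)" if "t \<in> {0..T}" for t
    by (rule euler_growth[OF B' K0 h that])
  have \<eta>0: "0 \<le> \<eta>" using B[of 0] norm_ge_zero order_trans by blast
  define R where "R t = (t - h * nat \<lfloor>t / h\<rfloor>) *\<^sub>R B (euler B h t x)" for t
  have R: "norm (R t) \<le> h * K * (exp (K * T) * (1 + norm x))" if "t \<in> {0..T}" for t
  proof -
    have "real (nat \<lfloor>t / h\<rfloor>) \<le> t / h" "t / h < real (nat \<lfloor>t / h\<rfloor>) + 1" using h that by auto
    then have "0 \<le> t - h * nat \<lfloor>t / h\<rfloor>" "t - h * nat \<lfloor>t / h\<rfloor> \<le> h" using h by (auto simp: field_simps)
    then have "norm (R t) \<le> h * (K * (1 + norm (euler B h t x)))"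
      unfolding R_def norm_scaleR using B'[of "euler B h t x"] by (intro mult_mono) auto
    also have "\<dots> \<le> h * (K * (exp (K * T) * (1 + norm x)))"
      using grow[OF that] h K0 by (intro mult_left_mono) auto
    finally show ?thesis by simp
  qed
  have GI: "(\<lambda>s. G (euler B h s x)) integrable_on {0..T}"
    using has_integral_step_function[OF h T, of "\<lambda>k. G (((\<lambda>x. x + h *\<^sub>R B x) ^^ k) x)"]
    unfolding euler_def by blast
  have BI: "(\<lambda>s. B (euler B h s x)) integrable_on {0..T}"
    using euler_has_integral[OF h T] by blast
  show ?thesis
    unfolding approx_sol_def
  proof (intro conjI allI impI)
    show "bounded ((\<lambda>t. euler B h t x) ` {0..T})"
      unfolding bounded_iff
    proof (intro exI[of _ "exp (K * T) * (1 + norm x)"] ballI)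
      fix v assume "v \<in> (\<lambda>t. euler B h t x) ` {0..T}"
      then obtain t where "v = euler B h t x" "t \<in> {0..T}" by (rule imageE)
      then show "norm v \<le> exp (K * T) * (1 + norm x)" using grow[of t] by simp
    qed
    fix s t assume st: "0 \<le> s \<and> s \<le> t \<and> t \<le> T"
    have Gst: "(\<lambda>s. G (euler B h s x)) integrable_on {s..t}" and Bst: "(\<lambda>s. B (euler B h s x)) integrable_on {s..t}"
      using st integrable_on_subinterval[OF GI] integrable_on_subinterval[OF BI] by auto
    have "integral {0..s} (\<lambda>s. B (euler B h s x)) + integral {s..t} (\<lambda>s. B (euler B h s x)) = integral {0..t} (\<lambda>s. B (euler B h s x))"
      using st by (intro Henstock_Kurzweil_Integration.integral_combine integrable_on_subinterval[OF BI]) auto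
    then have IB: "integral {s..t} (\<lambda>s. B (euler B h s x)) = (euler B h t x + R t) - (euler B h s x + R s)"
      using integral_unique[OF euler_has_integral[OF h, of s B x]] integral_unique[OF euler_has_integral[OF h, of t B x]] st
      by (simp add: R_def algebra_simps)
    have "norm (integral {s..t} (\<lambda>s. B (euler B h s x) - G (euler B h s x))) \<le> integral {s..t} (\<lambda>s. \<eta>)"
      by (rule integral_norm_bound_integral[OF integrable_diff[OF Bst Gst]]) (use B in auto)
    also have "\<dots> = \<eta> * (t - s)" using st by simp
    also have "\<dots> \<le> \<eta> * T" using st \<eta>0 by (intro mult_left_mono) auto
    finally have D: "norm (integral {s..t} (\<lambda>s. B (euler B h s x)) - integral {s..t} (\<lambda>s. G (euler B h s x))) \<le> \<eta> * T"
      using integral_diff[OF Bst Gst] by simp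
    have "euler B h t x - euler B h s x - integral {s..t} (\<lambda>s. G (euler B h s x)) =
      (integral {s..t} (\<lambda>s. B (euler B h s x)) - integral {s..t} (\<lambda>s. G (euler B h s x))) - R t + R s"
      using IB by (simp add: algebra_simps)
    also have "norm \<dots> \<le> \<eta> * T + norm (R t) + norm (R s)"
      using D norm_triangle_ineq[of "(integral {s..t} (\<lambda>s. B (euler B h s x)) - integral {s..t} (\<lambda>s. G (euler B h s x))) - R t" "R s"]
        norm_triangle_ineq4[of "integral {s..t} (\<lambda>s. B (euler B h s x)) - integral {s..t} (\<lambda>s. G (euler B h s x))" "R t"]
      by linarith
    also have "\<dots> \<le> \<eta> * T + 2 * h * K * (exp (K * T) * (1 + norm x))"
      using R[of s] R[of t] st by simp
    finally show "\<exists>I. ((\<lambda>\<tau>. G (euler B h \<tau> x)) has_integral I) {s..t} \<and>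
        norm (euler B h t x - euler B h s x - I) \<le> \<eta> * T + 2 * h * K * (exp (K * T) * (1 + norm x))"
      using Gst by blast
  qed
qed

section \<open>Exact solutions: uniqueness and existence\<close>

lemma solution_approx_sol:
  assumes "\<And>t. t \<in> {0..T} \<Longrightarrow> (y has_vector_derivative G (y t)) (at t within {0..T})"
  shows "approx_sol y T 0"
  unfolding approx_sol_def
proof (intro conjI allI impI)
  have "continuous_on {0..T} y" by (rule continuous_on_vector_derivative) (rule assms)
  then show "bounded (y ` {0..T})"
    using compact_continuous_image compact_imp_bounded by blast
  fix s t assume st: "0 \<le> s \<and> s \<le> t \<and> t \<le> T"
  have "((\<lambda>\<tau>. G (y \<tau>)) has_integral (y t - y s)) {s..t}"
    using st by (intro fundamental_theorem_of_calculus has_vector_derivative_within_subset[OF assms]) auto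
  then show "\<exists>I. ((\<lambda>\<tau>. G (y \<tau>)) has_integral I) {s..t} \<and> norm (y t - y s - I) \<le> 0"
    by (intro exI[of _ "y t - y s"]) simp
qed

lemma solution_unique_forward:
  assumes "\<And>t. (y has_vector_derivative G (y t)) (at t)" "\<And>t. (z has_vector_derivative G (z t)) (at t)"
    and "y 0 = z 0" and "0 \<le> t"
  shows "y t = z t"
proof -
  have y: "approx_sol y t 0" and z: "approx_sol z t 0"
    using assms(1,2) by (auto intro!: solution_approx_sol intro: has_vector_derivative_at_within)
  have "norm (y t - z t) \<le> \<epsilon>" if "0 < \<epsilon>" for \<epsilon>
  proof -
    obtain \<alpha> where "0 < \<alpha>" "\<And>y z s. approx_sol y t \<alpha> \<Longrightarrow> approx_sol z t \<alpha> \<Longrightarrow>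
     norm (y 0 - z 0) \<le> \<alpha> \<Longrightarrow> s \<in> {0..t} \<Longrightarrow> norm (y s - z s) \<le> \<epsilon>"
      using approx_sol_compare[OF \<open>0 < \<epsilon>\<close>, of t] by metis
    then show ?thesis using approx_sol_mono[OF y] approx_sol_mono[OF z] assms(3,4) by simp
  qed
  then have "norm (y t - z t) \<le> 0" by (rule field_le_epsilon[of _ 0, simplified])
  then show ?thesis by simp
qed

text \<open>Euler maps of \<open>G\<close> itself with step \<open>1 / (n + 1)\<close> share the
  initial point and have vanishing defect, so the comparison makes them uniformly Cauchy on
  \<open>{0..T}\<close>, without extraction of a subsequence.\<close>

lemma forward_solution_exists:
  "\<exists>y. y 0 = x \<and> (\<forall>t\<ge>0. (y has_vector_derivative G (y t)) (at t within {0..}))"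
proof -
  define Y where "Y n t = euler G (1 / (real n + 1)) t x" for n t
  define K where "K = norm (G 0) + C + 1"
  have Yap: "approx_sol (Y n) T (2 * (1 / (real n + 1)) * K * (exp (K * T) * (1 + norm x)))" if "0 \<le> T" for n T
    using euler_approx_sol[of G 0 "1 / (real n + 1)" K T x] that by (simp add: Y_def[abs_def] K_def)
  have Y0: "Y n 0 = x" for n by (simp add: Y_def)
  have small: "\<exists>N. \<forall>n\<ge>N. approx_sol (Y n) T \<alpha>" if T: "0 \<le> T" and \<alpha>: "0 < \<alpha>" for T \<alpha>
  proof -
    have "(\<lambda>n. 2 * (1 / (real n + 1)) * K * (exp (K * T) * (1 + norm x))) \<longlonglongrightarrow> 2 * 0 * K * (exp (K * T) * (1 + norm x))"
      using LIMSEQ_inverse_real_of_nat by (intro tendsto_intros) (simp add: inverse_eq_divide add.commute)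
    then have "eventually (\<lambda>n. 2 * (1 / (real n + 1)) * K * (exp (K * T) * (1 + norm x)) < \<alpha>) sequentially"
      using \<alpha> by (auto dest: order_tendstoD(2))
    then show ?thesis
      using Yap[OF T] approx_sol_mono by (meson eventually_sequentially less_imp_le order.refl)
  qed
  have cauchy: "\<exists>N. \<forall>m\<ge>N. \<forall>n\<ge>N. \<forall>t\<in>{0..T}. norm (Y m t - Y n t) \<le> \<epsilon>" if T: "0 \<le> T" and \<epsilon>: "0 < \<epsilon>" for T \<epsilon>
  proof -
    obtain \<alpha> where \<alpha>: "0 < \<alpha>" "\<And>y z s. approx_sol y T \<alpha> \<Longrightarrow> approx_sol z T \<alpha> \<Longrightarrow>
     norm (y 0 - z 0) \<le> \<alpha> \<Longrightarrow> s \<in> {0..T} \<Longrightarrow> norm (y s - z s) \<le> \<epsilon>"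
      using approx_sol_compare[OF \<epsilon>, of T] by metis
    obtain N where "\<forall>n\<ge>N. approx_sol (Y n) T \<alpha>" using small[OF T \<alpha>(1)] by blast
    then have "norm (Y m t - Y n t) \<le> \<epsilon>" if "m \<ge> N" "n \<ge> N" "t \<in> {0..T}" for m n t
      using that \<alpha>(1) Y0 by (intro \<alpha>(2)) auto
    then show ?thesis by blast
  qed
  define y where "y t = lim (\<lambda>n. Y n t)" for t
  have conv: "(\<lambda>n. Y n t) \<longlonglongrightarrow> y t" if "0 \<le> t" for t
  proof -
    have "Cauchy (\<lambda>n. Y n t)"
      unfolding Cauchy_def
    proof (intro allI impI)
      fix e :: real assume "0 < e"
      then obtain N where "\<forall>m\<ge>N. \<forall>n\<ge>N. \<forall>s\<in>{0..t}. norm (Y m s - Y n s) \<le> e / 2"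
        using cauchy[OF \<open>0 \<le> t\<close>, of "e / 2"] by auto
      then have "\<forall>m\<ge>N. \<forall>n\<ge>N. norm (Y m t - Y n t) \<le> e / 2" using that by auto
      then show "\<exists>M. \<forall>m\<ge>M. \<forall>n\<ge>M. dist (Y m t) (Y n t) < e"
        using \<open>0 < e\<close> by (intro exI[of _ N]) (force simp: dist_norm)
    qed
    then show ?thesis unfolding y_def using Cauchy_convergent convergent_LIMSEQ_iff by blast
  qed
  have unif: "\<exists>N. \<forall>n\<ge>N. \<forall>t\<in>{0..T}. norm (Y n t - y t) \<le> \<epsilon>" if T: "0 \<le> T" and \<epsilon>: "0 < \<epsilon>" for T \<epsilon>
  proof -
    obtain N where N: "\<forall>m\<ge>N. \<forall>n\<ge>N. \<forall>t\<in>{0..T}. norm (Y m t - Y n t) \<le> \<epsilon>"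
      using cauchy[OF T \<epsilon>] by blast
    have "norm (Y n t - y t) \<le> \<epsilon>" if "n \<ge> N" "t \<in> {0..T}" for n t
    proof (rule Lim_bounded)
      show "(\<lambda>m. norm (Y n t - Y m t)) \<longlonglongrightarrow> norm (Y n t - y t)"
        using that by (intro tendsto_intros conv) auto
      show "\<forall>m\<ge>N. norm (Y n t - Y m t) \<le> \<epsilon>" using N that by blast
    qed
    then show ?thesis by blast
  qed
  have int: "((\<lambda>\<tau>. G (y \<tau>)) has_integral (y t - x)) {0..t}" if t: "0 \<le> t" for t
  proof -
    have app: "\<exists>n I. ((\<lambda>\<tau>. G (Y n \<tau>)) has_integral I) {0..t} \<and> norm (Y n t - x - I) \<le> e \<and> norm (Y n t - y t) \<le> e \<and>
      (\<forall>s\<in>{0..t}. norm (G (y s) - G (Y n s)) \<le> e)" if e: "0 < e" for e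
    proof -
      obtain d where d: "0 < d" "\<And>a b. dist a b < d \<Longrightarrow> dist (G a) (G b) < e"
        using uniformly_continuous e unfolding uniformly_continuous_on_def by (metis UNIV_I dist_commute)
      obtain N1 where N1: "\<forall>n\<ge>N1. \<forall>s\<in>{0..t}. norm (Y n s - y s) \<le> min e (d/2)"
        using unif[OF t, of "min e (d/2)"] e d by auto
      obtain N2 where "\<forall>n\<ge>N2. approx_sol (Y n) t e" using small[OF t e] by blast
      then obtain I where I: "((\<lambda>\<tau>. G (Y (max N1 N2) \<tau>)) has_integral I) {0..t}"
          "norm (Y (max N1 N2) t - Y (max N1 N2) 0 - I) \<le> e"
        unfolding approx_sol_def using t by (meson max.cobounded2 order.refl)
      have "norm (G (y s) - G (Y (max N1 N2) s)) \<le> e" if "s \<in> {0..t}" for s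
      proof -
        have "norm (Y (max N1 N2) s - y s) \<le> d / 2" using N1 that by auto
        then have "dist (y s) (Y (max N1 N2) s) < d" using d by (simp add: dist_norm norm_minus_commute)
        then show ?thesis using d by (auto simp: dist_norm less_imp_le)
      qed
      moreover have "norm (Y (max N1 N2) t - y t) \<le> e" using N1 t by auto
      ultimately show ?thesis using I by (intro exI[of _ "max N1 N2"] exI[of _ I]) (auto simp: Y_def)
    qed
    have GI: "(\<lambda>\<tau>. G (y \<tau>)) integrable_on {0..t}"
      unfolding box_real(2)[symmetric]
    proof (rule integrable_uniform_limit)
      fix e :: real assume "0 < e"
      from app[OF this] obtain n I where "((\<lambda>\<tau>. G (Y n \<tau>)) has_integral I) {0..t}" "\<forall>s\<in>{0..t}. norm (G (y s) - G (Y n s)) \<le> e" by blast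
      then show "\<exists>g. (\<forall>s\<in>cbox 0 t. norm (G (y s) - g s) \<le> e) \<and> g integrable_on cbox 0 t"
        by (intro exI[of _ "\<lambda>s. G (Y n s)"]) auto
    qed
    have "norm (y t - x - integral {0..t} (\<lambda>\<tau>. G (y \<tau>))) \<le> e" if "0 < e" for e
    proof -
      \<comment> \<open>The denominator counts the errors: one for the defect, one at the end point,
        and \<open>t\<close> for the integrand.\<close>
      have "0 < e / (t + 2)" using that t by simp
      from app[OF this] obtain n I where I: "((\<lambda>\<tau>. G (Y n \<tau>)) has_integral I) {0..t}" "norm (Y n t - x - I) \<le> e / (t + 2)"
        "norm (Y n t - y t) \<le> e / (t + 2)" "\<forall>s\<in>{0..t}. norm (G (y s) - G (Y n s)) \<le> e / (t + 2)" by blast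
      have "norm (integral {0..t} (\<lambda>\<tau>. G (y \<tau>) - G (Y n \<tau>))) \<le> integral {0..t} (\<lambda>\<tau>. e / (t + 2))"
        using I GI by (intro integral_norm_bound_integral integrable_diff) (auto intro: has_integral_integrable)
      also have "integral {0..t} (\<lambda>\<tau>. G (y \<tau>) - G (Y n \<tau>)) = integral {0..t} (\<lambda>\<tau>. G (y \<tau>)) - I"
        using integral_diff[OF GI has_integral_integrable[OF I(1)]] integral_unique[OF I(1)] by simp
      finally have "norm (integral {0..t} (\<lambda>\<tau>. G (y \<tau>)) - I) \<le> t * (e / (t + 2))" using t by simp
      moreover have dec: "y t - x - integral {0..t} (\<lambda>\<tau>. G (y \<tau>)) = (Y n t - x - I) - (Y n t - y t) - (integral {0..t} (\<lambda>\<tau>. G (y \<tau>)) - I)"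
        by simp
      ultimately have "norm (y t - x - integral {0..t} (\<lambda>\<tau>. G (y \<tau>))) \<le> e / (t + 2) + e / (t + 2) + t * (e / (t + 2))"
        using I(2,3) norm_triangle_ineq4[of "(Y n t - x - I) - (Y n t - y t)" "integral {0..t} (\<lambda>\<tau>. G (y \<tau>)) - I"]
          norm_triangle_ineq4[of "Y n t - x - I" "Y n t - y t"] unfolding dec by linarith
      also have "\<dots> = (t + 2) * (e / (t + 2))" by algebra
      also have "\<dots> = e" using t by simp
      finally show ?thesis .
    qed
    then have "norm (y t - x - integral {0..t} (\<lambda>\<tau>. G (y \<tau>))) \<le> 0" by (rule field_le_epsilon[of _ 0, simplified])
    then have "y t - x = integral {0..t} (\<lambda>\<tau>. G (y \<tau>))" by simp
    then show ?thesis using GI by (simp add: has_integral_integral)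
  qed
  have y_eq: "y t = x + integral {0..t} (\<lambda>\<tau>. G (y \<tau>))" if "0 \<le> t" for t
    using integral_unique[OF int[OF that]] by simp
  have der: "(y has_vector_derivative G (y t)) (at t within {0..})" if t: "0 \<le> t" for t
  proof -
    \<comment> \<open>Bootstrapping: the integral equation makes \<open>y\<close> continuous, hence
      the integrand continuous, hence \<open>y\<close> differentiable.\<close>
    have "continuous_on {0..t + 1} (\<lambda>s. x + integral {0..s} (\<lambda>\<tau>. G (y \<tau>)))"
      using int[of "t + 1"] t by (intro continuous_intros indefinite_integral_continuous_1) auto
    then have "continuous_on {0..t + 1} y"
      by (rule continuous_on_eq) (use y_eq in auto)
    then have c: "continuous_on {0..t + 1} (\<lambda>\<tau>. G (y \<tau>))"
      by (rule continuous_on_compose2[OF continuous[of UNIV]]) auto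
    have "((\<lambda>s. x + integral {0..s} (\<lambda>\<tau>. G (y \<tau>))) has_vector_derivative (0 + G (y t))) (at t within {0..t + 1})"
      using t by (intro has_vector_derivative_add has_vector_derivative_const integral_has_vector_derivative c) auto
    then have "(y has_vector_derivative G (y t)) (at t within {0..t + 1})"
      using t y_eq by (intro has_vector_derivative_transform[of t "{0..t + 1}" y]) auto
    moreover have "at t within {0..t + 1} = at t within {0..}"
      by (rule at_within_nhd[of _ "{..<t + 1}"]) auto
    ultimately show ?thesis by simp
  qed
  have "y 0 = x" using y_eq[of 0] by simp
  then show ?thesis using der by (intro exI[of _ y]) auto
qed

lemma log_lipschitz_field_uminus: "log_lipschitz_field (\<lambda>x. - G x) C"
  by unfold_locales (use C_pos log_lip in \<open>auto simp: norm_minus_commute\<close>)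

text \<open>Negative times are forward times of \<open>- G\<close>; at 0 the two one-sided
  derivatives both equal \<open>G x\<close>.\<close>

lemma solution_exists: "\<exists>y. y 0 = x \<and> (\<forall>t. (y has_vector_derivative G (y t)) (at t))"
proof -
  interpret neg: log_lipschitz_field "\<lambda>x. - G x" C by (rule log_lipschitz_field_uminus)
  obtain y where y: "y 0 = x" "\<And>t. 0 \<le> t \<Longrightarrow> (y has_vector_derivative G (y t)) (at t within {0..})"
    using forward_solution_exists[of x] by auto
  obtain z where z: "z 0 = x" "\<And>t. 0 \<le> t \<Longrightarrow> (z has_vector_derivative - G (z t)) (at t within {0..})"
    using neg.forward_solution_exists[of x] by auto
  define w where "w t = (if 0 \<le> t then y t else z (- t))" for t
  have right: "(w has_vector_derivative G (w t)) (at t within {0..})" if "0 \<le> t" for t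
    using has_vector_derivative_transform[of t "{0..}" w y "G (y t)"] y(2)[OF that] that by (simp add: w_def)
  have left: "(w has_vector_derivative G (w t)) (at t within {..0})" if "t \<le> 0" for t
  proof -
    have wz: "w s = z (- s)" if "s \<le> 0" for s using that y(1) z(1) by (auto simp: w_def)
    have "((z \<circ> uminus) has_vector_derivative (- 1) *\<^sub>R (- G (z (- t)))) (at t within {..0})"
    proof (rule vector_diff_chain_within)
      show "(uminus has_vector_derivative - 1) (at t within {..0})"
        by (auto intro!: derivative_eq_intros simp: has_vector_derivative_def)
      have "uminus ` {..0::real} = {0..}" by (auto simp: image_iff intro: exI[of _ "- x" for x])
      then show "(z has_vector_derivative - G (z (- t))) (at (- t) within uminus ` {..0})"
        using z(2)[of "- t"] that by simp
    qed
    then show ?thesis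
      using has_vector_derivative_transform[of t "{..0}" w "z \<circ> uminus" "G (z (- t))"] that wz by simp
  qed
  have "(w has_vector_derivative G (w t)) (at t)" for t
  proof (cases t "0::real" rule: linorder_cases)
    case less
    then have "at t within {..0} = at t" by (intro at_within_interior) auto
    then show ?thesis using left[of t] less by simp
  next
    case greater
    then have "at t within {0..} = at t" by (intro at_within_interior) auto
    then show ?thesis using right[of t] greater by simp
  next
    case equal
    have "(w has_derivative (\<lambda>h. h *\<^sub>R G (w t))) (at t within {..0} \<union> {0..})"
      using left[of t] right[of t] equal unfolding has_vector_derivative_def has_derivative_within
      by (auto simp: Lim_within_Un)
    moreover have "{..0} \<union> {0..} = (UNIV :: real set)" by auto
    ultimately show ?thesis by (simp add: has_vector_derivative_def)
  qed
  moreover have "w 0 = x" using y by (simp add: w_def)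
  ultimately show ?thesis by (intro exI[of _ w]) auto
qed

lemma solution_unique:
  assumes y: "\<And>t. (y has_vector_derivative G (y t)) (at t)" and z: "\<And>t. (z has_vector_derivative G (z t)) (at t)"
    and "y 0 = z 0"
  shows "y t = z t"
proof (cases "0 \<le> t")
  case True then show ?thesis using solution_unique_forward[OF assms] by simp
next
  case False
  interpret neg: log_lipschitz_field "\<lambda>x. - G x" C by (rule log_lipschitz_field_uminus)
  have rev: "((\<lambda>s. v (- s)) has_vector_derivative - G (v (- s))) (at s)"
    if "\<And>t. (v has_vector_derivative G (v t)) (at t)" for v s
  proof -
    have "(uminus has_vector_derivative - 1) (at s)"
      by (auto intro!: derivative_eq_intros simp: has_vector_derivative_def)
    from vector_diff_chain_at[OF this that] show ?thesis by (simp add: o_def)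
  qed
  have "(\<lambda>s. y (- s)) (- t) = (\<lambda>s. z (- s)) (- t)"
    using neg.solution_unique_forward[of "\<lambda>s. y (- s)" "\<lambda>s. z (- s)" "- t"] rev[OF y] rev[OF z] assms(3) False by simp
  then show ?thesis by simp
qed

section \<open>The flow map: group law, time reversal, joint continuity\<close>

definition flow :: "real \<Rightarrow> 'a \<Rightarrow> 'a" where
  "flow t x = (SOME y. y 0 = x \<and> (\<forall>t. (y has_vector_derivative G (y t)) (at t))) t"

lemma flow_0 [simp]: "flow 0 x = x"
  and flow_has_vector_derivative: "((\<lambda>t. flow t x) has_vector_derivative G (flow t x)) (at t)"
proof -
  let ?y = "SOME y. y 0 = x \<and> (\<forall>t. (y has_vector_derivative G (y t)) (at t))"
  have "?y 0 = x \<and> (\<forall>t. (?y has_vector_derivative G (?y t)) (at t))"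
    by (rule someI_ex[OF solution_exists])
  then show "flow 0 x = x" "((\<lambda>t. flow t x) has_vector_derivative G (flow t x)) (at t)"
    unfolding flow_def by auto
qed

lemma flow_unique:
  assumes "\<And>t. (y has_vector_derivative G (y t)) (at t)"
  shows "y t = flow t (y 0)"
  using solution_unique[of y "\<lambda>t. flow t (y 0)" t] assms flow_has_vector_derivative by simp

lemma flow_add: "flow (s + t) x = flow s (flow t x)"
proof -
  have "((\<lambda>s. flow (s + t) x) has_vector_derivative G (flow (s + t) x)) (at s)" for s
  proof -
    have "((\<lambda>s. s + t) has_vector_derivative 1) (at s)"
      by (auto intro!: derivative_eq_intros simp: has_vector_derivative_def)
    from vector_diff_chain_at[OF this flow_has_vector_derivative] show ?thesis by (simp add: o_def)
  qed
  from flow_unique[of "\<lambda>s. flow (s + t) x", OF this] show ?thesis by simp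
qed

lemma flow_minus [simp]: "flow (- t) (flow t x) = x" "flow t (flow (- t) x) = x"
  by (simp_all add: flow_add[symmetric])

text \<open>The bridge to negative times: the locale is stable under passing from \<open>G\<close>
  to \<open>- G\<close>, so what is proved for nonnegative times can be reflected.\<close>

lemma flow_uminus: "log_lipschitz_field.flow (\<lambda>x. - G x) t x = flow (- t) x"
proof -
  interpret neg: log_lipschitz_field "\<lambda>x. - G x" C by (rule log_lipschitz_field_uminus)
  have "((\<lambda>s. flow (- s) x) has_vector_derivative - G (flow (- s) x)) (at s)" for s
  proof -
    have "(uminus has_vector_derivative - 1) (at s)"
      by (auto intro!: derivative_eq_intros simp: has_vector_derivative_def)
    from vector_diff_chain_at[OF this flow_has_vector_derivative] show ?thesis by (simp add: o_def)
  qed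
  from neg.flow_unique[of "\<lambda>s. flow (- s) x", OF this] show ?thesis by simp
qed

lemma flow_approx_sol: "approx_sol (\<lambda>t. flow t x) T 0"
  by (rule solution_approx_sol, rule has_vector_derivative_at_within, rule flow_has_vector_derivative)

text \<open>The modulus \<open>\<alpha>\<close> does not depend on the initial points, since exact
  trajectories have defect 0 wherever they start.\<close>

lemma flow_uniformly_continuous_forward:
  assumes "0 < \<epsilon>"
  obtains \<alpha> where "0 < \<alpha>" "\<And>x x' t. norm (x - x') \<le> \<alpha> \<Longrightarrow> t \<in> {0..T} \<Longrightarrow> norm (flow t x - flow t x') \<le> \<epsilon>"
proof -
  obtain \<alpha> where \<alpha>: "0 < \<alpha>" "\<And>y z t. approx_sol y T \<alpha> \<Longrightarrow> approx_sol z T \<alpha> \<Longrightarrow>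
     norm (y 0 - z 0) \<le> \<alpha> \<Longrightarrow> t \<in> {0..T} \<Longrightarrow> norm (y t - z t) \<le> \<epsilon>"
    using approx_sol_compare[OF assms, of T] by metis
  have "norm (flow t x - flow t x') \<le> \<epsilon>" if "norm (x - x') \<le> \<alpha>" "t \<in> {0..T}" for x x' t
    using \<alpha>(2)[of "\<lambda>t. flow t x" "\<lambda>t. flow t x'" t] approx_sol_mono[OF flow_approx_sol order.refl, of \<alpha>] \<alpha>(1) that by simp
  then show ?thesis by (rule that[OF \<alpha>(1)])
qed

lemma flow_uniformly_continuous:
  assumes "0 < \<epsilon>"
  obtains \<alpha> where "0 < \<alpha>" "\<And>x x' t. norm (x - x') \<le> \<alpha> \<Longrightarrow> \<bar>t\<bar> \<le> T \<Longrightarrow> norm (flow t x - flow t x') \<le> \<epsilon>"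
proof -
  interpret neg: log_lipschitz_field "\<lambda>x. - G x" C by (rule log_lipschitz_field_uminus)
  obtain \<alpha> where a: "0 < \<alpha>" "\<And>x x' t. norm (x - x') \<le> \<alpha> \<Longrightarrow> t \<in> {0..T} \<Longrightarrow> norm (flow t x - flow t x') \<le> \<epsilon>"
    using flow_uniformly_continuous_forward[OF assms] by metis
  obtain \<beta> where b: "0 < \<beta>" "\<And>x x' t. norm (x - x') \<le> \<beta> \<Longrightarrow> t \<in> {0..T} \<Longrightarrow> norm (neg.flow t x - neg.flow t x') \<le> \<epsilon>"
    using neg.flow_uniformly_continuous_forward[OF assms] by metis
  have "norm (flow t x - flow t x') \<le> \<epsilon>" if "norm (x - x') \<le> min \<alpha> \<beta>" "\<bar>t\<bar> \<le> T" for x x' t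
  proof (cases "0 \<le> t")
    case True then show ?thesis using a(2) that by simp
  next
    case False then show ?thesis using b(2)[of x x' "- t"] that by (simp add: flow_uminus)
  qed
  then show ?thesis using a(1) b(1) that[of "min \<alpha> \<beta>"] by simp
qed

text \<open>Uniform continuity in \<open>x\<close> over a time window, together with continuity in
  \<open>t\<close> at one fixed \<open>x\<close>, gives joint continuity.\<close>

lemma flow_continuous: "continuous_on UNIV (\<lambda>(t, x). flow t x)"
  unfolding continuous_on_iff
proof (clarsimp, goal_cases)
  case (1 t x e)
  then have e: "0 < e / 2" by simp
  obtain \<alpha> where a: "0 < \<alpha>" "\<And>y y' s. norm (y - y') \<le> \<alpha> \<Longrightarrow> \<bar>s\<bar> \<le> \<bar>t\<bar> + 1 \<Longrightarrow> norm (flow s y - flow s y') \<le> e / 2"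
    using flow_uniformly_continuous[OF e] by metis
  have "continuous (at t) (\<lambda>t. flow t x)"
    by (rule has_vector_derivative_continuous[OF flow_has_vector_derivative])
  then obtain d where d: "0 < d" "\<And>s. dist s t < d \<Longrightarrow> dist (flow s x) (flow t x) < e / 2"
    using e unfolding continuous_at_eps_delta by metis
  have "dist (flow s y) (flow t x) < e" if "dist (s, y) (t, x) < min (min 1 d) \<alpha>" for s y
  proof -
    have st: "dist s t < min (min 1 d) \<alpha>" "dist y x < min (min 1 d) \<alpha>"
      using that dist_fst_le[of "(s, y)" "(t, x)"] dist_snd_le[of "(s, y)" "(t, x)"] by auto
    then have "norm (flow s y - flow s x) \<le> e / 2"
      by (intro a(2)) (auto simp: dist_norm)
    moreover have "dist (flow s x) (flow t x) < e / 2" using d st by auto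
    ultimately show ?thesis using dist_triangle[of "flow s y" "flow t x" "flow s x"] by (simp add: dist_norm)
  qed
  then show ?case using a(1) d(1) by (intro exI[of _ "min (min 1 d) \<alpha>"]) auto
qed

lemma flow_continuous_on [continuous_intros]:
  "continuous_on S f \<Longrightarrow> continuous_on S g \<Longrightarrow> continuous_on S (\<lambda>x. flow (f x) (g x))"
  using continuous_on_compose2[OF flow_continuous continuous_on_Pair[of S f g]] by simp

text \<open>One threshold bounds both the field error and the step. Uniformity is on balls, because
  the defect of Euler maps grows with \<open>1 + norm x\<close>.\<close>

lemma euler_converges:
  assumes "0 < \<epsilon>" "0 \<le> T"
  obtains \<eta> where "0 < \<eta>" "\<And>B h x t. (\<And>z. norm (B z - G z) \<le> \<eta>) \<Longrightarrow> 0 < h \<Longrightarrow> h \<le> \<eta> \<Longrightarrow> norm x \<le> R \<Longrightarrow>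
    t \<in> {0..T} \<Longrightarrow> norm (euler B h t x - flow t x) \<le> \<epsilon>"
proof -
  obtain \<alpha> where \<alpha>: "0 < \<alpha>" "\<And>y z t. approx_sol y T \<alpha> \<Longrightarrow> approx_sol z T \<alpha> \<Longrightarrow>
     norm (y 0 - z 0) \<le> \<alpha> \<Longrightarrow> t \<in> {0..T} \<Longrightarrow> norm (y t - z t) \<le> \<epsilon>"
    using approx_sol_compare[OF assms(1), of T] by metis
  define K where "K = norm (G 0) + C + 1"
  have K: "0 \<le> K" using C_pos by (simp add: K_def)
  define D where "D = T + 2 * K * (exp (K * T) * (1 + \<bar>R\<bar>))"
  have D: "0 \<le> D" using K assms by (simp add: D_def)
  define \<eta> where "\<eta> = min 1 (\<alpha> / (D + 1))"
  have \<eta>: "0 < \<eta>" "\<eta> \<le> 1" using \<alpha>(1) D by (auto simp: \<eta>_def)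
  have "\<eta> * D \<le> \<alpha> / (D + 1) * D" using D by (intro mult_right_mono) (auto simp: \<eta>_def)
  also have "\<dots> \<le> \<alpha>" using D \<alpha>(1) by (simp add: field_simps)
  finally have \<eta>D: "\<eta> * D \<le> \<alpha>" .
  have "norm (euler B h t x - flow t x) \<le> \<epsilon>"
    if B: "\<And>z. norm (B z - G z) \<le> \<eta>" and h: "0 < h" "h \<le> \<eta>" and x: "norm x \<le> R" and t: "t \<in> {0..T}" for B h x t
  proof -
    have "\<eta> * T + 2 * h * K * (exp (K * T) * (1 + norm x)) \<le> \<eta> * T + 2 * \<eta> * K * (exp (K * T) * (1 + \<bar>R\<bar>))"
      using h x K by (intro add_left_mono mult_mono) auto
    also have "\<dots> = \<eta> * D" by (simp add: D_def algebra_simps)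
    finally have le: "\<eta> * T + 2 * h * K * (exp (K * T) * (1 + norm x)) \<le> \<alpha>" using \<eta>D by simp
    have "approx_sol (\<lambda>t. euler B h t x) T \<alpha>"
      using approx_sol_mono[OF euler_approx_sol[OF B \<eta>(2) h(1) K_def assms(2)] order.refl le] .
    moreover have "approx_sol (\<lambda>t. flow t x) T \<alpha>"
      using approx_sol_mono[OF flow_approx_sol order.refl, of \<alpha>] \<alpha>(1) by simp
    ultimately show ?thesis
      using \<alpha>(2)[of "\<lambda>t. euler B h t x" "\<lambda>t. flow t x" t] \<alpha>(1) t by simp
  qed
  then show ?thesis by (rule that[OF \<eta>(1)])
qed

end

section \<open>Change of variables for perturbations of the identity\<close>

text \<open>The change of variables formula of the library needs a well-ordered index type.\<close>

typedef ('a::finite) ordered_copy = "UNIV :: 'a set" ..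

lemma bij_Rep_ordered_copy: "bij (Rep_ordered_copy :: 'a::finite ordered_copy \<Rightarrow> 'a)"
  by (metis Abs_ordered_copy_inverse Rep_ordered_copy_inverse UNIV_I bijI')

instance ordered_copy :: (finite) finite
proof
  show "finite (UNIV :: 'a ordered_copy set)"
    using bij_betw_finite[OF bij_Rep_ordered_copy] by simp
qed

instantiation ordered_copy :: (finite) wellorder
begin

definition index_ordered_copy :: "'a ordered_copy \<Rightarrow> nat" where
  "index_ordered_copy = (SOME f. inj f)"

definition less_eq_ordered_copy :: "'a ordered_copy \<Rightarrow> 'a ordered_copy \<Rightarrow> bool" where
  "x \<le> y \<longleftrightarrow> index_ordered_copy x \<le> index_ordered_copy y"

definition less_ordered_copy :: "'a ordered_copy \<Rightarrow> 'a ordered_copy \<Rightarrow> bool" where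
  "x < y \<longleftrightarrow> index_ordered_copy x < index_ordered_copy y"

instance
proof
  have "\<exists>f :: 'a ordered_copy \<Rightarrow> nat. inj f"
    using finite_imp_inj_to_nat_seg[of "UNIV :: 'a ordered_copy set"] by auto
  then have inj: "inj (index_ordered_copy :: 'a ordered_copy \<Rightarrow> nat)"
    unfolding index_ordered_copy_def by (rule someI_ex)
  fix x y z :: "'a ordered_copy"
  show "(x < y) = (x \<le> y \<and> \<not> y \<le> x)" "x \<le> x" "x \<le> y \<or> y \<le> x"
    by (auto simp: less_eq_ordered_copy_def less_ordered_copy_def)
  show "x \<le> y \<Longrightarrow> y \<le> z \<Longrightarrow> x \<le> z"
    by (auto simp: less_eq_ordered_copy_def)
  show "x \<le> y \<Longrightarrow> y \<le> x \<Longrightarrow> x = y"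
    using inj by (auto simp: less_eq_ordered_copy_def dest: injD)
  show "P x" if step: "\<And>x. (\<And>y. y < x \<Longrightarrow> P y) \<Longrightarrow> P x" for P and x :: "'a ordered_copy"
    by (induction "index_ordered_copy x" arbitrary: x rule: less_induct)
      (metis step less_ordered_copy_def)
qed

end

definition to_copy :: "real ^ 'n \<Rightarrow> real ^ 'n::finite ordered_copy" where
  "to_copy x = (\<chi> i. x $ Rep_ordered_copy i)"

definition from_copy :: "real ^ 'n ordered_copy \<Rightarrow> real ^ 'n::finite" where
  "from_copy x = (\<chi> i. x $ Abs_ordered_copy i)"

lemma copy_inverse [simp]: "from_copy (to_copy x) = x" "to_copy (from_copy y) = y"
  by (simp_all add: to_copy_def from_copy_def vec_eq_iff Rep_ordered_copy_inverse Abs_ordered_copy_inverse)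

lemma linear_copy: "linear to_copy" "linear from_copy"
  by (auto intro!: linearI simp: to_copy_def from_copy_def vec_eq_iff)

lemma bounded_linear_copy: "bounded_linear to_copy" "bounded_linear from_copy"
  using linear_copy linear_conv_bounded_linear by blast+

lemma measurable_copy [measurable]:
  "to_copy \<in> borel_measurable borel" "from_copy \<in> borel_measurable borel"
  using bounded_linear_copy by (auto intro: borel_measurable_continuous_onI linear_continuous_on)

section \<open>Transport of Lebesgue measure and determinants to the ordered index type\<close>

lemma emeasure_lborel_box_vec:
  fixes l u :: "real ^ 'n"
  assumes "\<And>b. b \<in> Basis \<Longrightarrow> l \<bullet> b \<le> u \<bullet> b"
  shows "emeasure lborel (box l u) = (\<Prod>i\<in>UNIV. u $ i - l $ i)"
proof -
  have "(\<Prod>b\<in>Basis. (u - l) \<bullet> b) = (\<Prod>i\<in>UNIV. u $ i - l $ i)"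
    unfolding Basis_vec_def by (simp add: prod.UNION_disjoint inner_axis axis_eq_axis)
  then show ?thesis using assms by (simp add: emeasure_lborel_box)
qed

lemma distr_to_copy: "distr lborel borel (to_copy :: real ^ 'n \<Rightarrow> real ^ 'n::finite ordered_copy) = lborel"
proof (rule lborel_eqI[symmetric])
  fix l u :: "real ^ 'n ordered_copy"
  assume le: "\<And>b. b \<in> Basis \<Longrightarrow> l \<bullet> b \<le> u \<bullet> b"
  have le': "l $ i \<le> u $ i" for i
  proof -
    have "axis i 1 \<in> (Basis :: (real ^ 'n ordered_copy) set)" by (auto simp: Basis_vec_def)
    from le[OF this] show ?thesis by (simp add: inner_axis)
  qed
  have pre: "to_copy -` box l u = box (from_copy l) (from_copy u)"
    unfolding to_copy_def from_copy_def box_def Basis_vec_def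
    by (auto simp: inner_axis) (metis Rep_ordered_copy_inverse Abs_ordered_copy_inverse UNIV_I)+
  have "emeasure (distr lborel borel to_copy) (box l u) = emeasure lborel (box (from_copy l) (from_copy u))"
    by (subst emeasure_distr) (auto simp: pre)
  also have "\<dots> = (\<Prod>i\<in>UNIV. from_copy u $ i - from_copy l $ i)"
    using le' by (intro emeasure_lborel_box_vec) (auto simp: from_copy_def Basis_vec_def inner_axis)
  also have "(\<Prod>i\<in>UNIV. from_copy u $ i - from_copy l $ i) = (\<Prod>i\<in>UNIV. u $ i - l $ i)"
    unfolding from_copy_def
    by (intro prod.reindex_bij_witness[of _ Rep_ordered_copy Abs_ordered_copy])
      (auto simp: Rep_ordered_copy_inverse Abs_ordered_copy_inverse)
  also have "\<dots> = (\<Prod>b\<in>Basis. (u - l) \<bullet> b)"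
    unfolding Basis_vec_def by (simp add: prod.UNION_disjoint inner_axis axis_eq_axis)
  finally show "emeasure (distr lborel borel (to_copy :: real ^ 'n \<Rightarrow> _)) (box l u) = (\<Prod>b\<in>Basis. (u - l) \<bullet> b)" .
qed simp

text \<open>Rows and columns are relabelled together: permutations are conjugated by
  \<open>f\<close>, which preserves their signs.\<close>

lemma det_reindex:
  fixes A :: "real ^ 'n ^ 'n" and f :: "'m::finite \<Rightarrow> 'n::finite"
  assumes "bij f"
  shows "det (\<chi> i j. A $ f i $ f j) = det A"
proof -
  have inj: "inj_on f UNIV" using assms by (simp add: bij_def)
  have "(\<Sum>p | p permutes (UNIV :: 'm set). of_int (sign (map_permutation UNIV f p)) * (\<Prod>i\<in>UNIV. A $ i $ map_permutation UNIV f p i)) = det A"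
    unfolding det_def
  proof (rule sum.reindex_bij_witness[of _ "map_permutation UNIV (inv f)" "map_permutation UNIV f"])
    fix p assume p: "p \<in> {p. p permutes (UNIV :: 'n set)}"
    show "map_permutation UNIV f (map_permutation UNIV (inv f) p) = p"
      by (rule map_permutation_compose_inv[where A = UNIV]) (use p assms in \<open>auto simp: bij_imp_bij_inv bij_is_surj surj_f_inv_f\<close>)
    show "map_permutation UNIV (inv f) p \<in> {p. p permutes (UNIV :: 'm set)}"
      using p map_permutation_permutes[OF bij_imp_bij_inv[OF assms]] by auto
  next
    fix p assume p: "p \<in> {p. p permutes (UNIV :: 'm set)}"
    show "map_permutation UNIV (inv f) (map_permutation UNIV f p) = p"
      by (rule map_permutation_compose_inv[where A = UNIV]) (use p assms in \<open>auto simp: bij_is_inj\<close>)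
    show "map_permutation UNIV f p \<in> {p. p permutes (UNIV :: 'n set)}"
      using p map_permutation_permutes[OF assms] by auto
  qed auto
  then have "det A = (\<Sum>p | p permutes (UNIV :: 'm set). of_int (sign (map_permutation UNIV f p)) * (\<Prod>i\<in>UNIV. A $ i $ map_permutation UNIV f p i))" by simp
  also have "\<dots> = (\<Sum>p | p permutes (UNIV :: 'm set). of_int (sign p) * (\<Prod>i\<in>UNIV. A $ f i $ f (p i)))"
  proof (rule sum.cong[OF refl])
    fix p assume p: "p \<in> {p. p permutes (UNIV :: 'm set)}"
    have "(\<Prod>i\<in>UNIV. A $ i $ map_permutation UNIV f p i) = (\<Prod>i\<in>UNIV. A $ f i $ map_permutation UNIV f p (f i))"
      by (rule prod.reindex_bij_betw[symmetric]) (rule assms)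
    then show "of_int (sign (map_permutation UNIV f p)) * (\<Prod>i\<in>UNIV. A $ i $ map_permutation UNIV f p i) =
      of_int (sign p) * (\<Prod>i\<in>UNIV. A $ f i $ f (p i))"
      using p sign_map_permutation[OF inj, of p] by (simp add: map_permutation_apply[OF inj])
  qed
  finally show ?thesis by (simp add: det_def)
qed

text \<open>Lebesgue measure is determined by its values on boxes, and the volume of a box is the
  integral of the Jacobian over its preimage.\<close>

lemma density_det_distr_wellorder:
  fixes \<Phi> :: "real ^ 'n::{finite,wellorder} \<Rightarrow> real ^ 'n::_"
  assumes bij: "bij \<Phi>" and der: "\<And>x. (\<Phi> has_derivative \<Phi>' x) (at x)"
    and D [measurable]: "(\<lambda>x. det (matrix (\<Phi>' x))) \<in> borel_measurable borel"
  shows "distr (density lborel (\<lambda>x. \<bar>det (matrix (\<Phi>' x))\<bar>)) borel \<Phi> = lborel"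
proof (rule lborel_eqI[symmetric])
  fix l u :: "real ^ 'n::{finite,wellorder}"
  assume le: "\<And>b. b \<in> Basis \<Longrightarrow> l \<bullet> b \<le> u \<bullet> b"
  have "continuous_on UNIV \<Phi>"
    using der has_derivative_continuous continuous_at_imp_continuous_on by blast
  then have [measurable]: "\<Phi> \<in> borel_measurable borel" by (rule borel_measurable_continuous_onI)
  define S where "S = \<Phi> -` box l u"
  have S [measurable]: "S \<in> sets borel"
    unfolding S_def using measurable_sets[of \<Phi> borel borel "box l u"] by simp
  have im: "\<Phi> ` S = box l u" using bij by (auto simp: S_def bij_def surj_image_vimage_eq)
  have "((\<lambda>x. \<bar>det (matrix (\<Phi>' x))\<bar>) has_integral measure lebesgue (box l u)) S"
    using has_measure_differentiable_image[of S \<Phi> \<Phi>' "measure lebesgue (box l u)"] S bij der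
    by (auto simp: im intro: has_derivative_at_withinI inj_on_subset[OF bij_is_inj])
  from nn_integral_has_integral_lebesgue'[OF _ this]
  have "(\<integral>\<^sup>+x. ennreal \<bar>det (matrix (\<Phi>' x))\<bar> * indicator S x \<partial>lborel) = ennreal (measure lebesgue (box l u))"
    by simp
  also have "\<dots> = emeasure lborel (box l u)"
    using emeasure_eq_ennreal_measure[of lborel "box l u"] emeasure_lborel_box_finite[of l u]
    by (simp add: measure_completion del: measure_lborel_box emeasure_lborel_box_eq)
  finally have "(\<integral>\<^sup>+x. ennreal \<bar>det (matrix (\<Phi>' x))\<bar> * indicator S x \<partial>lborel) = (\<Prod>b\<in>Basis. (u - l) \<bullet> b)"
    using le by (simp add: emeasure_lborel_box)
  then show "emeasure (distr (density lborel (\<lambda>x. \<bar>det (matrix (\<Phi>' x))\<bar>)) borel \<Phi>) (box l u) = (\<Prod>b\<in>Basis. (u - l) \<bullet> b)"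
    by (subst emeasure_distr) (auto simp: emeasure_density S_def[symmetric])
qed simp

text \<open>Conjugation with the relabelling of coordinates changes neither Lebesgue measure nor the
  determinant.\<close>

lemma nn_integral_change_of_variables:
  fixes \<Phi> :: "real ^ 'n \<Rightarrow> real ^ 'n"
  assumes bij: "bij \<Phi>" and der: "\<And>x. (\<Phi> has_derivative \<Phi>' x) (at x)"
    and D [measurable]: "(\<lambda>x. det (matrix (\<Phi>' x))) \<in> borel_measurable borel"
    and f [measurable]: "f \<in> borel_measurable borel"
  shows "(\<integral>\<^sup>+x. f (\<Phi> x) * ennreal \<bar>det (matrix (\<Phi>' x))\<bar> \<partial>lborel) = (\<integral>\<^sup>+x. f x \<partial>lborel)"
proof -
  define \<Psi> where "\<Psi> = (\<lambda>x. to_copy (\<Phi> (from_copy x)))"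
  define \<Psi>' where "\<Psi>' = (\<lambda>x h. to_copy (\<Phi>' (from_copy x) (from_copy h)))"
  have "continuous_on UNIV \<Phi>"
    using der has_derivative_continuous continuous_at_imp_continuous_on by blast
  then have [measurable]: "\<Phi> \<in> borel_measurable borel" by (rule borel_measurable_continuous_onI)
  have [measurable]: "\<Psi> \<in> borel_measurable borel" unfolding \<Psi>_def by measurable
  have bij\<Psi>: "bij \<Psi>"
    unfolding \<Psi>_def
    by (intro o_bij[of "\<lambda>y. to_copy (inv \<Phi> (from_copy y))"])
      (auto simp: fun_eq_iff bij_is_inj[OF bij] surj_f_inv_f[OF bij_is_surj[OF bij]])
  have der\<Psi>: "(\<Psi> has_derivative \<Psi>' x) (at x)" for x
    unfolding \<Psi>_def \<Psi>'_def
    using bounded_linear.has_derivative[OF bounded_linear_copy(1)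
        has_derivative_compose[OF bounded_linear_imp_has_derivative[OF bounded_linear_copy(2)] der]] .
  have det: "det (matrix (\<Psi>' x)) = det (matrix (\<Phi>' (from_copy x)))" for x
  proof -
    have ax: "from_copy (axis j 1) = axis (Rep_ordered_copy j) 1" for j :: "'n ordered_copy"
      by (auto simp: from_copy_def axis_def vec_eq_iff Abs_ordered_copy_inverse Rep_ordered_copy_inverse)
    have "matrix (\<Psi>' x) = (\<chi> i j. matrix (\<Phi>' (from_copy x)) $ Rep_ordered_copy i $ Rep_ordered_copy j)"
      by (simp add: matrix_def \<Psi>'_def ax vec_eq_iff) (simp add: to_copy_def)
    then show ?thesis using det_reindex[OF bij_Rep_ordered_copy] by simp
  qed
  have D\<Psi> [measurable]: "(\<lambda>x. det (matrix (\<Psi>' x))) \<in> borel_measurable borel"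
    unfolding det by measurable
  have "(\<integral>\<^sup>+x. f x \<partial>lborel) = (\<integral>\<^sup>+y. f (from_copy y) \<partial>lborel)"
    by (subst distr_to_copy[symmetric], subst nn_integral_distr) simp_all
  also have "\<dots> = (\<integral>\<^sup>+y. f (from_copy (\<Psi> y)) * ennreal \<bar>det (matrix (\<Psi>' y))\<bar> \<partial>lborel)"
    by (subst density_det_distr_wellorder[OF bij\<Psi> der\<Psi> D\<Psi>, symmetric], subst nn_integral_distr)
      (simp_all add: nn_integral_density mult.commute)
  also have "\<dots> = (\<integral>\<^sup>+x. f (from_copy (\<Psi> (to_copy x))) * ennreal \<bar>det (matrix (\<Psi>' (to_copy x)))\<bar> \<partial>lborel)"
    by (subst distr_to_copy[symmetric], subst nn_integral_distr) simp_all
  finally show ?thesis by (simp add: \<Psi>_def det)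
qed

section \<open>Jacobians of maps close to the identity\<close>

lemma has_derivative_det_at_mat_1:
  "((det :: real ^ 'n ^ 'n \<Rightarrow> real) has_derivative trace) (at (mat 1))"
proof -
  have comp: "((\<lambda>A :: real ^ 'n ^ 'n. A $ i $ j) has_derivative (\<lambda>A. A $ i $ j)) F" for i j F
    by (intro bounded_linear_imp_has_derivative bounded_linear_compose[OF bounded_linear_vec_nth bounded_linear_vec_nth])
  have "((\<lambda>A :: real ^ 'n ^ 'n. \<Sum>p | p permutes (UNIV :: 'n set). of_int (sign p) * (\<Prod>i\<in>UNIV. A $ i $ p i)) has_derivative
     (\<lambda>E. \<Sum>p | p permutes (UNIV :: 'n set). of_int (sign p) * (\<Sum>i\<in>UNIV. E $ i $ p i * (\<Prod>j\<in>UNIV - {i}. (mat 1 :: real ^ 'n ^ 'n) $ j $ p j)))) (at (mat 1))"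
    by (intro has_derivative_sum has_derivative_mult_right has_derivative_prod comp)
  moreover have "(\<Sum>p | p permutes (UNIV :: 'n set). of_int (sign p) * (\<Sum>i\<in>UNIV. E $ i $ p i * (\<Prod>j\<in>UNIV - {i}. (mat 1 :: real ^ 'n ^ 'n) $ j $ p j))) = trace E" for E :: "real ^ 'n ^ 'n"
  proof -
    \<comment> \<open>A permutation other than the identity moves at least two indices, so after the
      factor at \<open>i\<close> is deleted some off-diagonal entry of the identity matrix
      remains.\<close>
    have z: "(\<Prod>j\<in>UNIV - {i}. (mat 1 :: real ^ 'n ^ 'n) $ j $ p j) = 0" if p: "p permutes (UNIV :: 'n set)" "p \<noteq> id" for p i
    proof -
      have "\<exists>j. j \<noteq> i \<and> p j \<noteq> j"
      proof (rule ccontr)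
        assume "\<nexists>j. j \<noteq> i \<and> p j \<noteq> j"
        then have *: "p j = j" if "j \<noteq> i" for j using that by blast
        have "p i = i" using * permutes_inj[OF p(1)] by (metis injD)
        then have "p j = j" for j using * by (cases "j = i") auto
        then show False using p(2) by (auto simp: fun_eq_iff)
      qed
      then obtain j where "j \<noteq> i" "p j \<noteq> j" by blast
      then show ?thesis by (intro prod_zero) (auto simp: mat_def intro!: bexI[of _ j])
    qed
    have "(\<Sum>i\<in>UNIV. E $ i $ p i * (\<Prod>j\<in>UNIV - {i}. (mat 1 :: real ^ 'n ^ 'n) $ j $ p j)) = 0"
      if "p permutes (UNIV :: 'n set)" "p \<noteq> id" for p
      by (intro sum.neutral ballI) (simp only: z[OF that] mult_zero_right)
    note z' = this
    have "(\<Sum>p | p permutes (UNIV :: 'n set). of_int (sign p) * (\<Sum>i\<in>UNIV. E $ i $ p i * (\<Prod>j\<in>UNIV - {i}. (mat 1 :: real ^ 'n ^ 'n) $ j $ p j)))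
      = (\<Sum>p\<in>{id}. of_int (sign p) * (\<Sum>i\<in>UNIV. E $ i $ p i * (\<Prod>j\<in>UNIV - {i}. (mat 1 :: real ^ 'n ^ 'n) $ j $ p j)))"
    proof (intro sum.mono_neutral_right ballI)
      fix p assume "p \<in> {p. p permutes (UNIV :: 'n set)} - {id}"
      then have "p permutes (UNIV :: 'n set)" "p \<noteq> id" by auto
      from z'[OF this] show "of_int (sign p) * (\<Sum>i\<in>UNIV. E $ i $ p i * (\<Prod>j\<in>UNIV - {i}. (mat 1 :: real ^ 'n ^ 'n) $ j $ p j)) = 0"
        by (simp only: mult_zero_right)
    qed (auto simp: finite_permutations permutes_id)
    also have "\<dots> = trace E" by (simp add: sign_id trace_def mat_def)
    finally show ?thesis .
  qed
  ultimately show ?thesis by (simp add: det_def[abs_def])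
qed

text \<open>The error is \<open>\<epsilon>\<close> per unit of \<open>h\<close>, so that over the
  \<open>t / h\<close> steps up to time \<open>t\<close> the errors add up to at most
  \<open>\<epsilon> * t\<close>. Uniformity in \<open>B\<close> comes from differentiability of
  \<open>det\<close> at the single point \<open>mat 1\<close>.\<close>

lemma ln_det_near_identity:
  fixes K \<epsilon> :: real
  assumes "0 < \<epsilon>"
  obtains h0 where "0 < h0" "\<And>h (B :: real ^ 'n ^ 'n). 0 < h \<Longrightarrow> h \<le> h0 \<Longrightarrow> norm B \<le> K \<Longrightarrow>
    0 < det (mat 1 + h *\<^sub>R B) \<and> \<bar>ln (det (mat 1 + h *\<^sub>R B)) - h * trace B\<bar> \<le> \<epsilon> * h"
proof -
  define K' where "K' = \<bar>K\<bar> + 1"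
  have K': "0 < K'" by (simp add: K'_def)
  obtain c where c: "0 < c" "\<And>B :: real ^ 'n ^ 'n. norm (trace B) \<le> norm B * c"
    using bounded_linear.pos_bounded[OF has_derivative_bounded_linear[OF has_derivative_det_at_mat_1]] by blast
  define \<epsilon>' where "\<epsilon>' = min 1 (\<epsilon> / (2 * K'))"
  have \<epsilon>': "0 < \<epsilon>'" using assms K' by (simp add: \<epsilon>'_def)
  obtain d where d: "0 < d" "\<And>A :: real ^ 'n ^ 'n. norm (A - mat 1) < d \<Longrightarrow> norm (det A - det (mat 1 :: real ^ 'n ^ 'n) - trace (A - mat 1)) \<le> \<epsilon>' * norm (A - mat 1)"
    using has_derivative_det_at_mat_1 \<epsilon>' unfolding has_derivative_at_alt by metis
  define q where "q = K' * (c + 1)"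
  have q: "0 < q" using K' c by (simp add: q_def)
  \<comment> \<open>The three bounds keep \<open>h *\<^sub>R B\<close> within the radius
    \<open>d\<close>, force \<open>\<bar>x\<bar> \<le> 1 / 2\<close> for the logarithm, and make the
    quadratic remainder \<open>2 * x\<^sup>2\<close> at most \<open>h * (\<epsilon> / 2)\<close>;
    here \<open>q\<close> bounds \<open>\<bar>x\<bar> / h\<close>.\<close>
  define h0 where "h0 = Min {d / (2 * K'), 1 / (2 * q), \<epsilon> / (4 * q\<^sup>2)}"
  have h0: "0 < h0" "h0 \<le> d / (2 * K')" "h0 \<le> 1 / (2 * q)" "h0 \<le> \<epsilon> / (4 * q\<^sup>2)"
    using d K' q assms by (auto simp: h0_def)
  have "0 < det (mat 1 + h *\<^sub>R B) \<and> \<bar>ln (det (mat 1 + h *\<^sub>R B)) - h * trace B\<bar> \<le> \<epsilon> * h"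
    if h: "0 < h" "h \<le> h0" and B: "norm B \<le> K" for h and B :: "real ^ 'n ^ 'n"
  proof -
    define x where "x = det (mat 1 + h *\<^sub>R B) - 1"
    have BK: "norm B \<le> K'" using B by (simp add: K'_def)
    have hB: "norm (h *\<^sub>R B) \<le> h * K'" using BK h by simp
    have "h * K' \<le> d / (2 * K') * K'" using h h0 K' by (intro mult_right_mono) auto
    also have "\<dots> < d" using K' d by simp
    finally have "norm (h *\<^sub>R B) < d" using hB by simp
    then have "\<bar>x - h * trace B\<bar> \<le> \<epsilon>' * norm (h *\<^sub>R B)"
      using d(2)[of "mat 1 + h *\<^sub>R B"] by (simp add: x_def det_I trace_def sum_distrib_left)
    also have "\<dots> \<le> \<epsilon>' * (h * K')" using hB \<epsilon>' by (intro mult_left_mono) auto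
    finally have x1: "\<bar>x - h * trace B\<bar> \<le> \<epsilon>' * (h * K')" .
    have "\<epsilon>' * (h * K') \<le> 1 * (h * K')" using h K' by (intro mult_right_mono) (auto simp: \<epsilon>'_def)
    moreover have "\<bar>h * trace B\<bar> \<le> h * (K' * c)"
    proof -
      have "\<bar>trace B\<bar> \<le> K' * c" using order_trans[OF c(2)[of B] mult_right_mono[OF BK, of c]] c(1) by simp
      then show ?thesis using h by (simp add: abs_mult)
    qed
    ultimately have x2: "\<bar>x\<bar> \<le> h * q" using x1 by (simp add: q_def algebra_simps abs_le_iff)
    have "h * q \<le> 1 / (2 * q) * q" using h h0 q by (intro mult_right_mono) auto
    then have x3: "\<bar>x\<bar> \<le> 1 / 2" using x2 q by simp
    have "\<bar>ln (1 + x) - x\<bar> \<le> 2 * x\<^sup>2" by (rule abs_ln_one_plus_x_minus_x_bound[OF x3])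
    also have "x\<^sup>2 \<le> (h * q)\<^sup>2" using x2 by (metis abs_ge_zero power2_abs power_mono)
    also have "2 * (h * q)\<^sup>2 = h * (2 * q\<^sup>2 * h)" by (simp add: power2_eq_square)
    also have "2 * q\<^sup>2 * h \<le> 2 * q\<^sup>2 * (\<epsilon> / (4 * q\<^sup>2))" using h h0 q by (intro mult_left_mono) auto
    also have "\<dots> = \<epsilon> / 2" using q by simp
    finally have ln: "\<bar>ln (1 + x) - x\<bar> \<le> h * (\<epsilon> / 2)" using h by simp
    have "\<epsilon>' * (h * K') \<le> (\<epsilon> / (2 * K')) * (h * K')" using h K' by (intro mult_right_mono) (auto simp: \<epsilon>'_def)
    also have "\<dots> = h * (\<epsilon> / 2)" using K' by simp
    finally have "\<bar>x - h * trace B\<bar> \<le> h * (\<epsilon> / 2)" using x1 by linarith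
    with ln have "\<bar>ln (1 + x) - h * trace B\<bar> \<le> h * (\<epsilon> / 2) + h * (\<epsilon> / 2)" by linarith
    moreover have "0 < 1 + x" using x3 by linarith
    ultimately show ?thesis by (simp add: x_def algebra_simps abs_le_iff)
  qed
  then show ?thesis by (rule that[OF h0(1)])
qed

text \<open>Chain rule for the iterate, with the innermost map peeled off: the factor
  \<open>j = 0\<close> is \<open>D x\<close>, and the others form an integrand evaluated at
  \<open>\<Phi> x\<close>.\<close>

lemma nn_integral_funpow_change_of_variables:
  fixes \<Phi> :: "'a::euclidean_space \<Rightarrow> 'a" and D :: "'a \<Rightarrow> ennreal"
  assumes cov: "\<And>f. f \<in> borel_measurable borel \<Longrightarrow> (\<integral>\<^sup>+x. f (\<Phi> x) * D x \<partial>lborel) = (\<integral>\<^sup>+x. f x \<partial>lborel)"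
    and [measurable]: "\<Phi> \<in> borel_measurable borel" "D \<in> borel_measurable borel" "f \<in> borel_measurable borel"
  shows "(\<integral>\<^sup>+x. f ((\<Phi> ^^ k) x) * (\<Prod>j<k. D ((\<Phi> ^^ j) x)) \<partial>lborel) = (\<integral>\<^sup>+x. f x \<partial>lborel)"
proof (induction k)
  case (Suc k)
  have [measurable]: "(\<Phi> ^^ j) \<in> borel_measurable borel" for j
    by (induction j) (auto simp: id_def)
  define g where "g x = f ((\<Phi> ^^ k) x) * (\<Prod>j<k. D ((\<Phi> ^^ j) x))" for x
  have [measurable]: "g \<in> borel_measurable borel" unfolding g_def by measurable
  have "f ((\<Phi> ^^ Suc k) x) * (\<Prod>j<Suc k. D ((\<Phi> ^^ j) x)) = g (\<Phi> x) * D x" for x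
    unfolding g_def by (simp add: funpow_Suc_right prod.lessThan_Suc_shift mult_ac del: funpow.simps prod.lessThan_Suc)
  then show ?case using cov[of g] Suc by (simp add: g_def)
qed simp

lemma bij_near_identity:
  fixes A :: "'a::banach \<Rightarrow> 'a"
  assumes lip: "\<And>x y. norm (A x - A y) \<le> K * norm (x - y)" and "0 \<le> h" "h * K < 1"
  shows "bij (\<lambda>x. x + h *\<^sub>R A x)"
proof (rule bijI)
  show "inj (\<lambda>x. x + h *\<^sub>R A x)"
  proof (rule injI)
    fix x y assume "x + h *\<^sub>R A x = y + h *\<^sub>R A y"
    then have "x - y = h *\<^sub>R (A y - A x)" by (simp add: algebra_simps)
    then have "norm (x - y) \<le> (h * K) * norm (x - y)"
      using mult_left_mono[OF lip[of y x] \<open>0 \<le> h\<close>] \<open>0 \<le> h\<close> by (simp add: norm_minus_commute)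
    then have "(1 - h * K) * norm (x - y) \<le> 0" by (simp add: algebra_simps)
    then have "norm (x - y) \<le> 0" using \<open>h * K < 1\<close> by (simp add: mult_le_0_iff)
    then show "x = y" by simp
  qed
  show "surj (\<lambda>x. x + h *\<^sub>R A x)"
    unfolding surj_def
  proof
    fix y
    \<comment> \<open>Solving \<open>x + h *\<^sub>R A x = y\<close> is a fixed point problem for a
      contraction; \<open>max 0\<close> supplies a nonnegative contraction constant.\<close>
    have "\<exists>!x. y - h *\<^sub>R A x = x"
    proof (rule banach_fix_type)
      show "\<forall>x z. dist (y - h *\<^sub>R A x) (y - h *\<^sub>R A z) \<le> max 0 (h * K) * dist x z"
      proof (intro allI)
        fix x z
        have "dist (y - h *\<^sub>R A x) (y - h *\<^sub>R A z) = h * norm (A z - A x)"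
          using \<open>0 \<le> h\<close> by (simp add: dist_norm scaleR_diff_right[symmetric])
        also have "\<dots> \<le> (h * K) * dist x z"
          using mult_left_mono[OF lip[of z x] \<open>0 \<le> h\<close>] by (simp add: dist_norm norm_minus_commute)
        also have "\<dots> \<le> max 0 (h * K) * dist x z" by (intro mult_right_mono) auto
        finally show "dist (y - h *\<^sub>R A x) (y - h *\<^sub>R A z) \<le> max 0 (h * K) * dist x z" .
      qed
    qed (use assms(3) in auto)
    then obtain x where "y - h *\<^sub>R A x = x" by blast
    then show "\<exists>x. y = x + h *\<^sub>R A x" by (intro exI[of _ x]) (simp add: algebra_simps)
  qed
qed

section \<open>The Jacobian formula for the flow\<close>

text \<open>Outer regularity of Lebesgue measure reduces the claim to open sets. Their indicators
  are lower semicontinuous, which is what lets Fatou's lemma pass from approximations of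
  \<open>X\<close> to \<open>X\<close>.\<close>

lemma nn_integral_le_if_open:
  fixes X :: "'a::euclidean_space \<Rightarrow> 'b::euclidean_space" and w :: "'a \<Rightarrow> ennreal"
  assumes [measurable]: "X \<in> borel_measurable borel" "w \<in> borel_measurable borel" "f \<in> borel_measurable borel"
    and le: "\<And>U. open U \<Longrightarrow> (\<integral>\<^sup>+x. indicator U (X x) * w x \<partial>lborel) \<le> ennreal c * emeasure lborel U"
  shows "(\<integral>\<^sup>+x. f (X x) * w x \<partial>lborel) \<le> ennreal c * (\<integral>\<^sup>+x. f x \<partial>lborel)"
proof -
  define \<nu> where "\<nu> = distr (density lborel w) borel X"
  have \<nu>: "emeasure \<nu> A = (\<integral>\<^sup>+x. indicator A (X x) * w x \<partial>lborel)" if [measurable]: "A \<in> sets borel" for A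
  proof -
    have [measurable]: "X -` A \<in> sets borel" using measurable_sets[of X borel borel A] that by simp
    have "emeasure \<nu> A = (\<integral>\<^sup>+x. w x * indicator (X -` A) x \<partial>lborel)"
      unfolding \<nu>_def by (subst emeasure_distr) (auto simp: emeasure_density)
    then show ?thesis by (simp add: indicator_vimage mult.commute)
  qed
  have "\<nu> \<le> scale_measure (ennreal c) lborel"
  proof (subst le_measure)
    show "\<forall>A\<in>sets \<nu>. emeasure \<nu> A \<le> emeasure (scale_measure (ennreal c) lborel) A"
    proof
      fix A assume "A \<in> sets \<nu>"
      then have A [measurable]: "A \<in> sets borel" by (simp add: \<nu>_def)
      have "emeasure \<nu> A \<le> ennreal c * emeasure lborel A + ennreal e" if "0 < e" for e :: real
      proof -
        \<comment> \<open>The denominator makes \<open>c * e' \<le> e\<close> whatever the size and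
          sign of \<open>c\<close>.\<close>
        define e' where "e' = e / (\<bar>c\<bar> + 1)"
        have e': "0 < e'" using that by (simp add: e'_def)
        obtain U where U: "open U" "A \<subseteq> U" "emeasure lborel (U - A) < ennreal e'"
          using outer_regular_lborel[OF A e'] by blast
        have "emeasure \<nu> A \<le> emeasure \<nu> U"
          using U by (intro emeasure_mono) (auto simp: \<nu>_def)
        also have "\<dots> \<le> ennreal c * emeasure lborel U" using le[OF U(1)] U(1) by (simp add: \<nu>)
        also have "emeasure lborel U \<le> emeasure lborel A + emeasure lborel (U - A)"
          using U emeasure_subadditive[of A lborel "U - A"] by (simp add: Un_absorb1)
        also have "\<dots> \<le> emeasure lborel A + ennreal e'" using U(3) by (intro add_left_mono) auto
        finally have "emeasure \<nu> A \<le> ennreal c * (emeasure lborel A + ennreal e')"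
          by (simp add: mult_left_mono)
        also have "\<dots> = ennreal c * emeasure lborel A + ennreal c * ennreal e'" by (rule distrib_left)
        also have "ennreal c * ennreal e' \<le> ennreal \<bar>c\<bar> * ennreal e'" by (intro mult_right_mono ennreal_leI) auto
        also have "\<dots> = ennreal (\<bar>c\<bar> * e')" using e' by (simp add: ennreal_mult)
        also have "\<bar>c\<bar> * e' \<le> e" using that by (simp add: e'_def field_simps)
        finally show ?thesis by (simp add: ennreal_leI add_left_mono)
      qed
      then show "emeasure \<nu> A \<le> emeasure (scale_measure (ennreal c) lborel) A"
        by (simp add: ennreal_le_epsilon)
    qed
  qed (simp add: \<nu>_def)
  then have "nn_integral \<nu> f \<le> nn_integral (scale_measure (ennreal c) lborel) f"
    by (intro nn_integral_mono_measure) (auto simp: \<nu>_def)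
  moreover have "nn_integral \<nu> f = (\<integral>\<^sup>+x. f (X x) * w x \<partial>lborel)"
    unfolding \<nu>_def by (subst nn_integral_distr) (auto simp: nn_integral_density mult.commute)
  ultimately show ?thesis by (simp add: nn_integral_scale_measure)
qed

lemma tendsto_indicator_open_liminf:
  fixes y :: "nat \<Rightarrow> 'a::topological_space"
  assumes "y \<longlonglongrightarrow> l" "open U"
  shows "indicator U l * w \<le> liminf (\<lambda>n. indicator U (y n) * (w::ennreal))"
proof (cases "l \<in> U")
  case True
  then have "eventually (\<lambda>n. y n \<in> U) sequentially" by (rule topological_tendstoD[OF assms])
  then show ?thesis using True
    by (intro Liminf_bounded) (auto elim!: eventually_mono)
qed simp

lemma interval_integral_shift:
  fixes f :: "real \<Rightarrow> real"
  shows "(LBINT s=ereal a..ereal b. f (s + t)) = (LBINT s=ereal (a + t)..ereal (b + t). f s)"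
proof -
  have *: "(LBINT s=ereal a..ereal b. f (s + t)) = (LBINT s=ereal (a + t)..ereal (b + t). f s)" if "a \<le> b" for a b
  proof -
    have "(LBINT s : {a..b}. f (s + t)) = (\<integral>s. indicator {a + t..b + t} (t + 1 * s) *\<^sub>R f (t + 1 * s) \<partial>lborel)"
      unfolding set_lebesgue_integral_def
      by (intro Bochner_Integration.integral_cong) (auto simp: indicator_def add.commute)
    also have "\<dots> = (LBINT s : {a + t..b + t}. f s)"
      unfolding set_lebesgue_integral_def
      using lborel_integral_real_affine[of 1 "\<lambda>s. indicator {a + t..b + t} s *\<^sub>R f s" t] by simp
    finally show ?thesis using that by (simp add: interval_integral_Icc)
  qed
  show ?thesis
  proof (cases "a \<le> b")
    case False
    then show ?thesis
      using *[of b a] interval_integral_endpoints_reverse[of "ereal a" "ereal b" "\<lambda>s. f (s + t)"]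
        interval_integral_endpoints_reverse[of "ereal (a + t)" "ereal (b + t)" f] by simp
  qed (rule *)
qed

lemma interval_integrable_bounded:
  fixes f :: "real \<Rightarrow> real"
  assumes [measurable]: "f \<in> borel_measurable borel" and "\<And>s. \<bar>f s\<bar> \<le> M"
  shows "interval_lebesgue_integrable lborel (ereal a) (ereal b) f" "set_integrable lborel {a..b} f"
proof -
  have *: "set_integrable lborel S f" if [measurable]: "S \<in> sets borel" and "S \<subseteq> {c..d}" for S c d
  proof -
    have "emeasure lborel S \<le> emeasure lborel {c..d}" using that by (intro emeasure_mono) auto
    also have "\<dots> < \<infinity>" by (cases "c \<le> d") auto
    finally have "emeasure lborel S < \<infinity>" .
    then show ?thesis
      unfolding set_integrable_def
      by (intro integrableI_bounded_set_indicator[where B = M]) (use assms in auto)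
  qed
  show "set_integrable lborel {a..b} f" by (rule *[of _ a b]) auto
  have "set_integrable lborel (einterval (ereal c) (ereal d)) f" for c d
    by (rule *[of _ c d]) (auto simp: einterval_def)
  then show "interval_lebesgue_integrable lborel (ereal a) (ereal b) f"
    by (simp add: interval_lebesgue_integrable_def)
qed

lemma interval_integral_zero_bound:
  fixes f :: "real \<Rightarrow> real"
  assumes [measurable]: "f \<in> borel_measurable borel" and M: "\<And>s. \<bar>f s\<bar> \<le> M"
  shows "\<bar>LBINT s=ereal 0..ereal t. f s\<bar> \<le> M * \<bar>t\<bar>"
proof -
  have *: "\<bar>LBINT s : {a..b}. f s\<bar> \<le> M * (b - a)" if "a \<le> b" for a b
  proof -
    have "\<bar>LBINT s : {a..b}. f s\<bar> \<le> (LBINT s : {a..b}. norm (f s))"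
      using set_integral_norm_bound[OF interval_integrable_bounded(2)[OF assms]] by simp
    also have "\<dots> \<le> (LBINT s : {a..b}. M)"
      using M interval_integrable_bounded(2)[of "\<lambda>s. M" "\<bar>M\<bar>" a b]
      by (intro set_integral_mono set_integrable_norm interval_integrable_bounded(2)[OF assms]) auto
    also have "\<dots> = M * (b - a)" using that by (simp add: set_integral_const)
    finally show ?thesis .
  qed
  show ?thesis
  proof (cases "0 \<le> t")
    case True then show ?thesis using *[of 0 t] by (simp add: interval_integral_Icc)
  next
    case False
    then show ?thesis
      using *[of t 0] interval_integral_endpoints_reverse[of "ereal 0" "ereal t" f]
      by (simp add: interval_integral_Icc)
  qed
qed

lemma cball_borel [measurable]: "cball (a :: 'a::metric_space) r \<in> sets borel"
  by (intro borel_closed) simp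

text \<open>The Lipschitz and derivative bounds may grow with \<open>n\<close>, since step sizes are
  chosen after \<open>n\<close>. The divergence bound \<open>M\<close> may not: it controls the
  Jacobians over a whole time interval. The divergences converge only in \<open>L\<^sup>1\<close> on
  balls.\<close>

locale regularized_field = log_lipschitz_field G C for G :: "real ^ 'd \<Rightarrow> real ^ 'd" and C :: real +
  fixes A :: "nat \<Rightarrow> real ^ 'd \<Rightarrow> real ^ 'd" and A' :: "nat \<Rightarrow> real ^ 'd \<Rightarrow> real ^ 'd \<Rightarrow> real ^ 'd"
    and L :: "real ^ 'd \<Rightarrow> real" and M :: real
  assumes A_uniform: "\<And>\<eta>. 0 < \<eta> \<Longrightarrow> \<exists>N. \<forall>n\<ge>N. \<forall>z. norm (A n z - G z) \<le> \<eta>"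
    and A_lipschitz: "\<And>n. \<exists>K. \<forall>x y. norm (A n x - A n y) \<le> K * norm (x - y)"
    and A_derivative: "\<And>n x. (A n has_derivative A' n x) (at x)"
    and A'_continuous: "\<And>n. continuous_on UNIV (\<lambda>x. matrix (A' n x))"
    and A'_bounded: "\<And>n. \<exists>K. \<forall>x. norm (matrix (A' n x)) \<le> K"
    and div_A_bound: "\<And>n x. \<bar>trace (matrix (A' n x))\<bar> \<le> M"
    and L_measurable [measurable]: "L \<in> borel_measurable borel"
    and L_bound: "\<And>x. \<bar>L x\<bar> \<le> M"
    and div_A_converges: "\<And>R. (\<lambda>n. \<integral>\<^sup>+x\<in>cball 0 R. ennreal \<bar>trace (matrix (A' n x)) - L x\<bar> \<partial>lborel) \<longlonglongrightarrow> 0"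
begin

lemma M_nonneg: "0 \<le> M"
  using L_bound[of 0] by simp

lemma flow_measurable [measurable (raw)]:
  "f \<in> borel_measurable N \<Longrightarrow> g \<in> borel_measurable N \<Longrightarrow> (\<lambda>x. flow (f x) (g x)) \<in> borel_measurable N"
  using measurable_compose[OF borel_measurable_Pair borel_measurable_continuous_onI[OF flow_continuous], of f N g]
  by simp

definition Lint :: "real \<Rightarrow> real ^ 'd \<Rightarrow> real" where
  "Lint t x = (LBINT s=ereal 0..ereal t. L (flow s x))"

lemma Lint_0 [simp]: "Lint 0 x = 0"
  by (simp add: Lint_def interval_lebesgue_integral_def set_lebesgue_integral_def einterval_same)

lemma Lint_bound: "\<bar>Lint t x\<bar> \<le> M * \<bar>t\<bar>"
  unfolding Lint_def by (rule interval_integral_zero_bound) (use L_bound in auto)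

text \<open>Cocycle identity over the flow. It makes the Jacobian multiplicative in time and later
  gives the ratio formula for the conductivity.\<close>

lemma Lint_add: "Lint (s + t) x = Lint t x + Lint s (flow t x)"
proof -
  have "Lint s (flow t x) = (LBINT r=ereal t..ereal (s + t). L (flow r x))"
    unfolding Lint_def using interval_integral_shift[of 0 s "\<lambda>r. L (flow r x)" t]
    by (simp add: flow_add[symmetric])
  moreover have "interval_lebesgue_integrable lborel (ereal (min 0 (min t (s + t)))) (ereal (max 0 (max t (s + t)))) (\<lambda>r. L (flow r x))"
    by (rule interval_integrable_bounded) (use L_bound in auto)
  then have "(LBINT r=ereal 0..ereal t. L (flow r x)) + (LBINT r=ereal t..ereal (s + t). L (flow r x)) = (LBINT r=ereal 0..ereal (s + t). L (flow r x))"
    by (intro interval_integral_sum) (simp only: ereal_min[symmetric] ereal_max[symmetric])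
  ultimately show ?thesis by (simp add: Lint_def)
qed

lemma Lint_flow_minus: "Lint (- t) (flow t x) = - Lint t x"
  using Lint_add[of "- t" t x] by simp

text \<open>Joint measurability in time and point is needed because the conductivity evaluates
  \<open>Lint\<close> at a time depending on \<open>x\<close>. Written as two integrals over the
  whole line, the expression is a parametric integral.\<close>

lemma Lint_measurable [measurable (raw)]:
  assumes [measurable]: "f \<in> borel_measurable N" "g \<in> borel_measurable N"
  shows "(\<lambda>x. Lint (f x) (g x)) \<in> borel_measurable N"
proof -
  have eq: "Lint t x = (\<integral>s. (if 0 \<le> s \<and> s \<le> t then L (flow s x) else 0) \<partial>lborel)
     - (\<integral>s. (if t \<le> s \<and> s \<le> 0 then L (flow s x) else 0) \<partial>lborel)" for t x
  proof -
    have z: "(\<integral>s. (if a \<le> s \<and> s \<le> b then h s else 0) \<partial>lborel) = (LBINT s : {a..b}. h s)" for a b and h :: "real \<Rightarrow> real"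
      unfolding set_lebesgue_integral_def by (intro Bochner_Integration.integral_cong) (auto simp: indicator_def)
    have z0: "(LBINT s : {a..b}. h s) = 0" if "b \<le> a" for a b and h :: "real \<Rightarrow> real"
    proof (cases "a = b")
      case True then show ?thesis using interval_integral_Icc[of a b h]
        by (simp add: interval_lebesgue_integral_def set_lebesgue_integral_def einterval_same)
    next
      case False then show ?thesis using that by (simp add: set_lebesgue_integral_def)
    qed
    have z1: "(LBINT s : {}. h s) = 0" for h :: "real \<Rightarrow> real" by (simp add: set_lebesgue_integral_def)
    show ?thesis
    proof (cases "0 \<le> t")
      case True then show ?thesis by (simp add: z z0 z1 Lint_def interval_integral_Icc)
    next
      case False then show ?thesis
        using interval_integral_endpoints_reverse[of "ereal 0" "ereal t" "\<lambda>s. L (flow s x)"]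
        by (simp add: z z0 z1 Lint_def interval_integral_Icc)
    qed
  qed
  show ?thesis unfolding eq by measurable
qed

section \<open>Euler maps of the regularised fields and their Jacobians\<close>

definition divA :: "nat \<Rightarrow> real ^ 'd \<Rightarrow> real" where
  "divA n x = trace (matrix (A' n x))"

lemma divA_bound: "\<bar>divA n x\<bar> \<le> M"
  using div_A_bound by (simp add: divA_def)

lemma divA_continuous: "continuous_on S (divA n)"
proof -
  have "continuous_on S (\<lambda>x. matrix (A' n x))" using A'_continuous continuous_on_subset by blast
  then show ?thesis unfolding divA_def trace_def by (intro continuous_intros)
qed

lemma divA_measurable [measurable]: "divA n \<in> borel_measurable borel"
  using divA_continuous by (rule borel_measurable_continuous_onI)

lemma A_continuous: "continuous_on UNIV (A n)"
  by (intro continuous_at_imp_continuous_on ballI has_derivative_continuous[OF A_derivative])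

lemma A_measurable [measurable]: "A n \<in> borel_measurable borel"
  using A_continuous by (rule borel_measurable_continuous_onI)

text \<open>The step has to be small against the Lipschitz constant, for bijectivity, and against
  the derivative bound, for the logarithm of the determinant; both depend on
  \<open>n\<close>.\<close>

lemma step_size_exists: "\<exists>h. 0 < h \<and> h \<le> 1 / (real n + 1) \<and> bij (\<lambda>x. x + h *\<^sub>R A n x) \<and>
   (\<forall>x. 0 < det (mat 1 + h *\<^sub>R matrix (A' n x)) \<and>
     \<bar>ln (det (mat 1 + h *\<^sub>R matrix (A' n x))) - h * divA n x\<bar> \<le> 1 / (real n + 1) * h)"
proof -
  obtain K where K: "\<And>x y. norm (A n x - A n y) \<le> K * norm (x - y)" using A_lipschitz by blast
  obtain K' where K': "\<And>x. norm (matrix (A' n x)) \<le> K'" using A'_bounded by blast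
  obtain h0 where h0: "0 < h0" "\<And>h (B :: real ^ 'd ^ 'd). 0 < h \<Longrightarrow> h \<le> h0 \<Longrightarrow> norm B \<le> K' \<Longrightarrow>
    0 < det (mat 1 + h *\<^sub>R B) \<and> \<bar>ln (det (mat 1 + h *\<^sub>R B)) - h * trace B\<bar> \<le> 1 / (real n + 1) * h"
    by (rule ln_det_near_identity[of "1 / (real n + 1)" K']) auto
  define h where "h = min h0 (min (1 / (real n + 1)) (1 / (2 * (\<bar>K\<bar> + 1))))"
  have h: "0 < h" "h \<le> h0" "h \<le> 1 / (real n + 1)" "h \<le> 1 / (2 * (\<bar>K\<bar> + 1))" using h0 by (auto simp: h_def)
  have "h * (\<bar>K\<bar> + 1) \<le> 1 / (2 * (\<bar>K\<bar> + 1)) * (\<bar>K\<bar> + 1)" using h by (intro mult_right_mono) auto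
  also have "\<dots> < 1" by simp
  finally have "h * (\<bar>K\<bar> + 1) < 1" .
  moreover have "norm (A n x - A n y) \<le> (\<bar>K\<bar> + 1) * norm (x - y)" for x y
    using order_trans[OF K mult_right_mono[of K "\<bar>K\<bar> + 1" "norm (x - y)"]] by simp
  ultimately have "bij (\<lambda>x. x + h *\<^sub>R A n x)" using h by (intro bij_near_identity[where K = "\<bar>K\<bar> + 1"]) auto
  then show ?thesis using h h0(2)[OF h(1,2) K'] by (intro exI[of _ h]) (auto simp: divA_def)
qed

definition step :: "nat \<Rightarrow> real" where
  "step n = (SOME h. 0 < h \<and> h \<le> 1 / (real n + 1) \<and> bij (\<lambda>x. x + h *\<^sub>R A n x) \<and>
   (\<forall>x. 0 < det (mat 1 + h *\<^sub>R matrix (A' n x)) \<and>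
     \<bar>ln (det (mat 1 + h *\<^sub>R matrix (A' n x))) - h * divA n x\<bar> \<le> 1 / (real n + 1) * h))"

definition jac :: "nat \<Rightarrow> real ^ 'd \<Rightarrow> real" where
  "jac n x = det (mat 1 + step n *\<^sub>R matrix (A' n x))"

definition \<Phi> :: "nat \<Rightarrow> real ^ 'd \<Rightarrow> real ^ 'd" where
  "\<Phi> n x = x + step n *\<^sub>R A n x"

lemma step: "0 < step n" "step n \<le> 1 / (real n + 1)"
  and bij_\<Phi>: "bij (\<Phi> n)" and jac_pos: "0 < jac n x"
  and ln_jac: "\<bar>ln (jac n x) - step n * divA n x\<bar> \<le> 1 / (real n + 1) * step n"
  using someI_ex[OF step_size_exists[of n]] unfolding step_def[symmetric] jac_def \<Phi>_def[abs_def] by simp_all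

lemma \<Phi>_measurable [measurable]: "\<Phi> n \<in> borel_measurable borel"
  unfolding \<Phi>_def by measurable

lemma jac_continuous: "continuous_on UNIV (jac n)"
proof -
  have c: "continuous_on UNIV (\<lambda>x. (mat 1 + step n *\<^sub>R matrix (A' n x)) $ i $ j)" for i j
    using A'_continuous[of n] by (intro continuous_intros)
  show ?thesis unfolding jac_def[abs_def] det_def
    by (intro continuous_intros c)
qed

lemma jac_measurable [measurable]: "jac n \<in> borel_measurable borel"
  using jac_continuous by (rule borel_measurable_continuous_onI)

lemma nn_integral_\<Phi>:
  assumes [measurable]: "f \<in> borel_measurable borel"
  shows "(\<integral>\<^sup>+x. f (\<Phi> n x) * ennreal (jac n x) \<partial>lborel) = (\<integral>\<^sup>+x. f x \<partial>lborel)"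
proof -
  have der: "(\<Phi> n has_derivative (\<lambda>k. k + step n *\<^sub>R A' n x k)) (at x)" for x
    unfolding \<Phi>_def[abs_def] by (intro derivative_intros A_derivative)
  have mat: "matrix (\<lambda>k. k + step n *\<^sub>R A' n x k) = mat 1 + step n *\<^sub>R matrix (A' n x)" for x
    by (simp add: matrix_def mat_def axis_def vec_eq_iff)
  have "\<bar>jac n x\<bar> = jac n x" for x using jac_pos[of n x] by simp
  then show ?thesis
    using nn_integral_change_of_variables[OF bij_\<Phi> der, of f]
    by (simp add: mat jac_def[symmetric])
qed

abbreviation Y :: "nat \<Rightarrow> real \<Rightarrow> real ^ 'd \<Rightarrow> real ^ 'd" where
  "Y n \<equiv> euler (A n) (step n)"

lemma Y_eq: "Y n t x = (\<Phi> n ^^ nat \<lfloor>t / step n\<rfloor>) x"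
  by (simp add: euler_def \<Phi>_def[abs_def])

lemma funpow_\<Phi>_measurable [measurable]: "(\<Phi> n ^^ j) \<in> borel_measurable borel"
  by (induction j) (auto simp: id_def)

lemma Y_measurable [measurable (raw)]:
  assumes [measurable]: "f \<in> borel_measurable N" "g \<in> borel_measurable N"
  shows "(\<lambda>x. Y n (f x) (g x)) \<in> borel_measurable N"
  unfolding Y_eq
  by (rule measurable_compose_countable[where f = "\<lambda>i x. (\<Phi> n ^^ i) (g x)"]) measurable

text \<open>The logarithm of the Jacobian of the Euler map at time \<open>t\<close>; as a sum over
  steps it can be compared with a Riemann sum of the divergence.\<close>

definition logjac :: "nat \<Rightarrow> real \<Rightarrow> real ^ 'd \<Rightarrow> real" where
  "logjac n t x = (\<Sum>j<nat \<lfloor>t / step n\<rfloor>. ln (jac n ((\<Phi> n ^^ j) x)))"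

lemma logjac_measurable [measurable]: "logjac n t \<in> borel_measurable borel"
  unfolding logjac_def by measurable

lemma nn_integral_Y:
  assumes [measurable]: "f \<in> borel_measurable borel"
  shows "(\<integral>\<^sup>+x. f (Y n t x) * ennreal (exp (logjac n t x)) \<partial>lborel) = (\<integral>\<^sup>+x. f x \<partial>lborel)"
proof -
  have "(\<Prod>j<k. ennreal (jac n ((\<Phi> n ^^ j) x))) = ennreal (exp (\<Sum>j<k. ln (jac n ((\<Phi> n ^^ j) x))))" for k x
    using jac_pos by (simp add: prod_ennreal less_imp_le exp_sum)
  then show ?thesis
    using nn_integral_funpow_change_of_variables[OF nn_integral_\<Phi>, of n f "nat \<lfloor>t / step n\<rfloor>"]
    by (simp add: Y_eq logjac_def)
qed

definition divint :: "nat \<Rightarrow> real \<Rightarrow> real ^ 'd \<Rightarrow> real" where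
  "divint n t x = (LBINT s : {0..t}. divA n (Y n s x))"

lemma divint_measurable [measurable]: "divint n t \<in> borel_measurable borel"
  unfolding divint_def set_lebesgue_integral_def by measurable

lemma divint_bound: "0 \<le> t \<Longrightarrow> \<bar>divint n t x\<bar> \<le> M * t"
  using interval_integral_zero_bound[of "\<lambda>s. divA n (Y n s x)" M t] divA_bound
  by (simp add: divint_def interval_integral_Icc)

text \<open>Each full step contributes an error \<open>step n / (n + 1)\<close>, in total at most
  \<open>t / (n + 1)\<close>. The unfinished step is in the integral but not in the sum; its length
  is at most \<open>1 / (n + 1)\<close>, which gives the term with \<open>M\<close>.\<close>

lemma logjac_approx:
  assumes t: "0 \<le> t"
  shows "\<bar>logjac n t x - divint n t x\<bar> \<le> (t + M) / (real n + 1)"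
proof -
  define k where "k = nat \<lfloor>t / step n\<rfloor>"
  define g where "g j = divA n ((\<Phi> n ^^ j) x)" for j
  have kt: "real k * step n \<le> t" "t - step n * k \<le> step n"
  proof -
    have "real k \<le> t / step n" "t / step n < real k + 1" using t step[of n] by (auto simp: k_def)
    then show "real k * step n \<le> t" "t - step n * k \<le> step n" using step[of n] by (auto simp: field_simps)
  qed
  have "divint n t x = integral {0..t} (\<lambda>s. divA n (Y n s x))"
    unfolding divint_def using divA_bound
    by (intro set_borel_integral_eq_integral(2) interval_integrable_bounded(2)[where M = M]) auto
  also have "\<dots> = step n * (\<Sum>j<k. g j) + (t - step n * k) * g k"
    using integral_unique[OF has_integral_step_function[OF step(1)[of n] t, of g]]
    by (simp add: Y_eq g_def k_def)
  finally have d: "divint n t x = step n * (\<Sum>j<k. g j) + (t - step n * k) * g k" .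
  have "\<bar>(\<Sum>j<k. ln (jac n ((\<Phi> n ^^ j) x))) - step n * (\<Sum>j<k. g j)\<bar> = \<bar>\<Sum>j<k. (ln (jac n ((\<Phi> n ^^ j) x)) - step n * g j)\<bar>"
    by (simp add: sum_subtractf sum_distrib_left)
  also have "\<dots> \<le> (\<Sum>j<k. 1 / (real n + 1) * step n)"
    unfolding g_def by (intro order_trans[OF sum_abs] sum_mono ln_jac)
  also have "\<dots> = (real k * step n) / (real n + 1)" by simp
  also have "\<dots> \<le> t / (real n + 1)" using kt by (intro divide_right_mono) auto
  finally have 1: "\<bar>logjac n t x - step n * (\<Sum>j<k. g j)\<bar> \<le> t / (real n + 1)" by (simp add: logjac_def k_def)
  have "\<bar>(t - step n * k) * g k\<bar> \<le> step n * M"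
    using kt divA_bound[of n "(\<Phi> n ^^ k) x"] unfolding abs_mult g_def
    by (intro mult_mono) (auto simp: mult.commute)
  also have "\<dots> \<le> 1 / (real n + 1) * M" using step(2)[of n] M_nonneg by (intro mult_right_mono) auto
  finally have 2: "\<bar>(t - step n * k) * g k\<bar> \<le> M / (real n + 1)" by simp
  show ?thesis using 1 2 unfolding d add_divide_distrib by linarith
qed

section \<open>Passage to the limit in the Jacobian formula\<close>

definition crude :: "real \<Rightarrow> real" where
  "crude T = exp (M * T + (T + M))"

text \<open>The constant comes from bounding the logarithm of the Jacobian below by
  \<open>- M * T\<close> for the divergence and by \<open>- (T + M)\<close> for the discretisation
  error. It is not sharp, but it is uniform in \<open>n\<close>.\<close>

lemma nn_integral_Y_le:
  assumes [measurable]: "f \<in> borel_measurable borel" and t: "t \<in> {0..T}"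
  shows "(\<integral>\<^sup>+x. f (Y n t x) \<partial>lborel) \<le> ennreal (crude T) * (\<integral>\<^sup>+x. f x \<partial>lborel)"
proof -
  have "f (Y n t x) \<le> ennreal (crude T) * (f (Y n t x) * ennreal (exp (logjac n t x)))" for x
  proof -
    have "(t + M) / (real n + 1) \<le> (t + M) / 1" using t M_nonneg by (intro divide_left_mono) auto
    then have "- logjac n t x \<le> M * t + (t + M)"
      using logjac_approx[of t n x] divint_bound[of t n x] t by auto
    also have "\<dots> \<le> M * T + (T + M)" using t M_nonneg by (intro add_mono mult_left_mono) auto
    finally have "0 \<le> (M * T + (T + M)) + logjac n t x" by simp
    then have "1 \<le> crude T * exp (logjac n t x)" by (simp add: crude_def exp_add[symmetric])
    then have "ennreal 1 \<le> ennreal (crude T) * ennreal (exp (logjac n t x))"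
      by (subst ennreal_mult[symmetric]) (auto simp: crude_def intro: ennreal_leI)
    then have "f (Y n t x) * 1 \<le> f (Y n t x) * (ennreal (crude T) * ennreal (exp (logjac n t x)))"
      by (intro mult_left_mono) auto
    then show ?thesis by (simp add: mult_ac)
  qed
  then have "(\<integral>\<^sup>+x. f (Y n t x) \<partial>lborel) \<le> (\<integral>\<^sup>+x. ennreal (crude T) * (f (Y n t x) * ennreal (exp (logjac n t x))) \<partial>lborel)"
    by (intro nn_integral_mono)
  also have "\<dots> = ennreal (crude T) * (\<integral>\<^sup>+x. f (Y n t x) * ennreal (exp (logjac n t x)) \<partial>lborel)"
    by (rule nn_integral_cmult) measurable
  finally show ?thesis by (simp add: nn_integral_Y)
qed

lemma Y_converges:
  assumes "0 < \<epsilon>" "0 \<le> T"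
  shows "\<exists>N. \<forall>n\<ge>N. \<forall>x\<in>cball 0 R. \<forall>t\<in>{0..T}. norm (Y n t x - flow t x) \<le> \<epsilon>"
proof -
  obtain \<eta> where \<eta>: "0 < \<eta>" "\<And>B h x t. (\<And>z. norm (B z - G z) \<le> \<eta>) \<Longrightarrow> 0 < h \<Longrightarrow> h \<le> \<eta> \<Longrightarrow> norm x \<le> R \<Longrightarrow>
    t \<in> {0..T} \<Longrightarrow> norm (euler B h t x - flow t x) \<le> \<epsilon>"
    by (rule euler_converges[OF assms, of R]) auto
  obtain N1 where N1: "\<And>n z. n \<ge> N1 \<Longrightarrow> norm (A n z - G z) \<le> \<eta>" using A_uniform[OF \<eta>(1)] by blast
  obtain N2 :: nat where N2: "1 / \<eta> \<le> real N2" using real_arch_simple by blast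
  have "norm (Y n t x - flow t x) \<le> \<epsilon>" if n: "n \<ge> max N1 N2" and x: "x \<in> cball 0 R" and t: "t \<in> {0..T}" for n x t
  proof (rule \<eta>(2))
    show "norm (A n z - G z) \<le> \<eta>" for z using N1 n by simp
    have "1 / \<eta> \<le> real n + 1" using N2 n by linarith
    then have "1 / (real n + 1) \<le> \<eta>" using \<eta>(1) by (simp add: field_simps)
    then show "step n \<le> \<eta>" using step(2)[of n] by simp
  qed (use step x t in auto)
  then show ?thesis by blast
qed

lemma Y_tendsto:
  assumes "0 \<le> t" shows "(\<lambda>n. Y n t x) \<longlonglongrightarrow> flow t x"
proof (rule LIMSEQ_I)
  fix r :: real assume "0 < r"
  then have "0 < r / 2" by simp
  from Y_converges[OF this assms, of "norm x"] obtain N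
    where N: "\<forall>n\<ge>N. \<forall>y\<in>cball 0 (norm x). \<forall>s\<in>{0..t}. norm (Y n s y - flow s y) \<le> r / 2" by blast
  have "norm (Y n t x - flow t x) < r" if "n \<ge> N" for n
  proof -
    have "norm (Y n t x - flow t x) \<le> r / 2" using N that assms by auto
    then show ?thesis using \<open>0 < r\<close> by linarith
  qed
  then show "\<exists>no. \<forall>n\<ge>no. norm (Y n t x - flow t x) < r" by blast
qed

text \<open>The uniform density bound survives the limit by Fatou on open sets. It has to precede
  the exact formula, because it controls a measurable \<open>L\<close> evaluated along
  trajectories.\<close>

lemma nn_integral_flow_crude:
  assumes [measurable]: "f \<in> borel_measurable borel" and t: "t \<in> {0..T}"
  shows "(\<integral>\<^sup>+x. f (flow t x) \<partial>lborel) \<le> ennreal (crude T) * (\<integral>\<^sup>+x. f x \<partial>lborel)"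
proof -
  have "(\<integral>\<^sup>+x. f (flow t x) * 1 \<partial>lborel) \<le> ennreal (crude T) * (\<integral>\<^sup>+x. f x \<partial>lborel)"
  proof (rule nn_integral_le_if_open)
    fix U :: "(real ^ 'd) set" assume U: "open U"
    then have [measurable]: "U \<in> sets borel" by simp
    have "(\<integral>\<^sup>+x. indicator U (flow t x) * 1 \<partial>lborel) \<le> (\<integral>\<^sup>+x. liminf (\<lambda>n. indicator U (Y n t x) * 1) \<partial>lborel)"
      using t by (intro nn_integral_mono tendsto_indicator_open_liminf Y_tendsto U) auto
    also have "\<dots> \<le> liminf (\<lambda>n. \<integral>\<^sup>+x. indicator U (Y n t x) * 1 \<partial>lborel)"
      by (intro nn_integral_liminf) measurable
    also have "\<dots> \<le> liminf (\<lambda>n. ennreal (crude T) * emeasure lborel U)"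
      using nn_integral_Y_le[of "indicator U" t T] t
      by (intro Liminf_mono always_eventually) auto
    also have "\<dots> = ennreal (crude T) * emeasure lborel U" by (simp add: Liminf_const)
    finally show "(\<integral>\<^sup>+x. indicator U (flow t x) * 1 \<partial>lborel) \<le> ennreal (crude T) * emeasure lborel U" .
  qed measurable
  then show ?thesis by simp
qed

lemma flow_image_bounded:
  obtains R' where "\<And>x t. x \<in> cball 0 R \<Longrightarrow> \<bar>t\<bar> \<le> T \<Longrightarrow> norm (flow t x) \<le> R'"
proof -
  have "compact ((\<lambda>(t, x). flow t x) ` ({- T..T} \<times> cball 0 R))"
    by (intro compact_continuous_image continuous_on_subset[OF flow_continuous] compact_Times) auto
  then obtain R' where "\<forall>y\<in>(\<lambda>(t, x). flow t x) ` ({- T..T} \<times> cball 0 R). norm y \<le> R'"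
    using compact_imp_bounded bounded_iff by blast
  then have "norm (flow t x) \<le> R'" if "x \<in> cball 0 R" "\<bar>t\<bar> \<le> T" for x t
    using that by (auto simp: abs_le_iff)
  then show ?thesis by (rule that)
qed

lemma divint_Lint_le:
  assumes t: "0 \<le> t"
  shows "ennreal \<bar>divint n t x - Lint t x\<bar> \<le> (\<integral>\<^sup>+s. indicator {0..t} s * ennreal \<bar>divA n (Y n s x) - L (flow s x)\<bar> \<partial>lborel)"
proof -
  have i: "set_integrable lborel {0..t} (\<lambda>s. divA n (Y n s x))" "set_integrable lborel {0..t} (\<lambda>s. L (flow s x))"
    using divA_bound L_bound by (auto intro!: interval_integrable_bounded(2)[where M = M])
  define I where "I = (\<integral>s. indicator {0..t} s *\<^sub>R (divA n (Y n s x) - L (flow s x)) \<partial>lborel)"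
  have eq: "divint n t x - Lint t x = I"
    using set_integral_diff(2)[OF i] unfolding divint_def Lint_def interval_integral_Icc[OF t] I_def set_lebesgue_integral_def
    by (rule sym)
  have "ennreal (norm I) \<le> (\<integral>\<^sup>+s. norm (indicator {0..t} s *\<^sub>R (divA n (Y n s x) - L (flow s x))) \<partial>lborel)"
    unfolding I_def using set_integral_diff(1)[OF i] unfolding set_integrable_def by (rule integral_norm_bound_ennreal)
  also have "\<dots> = (\<integral>\<^sup>+s. indicator {0..t} s * ennreal \<bar>divA n (Y n s x) - L (flow s x)\<bar> \<partial>lborel)"
    by (intro nn_integral_cong) (auto simp: indicator_def)
  finally show ?thesis unfolding eq by simp
qed

text \<open>\<open>L\<close> need not be continuous, so closeness of \<open>Y n s x\<close> and
  \<open>flow s x\<close> says nothing about \<open>L\<close> directly. A continuous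
  \<open>divA m\<close> is put in between: the three differences with \<open>L\<close> are
  integrated with the crude density bounds and give \<open>3 * crude T * \<delta>\<close>, and the
  fourth difference is at most \<open>\<delta>\<close> pointwise.\<close>

lemma divA_Y_converges:
  assumes \<delta>: "0 < \<delta>" and T: "0 \<le> T"
  shows "\<exists>N. \<forall>n\<ge>N. \<forall>s\<in>{0..T}. (\<integral>\<^sup>+x. indicator (cball 0 R) x * ennreal \<bar>divA n (Y n s x) - L (flow s x)\<bar> \<partial>lborel)
     \<le> ennreal (3 * crude T * \<delta> + \<delta> * measure lborel (cball (0 :: real ^ 'd) R))"
proof -
  obtain R1 where R1: "\<And>x s. x \<in> cball 0 R \<Longrightarrow> \<bar>s\<bar> \<le> T \<Longrightarrow> norm (flow s x) \<le> R1" by (rule flow_image_bounded[of R T]) blast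
  \<comment> \<open>The extra radius 1 keeps the Euler points, which are within distance 1 of the
    trajectories, inside \<open>K\<close>.\<close>
  define K where "K = cball (0 :: real ^ 'd) (R1 + 1)"
  have [measurable]: "K \<in> sets borel" by (simp add: K_def)
  define E where "E n = (\<integral>\<^sup>+x. indicator K x * ennreal \<bar>divA n x - L x\<bar> \<partial>lborel)" for n
  have "E \<longlonglongrightarrow> 0" using div_A_converges[of "R1 + 1"] by (simp add: E_def[abs_def] K_def divA_def mult.commute)
  then have "eventually (\<lambda>n. E n < ennreal \<delta>) sequentially" using \<delta> by (intro order_tendstoD(2)) auto
  then obtain N1 where N1: "\<And>n. n \<ge> N1 \<Longrightarrow> E n \<le> ennreal \<delta>" unfolding eventually_sequentially by (meson less_imp_le)
  \<comment> \<open>The index \<open>m\<close> is frozen before \<open>n\<close> grows, because the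
    modulus of continuity of \<open>divA m\<close> may depend on \<open>m\<close>.\<close>
  define m where "m = N1"
  have "uniformly_continuous_on K (divA m)"
    unfolding K_def by (intro compact_uniformly_continuous divA_continuous) auto
  then obtain d where d: "0 < d" "\<And>x y. x \<in> K \<Longrightarrow> y \<in> K \<Longrightarrow> dist y x < d \<Longrightarrow> dist (divA m y) (divA m x) < \<delta>"
    unfolding uniformly_continuous_on_def using \<delta> by metis
  obtain N2 where N2: "\<And>n x s. n \<ge> N2 \<Longrightarrow> x \<in> cball 0 R \<Longrightarrow> s \<in> {0..T} \<Longrightarrow> norm (Y n s x - flow s x) \<le> min 1 (d / 2)"
    using Y_converges[of "min 1 (d / 2)" T R] d(1) T by (metis half_gt_zero min_less_iff_conj zero_less_one)
  have c0: "0 \<le> crude T" by (simp add: crude_def)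
  have "(\<integral>\<^sup>+x. indicator (cball 0 R) x * ennreal \<bar>divA n (Y n s x) - L (flow s x)\<bar> \<partial>lborel)
     \<le> ennreal (3 * crude T * \<delta> + \<delta> * measure lborel (cball (0 :: real ^ 'd) R))"
    if n: "n \<ge> max N1 N2" and s: "s \<in> {0..T}" for n s
  proof -
    define p where "p x = indicator K x * ennreal \<bar>divA n x - L x\<bar>" for x
    define q where "q x = indicator K x * ennreal \<bar>divA m x - L x\<bar>" for x
    have [measurable]: "p \<in> borel_measurable borel" "q \<in> borel_measurable borel" unfolding p_def q_def by measurable
    have pt: "indicator (cball 0 R) x * ennreal \<bar>divA n (Y n s x) - L (flow s x)\<bar>
      \<le> p (Y n s x) + q (Y n s x) + q (flow s x) + ennreal \<delta> * indicator (cball 0 R) x" for x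
    proof (cases "x \<in> cball 0 R")
      case True
      have c: "norm (Y n s x - flow s x) \<le> min 1 (d / 2)" using N2 n True s by auto
      have f: "norm (flow s x) \<le> R1" using R1[of x s] True s by auto
      have "norm (Y n s x) \<le> R1 + 1" using c f norm_triangle_sub[of "Y n s x" "flow s x"] by simp
      with f have K: "Y n s x \<in> K" "flow s x \<in> K" by (auto simp: K_def)
      have "dist (Y n s x) (flow s x) < d" using c d(1) by (simp add: dist_norm)
      then have "\<bar>divA m (Y n s x) - divA m (flow s x)\<bar> < \<delta>" using d(2)[OF K(2,1)] by (simp add: dist_real_def)
      then have "\<bar>divA n (Y n s x) - L (flow s x)\<bar> \<le>
        \<bar>divA n (Y n s x) - L (Y n s x)\<bar> + \<bar>divA m (Y n s x) - L (Y n s x)\<bar> + \<bar>divA m (flow s x) - L (flow s x)\<bar> + \<delta>"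
        by linarith
      then have "ennreal \<bar>divA n (Y n s x) - L (flow s x)\<bar> \<le>
        ennreal (\<bar>divA n (Y n s x) - L (Y n s x)\<bar> + \<bar>divA m (Y n s x) - L (Y n s x)\<bar> + \<bar>divA m (flow s x) - L (flow s x)\<bar> + \<delta>)"
        by (rule ennreal_leI)
      then show ?thesis using True K \<delta> by (simp add: p_def q_def)
    qed simp
    have "(\<integral>\<^sup>+x. indicator (cball 0 R) x * ennreal \<bar>divA n (Y n s x) - L (flow s x)\<bar> \<partial>lborel) \<le>
      (\<integral>\<^sup>+x. p (Y n s x) + q (Y n s x) + q (flow s x) + ennreal \<delta> * indicator (cball 0 R) x \<partial>lborel)"
      by (intro nn_integral_mono pt)
    also have "\<dots> = (\<integral>\<^sup>+x. p (Y n s x) \<partial>lborel) + (\<integral>\<^sup>+x. q (Y n s x) \<partial>lborel) + (\<integral>\<^sup>+x. q (flow s x) \<partial>lborel) + ennreal \<delta> * emeasure lborel (cball (0 :: real ^ 'd) R)"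
      by (simp add: nn_integral_add nn_integral_cmult)
    also have "\<dots> \<le> ennreal (crude T) * E n + ennreal (crude T) * E m + ennreal (crude T) * E m + ennreal \<delta> * emeasure lborel (cball (0 :: real ^ 'd) R)"
      using nn_integral_Y_le[of p s T n] nn_integral_Y_le[of q s T n] nn_integral_flow_crude[of q s T] s
      by (intro add_mono) (auto simp: E_def p_def q_def)
    also have "\<dots> \<le> ennreal (crude T) * ennreal \<delta> + ennreal (crude T) * ennreal \<delta> + ennreal (crude T) * ennreal \<delta> + ennreal \<delta> * emeasure lborel (cball (0 :: real ^ 'd) R)"
      using N1[of n] N1[of m] n by (intro add_mono mult_left_mono) (auto simp: m_def)
    also have "emeasure lborel (cball (0 :: real ^ 'd) R) = ennreal (measure lborel (cball (0 :: real ^ 'd) R))"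
      by (intro emeasure_eq_ennreal_measure) (use emeasure_lborel_cball_finite[of "0 :: real ^ 'd" R] in auto)
    also have "ennreal (crude T) * ennreal \<delta> + ennreal (crude T) * ennreal \<delta> + ennreal (crude T) * ennreal \<delta> + ennreal \<delta> * ennreal (measure lborel (cball (0 :: real ^ 'd) R))
      = ennreal (3 * crude T * \<delta> + \<delta> * measure lborel (cball (0 :: real ^ 'd) R))"
      using c0 \<delta> by (simp add: ennreal_mult[symmetric] ennreal_plus[symmetric] del: ennreal_plus)
    finally show ?thesis .
  qed
  then show ?thesis by blast
qed

text \<open>Tonelli puts the time integral outside, where the preceding bound is uniform on
  \<open>{0..t}\<close>.\<close>

lemma divint_converges:
  assumes \<epsilon>: "0 < \<epsilon>" and t: "0 \<le> t"
  shows "\<exists>N. \<forall>n\<ge>N. (\<integral>\<^sup>+x. indicator (cball 0 R) x * ennreal \<bar>divint n t x - Lint t x\<bar> \<partial>lborel) \<le> ennreal \<epsilon>"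
proof -
  define D where "D = 3 * crude t + measure lborel (cball (0 :: real ^ 'd) R) + 1"
  have D: "0 < D" by (simp add: D_def crude_def add_pos_nonneg)
  define \<delta> where "\<delta> = \<epsilon> / (D * (t + 1))"
  have \<delta>: "0 < \<delta>" using \<epsilon> D t by (simp add: \<delta>_def)
  obtain N where N: "\<And>n s. n \<ge> N \<Longrightarrow> s \<in> {0..t} \<Longrightarrow> (\<integral>\<^sup>+x. indicator (cball 0 R) x * ennreal \<bar>divA n (Y n s x) - L (flow s x)\<bar> \<partial>lborel)
     \<le> ennreal (3 * crude t * \<delta> + \<delta> * measure lborel (cball (0 :: real ^ 'd) R))"
    using divA_Y_converges[OF \<delta> t, of R] by blast
  have "(\<integral>\<^sup>+x. indicator (cball 0 R) x * ennreal \<bar>divint n t x - Lint t x\<bar> \<partial>lborel) \<le> ennreal \<epsilon>" if n: "n \<ge> N" for n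
  proof -
    have "(\<integral>\<^sup>+x. indicator (cball 0 R) x * ennreal \<bar>divint n t x - Lint t x\<bar> \<partial>lborel)
      \<le> (\<integral>\<^sup>+x. indicator (cball 0 R) x * (\<integral>\<^sup>+s. indicator {0..t} s * ennreal \<bar>divA n (Y n s x) - L (flow s x)\<bar> \<partial>lborel) \<partial>lborel)"
      using divint_Lint_le[OF t] by (intro nn_integral_mono mult_left_mono) auto
    also have "\<dots> = (\<integral>\<^sup>+x. (\<integral>\<^sup>+s. indicator (cball 0 R) x * (indicator {0..t} s * ennreal \<bar>divA n (Y n s x) - L (flow s x)\<bar>) \<partial>lborel) \<partial>lborel)"
      by (intro nn_integral_cong nn_integral_cmult[symmetric]) measurable
    also have "\<dots> = (\<integral>\<^sup>+s. (\<integral>\<^sup>+x. indicator (cball 0 R) x * (indicator {0..t} s * ennreal \<bar>divA n (Y n s x) - L (flow s x)\<bar>) \<partial>lborel) \<partial>lborel)"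
      by (rule lborel_pair.Fubini'[symmetric]) measurable
    also have "\<dots> \<le> (\<integral>\<^sup>+s. ennreal (D * \<delta>) * indicator {0..t} s \<partial>lborel)"
    proof (rule nn_integral_mono)
      fix s :: real
      show "(\<integral>\<^sup>+x. indicator (cball 0 R) x * (indicator {0..t} s * ennreal \<bar>divA n (Y n s x) - L (flow s x)\<bar>) \<partial>lborel) \<le> ennreal (D * \<delta>) * indicator {0..t} s"
      proof (cases "s \<in> {0..t}")
        case True
        have "3 * crude t * \<delta> + \<delta> * measure lborel (cball (0 :: real ^ 'd) R) \<le> D * \<delta>"
          using \<delta> by (simp add: D_def algebra_simps)
        then show ?thesis using order_trans[OF N[OF n True] ennreal_leI] True by simp
      qed simp
    qed
    also have "\<dots> = ennreal (D * \<delta>) * ennreal t" using t by (simp add: nn_integral_cmult)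
    also have "\<dots> = ennreal (D * \<delta> * t)" using D \<delta> t by (simp add: ennreal_mult)
    also have "D * \<delta> * t \<le> \<epsilon>"
    proof -
      have "D * \<delta> * t = \<epsilon> * (t / (t + 1))" using D t by (simp add: \<delta>_def)
      also have "\<dots> \<le> \<epsilon> * 1" using \<epsilon> t by (intro mult_left_mono) auto
      finally show ?thesis by simp
    qed
    finally show ?thesis by (simp add: ennreal_leI)
  qed
  then show ?thesis by blast
qed

text \<open>Fatou is applied with the limit weight \<open>exp (Lint t x)\<close> already in place,
  so that only the indicator of the open set varies; replacing this weight by the true Jacobian of
  the Euler map costs an \<open>L\<^sup>1\<close> error.\<close>

lemma nn_integral_flow_open_le:
  assumes t: "0 \<le> t" and U: "open U"
  shows "(\<integral>\<^sup>+x. indicator U (flow t x) * ennreal (exp (Lint t x)) \<partial>lborel) \<le> emeasure lborel U"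
proof -
  have [measurable]: "U \<in> sets borel" using U by simp
  \<comment> \<open>Cut off to a ball, since the divergences converge only locally; the cutoff is
    removed at the end by letting the radius grow.\<close>
  have cut: "(\<integral>\<^sup>+x. indicator U (flow t x) * (ennreal (exp (Lint t x)) * indicator (cball 0 R) x) \<partial>lborel) \<le> emeasure lborel U" for R
  proof -
    define e where "e x = ennreal (exp (Lint t x)) * indicator (cball 0 R) x" for x
    have [measurable]: "e \<in> borel_measurable borel" unfolding e_def by measurable
    define V where "V = measure lborel (cball (0 :: real ^ 'd) R)"
    have V: "emeasure lborel (cball (0 :: real ^ 'd) R) = ennreal V"
      unfolding V_def by (intro emeasure_eq_ennreal_measure) (use emeasure_lborel_cball_finite[of "0 :: real ^ 'd" R] in auto)
    have bd: "\<exists>N. \<forall>n\<ge>N. (\<integral>\<^sup>+x. indicator U (Y n t x) * e x \<partial>lborel) \<le> emeasure lborel U + ennreal \<epsilon>" if \<epsilon>: "0 < \<epsilon>" for \<epsilon>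
    proof -
      define \<epsilon>' where "\<epsilon>' = \<epsilon> / (2 * exp (M * t))"
      have \<epsilon>': "0 < \<epsilon>'" using \<epsilon> by (simp add: \<epsilon>'_def)
      obtain N1 where N1: "\<And>n. n \<ge> N1 \<Longrightarrow> (\<integral>\<^sup>+x. indicator (cball 0 R) x * ennreal \<bar>divint n t x - Lint t x\<bar> \<partial>lborel) \<le> ennreal \<epsilon>'"
        using divint_converges[OF \<epsilon>' t, of R] by blast
      obtain N2 :: nat where N2: "(t + M) * V / \<epsilon>' \<le> real N2" using real_arch_simple by blast
      have "(\<integral>\<^sup>+x. indicator U (Y n t x) * e x \<partial>lborel) \<le> emeasure lborel U + ennreal \<epsilon>" if n: "n \<ge> max N1 N2" for n
      proof -
        define r where "r = (t + M) / (real n + 1)"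
        have r0: "0 \<le> r" using t M_nonneg by (simp add: r_def)
        have pt: "indicator U (Y n t x) * e x \<le> indicator U (Y n t x) * ennreal (exp (logjac n t x)) +
           ennreal (exp (M * t)) * (indicator (cball 0 R) x * ennreal \<bar>divint n t x - Lint t x\<bar> + ennreal r * indicator (cball 0 R) x)" for x
        proof (cases "x \<in> cball 0 R \<and> Y n t x \<in> U")
          case True
          \<comment> \<open>Tangent line of \<open>exp\<close> at \<open>Lint t x\<close>: this
            one-sided bound suffices, and its error is linear in the difference of the
            exponents.\<close>
          have "exp (Lint t x) * (1 + (logjac n t x - Lint t x)) \<le> exp (Lint t x) * exp (logjac n t x - Lint t x)"
            by (intro mult_left_mono exp_ge_add_one_self) auto
          then have "exp (Lint t x) \<le> exp (logjac n t x) + exp (Lint t x) * (Lint t x - logjac n t x)"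
            by (simp add: exp_diff algebra_simps)
          also have "exp (Lint t x) * (Lint t x - logjac n t x) \<le> exp (M * t) * (\<bar>divint n t x - Lint t x\<bar> + r)"
          proof (rule order_trans[OF mult_left_mono mult_right_mono])
            show "Lint t x - logjac n t x \<le> \<bar>divint n t x - Lint t x\<bar> + r"
              using logjac_approx[OF t, of n x] by (auto simp: r_def)
            show "exp (Lint t x) \<le> exp (M * t)" using Lint_bound[of t x] t by auto
          qed (use r0 in auto)
          finally have "exp (Lint t x) \<le> exp (logjac n t x) + exp (M * t) * (\<bar>divint n t x - Lint t x\<bar> + r)" by simp
          then have "ennreal (exp (Lint t x)) \<le> ennreal (exp (logjac n t x) + exp (M * t) * (\<bar>divint n t x - Lint t x\<bar> + r))"
            by (rule ennreal_leI)
          then show ?thesis using True r0 by (simp add: e_def ennreal_mult)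
        next
          case False
          then have "indicator U (Y n t x) * e x = 0" by (auto simp: e_def)
          then show ?thesis by (simp only: zero_le)
        qed
        have "(\<integral>\<^sup>+x. indicator U (Y n t x) * e x \<partial>lborel) \<le> (\<integral>\<^sup>+x. indicator U (Y n t x) * ennreal (exp (logjac n t x)) +
           ennreal (exp (M * t)) * (indicator (cball 0 R) x * ennreal \<bar>divint n t x - Lint t x\<bar> + ennreal r * indicator (cball 0 R) x) \<partial>lborel)"
          by (intro nn_integral_mono pt)
        also have "\<dots> = emeasure lborel U + ennreal (exp (M * t)) * ((\<integral>\<^sup>+x. indicator (cball 0 R) x * ennreal \<bar>divint n t x - Lint t x\<bar> \<partial>lborel) + ennreal r * ennreal V)"
          using nn_integral_Y[of "indicator U" n t] by (simp add: nn_integral_add nn_integral_cmult V)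
        also have "\<dots> \<le> emeasure lborel U + ennreal (exp (M * t)) * (ennreal \<epsilon>' + ennreal \<epsilon>')"
        proof (intro add_left_mono mult_left_mono add_mono)
          show "(\<integral>\<^sup>+x. indicator (cball 0 R) x * ennreal \<bar>divint n t x - Lint t x\<bar> \<partial>lborel) \<le> ennreal \<epsilon>'" using N1 n by simp
          have "(t + M) * V / \<epsilon>' \<le> real n + 1" using N2 n by linarith
          then have "r * V \<le> \<epsilon>'" using \<epsilon>' by (simp add: r_def field_simps)
          then show "ennreal r * ennreal V \<le> ennreal \<epsilon>'"
            using r0 by (simp add: ennreal_mult[symmetric] V_def ennreal_leI)
        qed auto
        also have "ennreal (exp (M * t)) * (ennreal \<epsilon>' + ennreal \<epsilon>') = ennreal \<epsilon>"
          using \<epsilon>' by (simp add: ennreal_plus[symmetric] ennreal_mult[symmetric] del: ennreal_plus) (simp add: \<epsilon>'_def)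
        finally show ?thesis .
      qed
      then show ?thesis by blast
    qed
    have "(\<integral>\<^sup>+x. indicator U (flow t x) * e x \<partial>lborel) \<le> (\<integral>\<^sup>+x. liminf (\<lambda>n. indicator U (Y n t x) * e x) \<partial>lborel)"
      by (intro nn_integral_mono tendsto_indicator_open_liminf Y_tendsto t U)
    also have "\<dots> \<le> liminf (\<lambda>n. \<integral>\<^sup>+x. indicator U (Y n t x) * e x \<partial>lborel)"
      by (intro nn_integral_liminf) measurable
    also have "\<dots> \<le> emeasure lborel U"
    proof (rule ennreal_le_epsilon)
      fix \<epsilon> :: real assume "0 < \<epsilon>"
      then obtain N where "\<forall>n\<ge>N. (\<integral>\<^sup>+x. indicator U (Y n t x) * e x \<partial>lborel) \<le> emeasure lborel U + ennreal \<epsilon>" using bd by blast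
      then show "liminf (\<lambda>n. \<integral>\<^sup>+x. indicator U (Y n t x) * e x \<partial>lborel) \<le> emeasure lborel U + ennreal \<epsilon>"
        by (intro Liminf_le eventually_sequentiallyI[of N]) auto
    qed
    finally show ?thesis by (simp add: e_def)
  qed
  have "(\<integral>\<^sup>+x. indicator U (flow t x) * ennreal (exp (Lint t x)) \<partial>lborel)
    \<le> (\<integral>\<^sup>+x. liminf (\<lambda>n. indicator U (flow t x) * (ennreal (exp (Lint t x)) * indicator (cball 0 (real n)) x)) \<partial>lborel)"
  proof (rule nn_integral_mono)
    fix x :: "real ^ 'd"
    obtain N :: nat where "norm x \<le> real N" using real_arch_simple by blast
    then show "indicator U (flow t x) * ennreal (exp (Lint t x))
      \<le> liminf (\<lambda>n. indicator U (flow t x) * (ennreal (exp (Lint t x)) * indicator (cball 0 (real n)) x))"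
      by (intro Liminf_bounded eventually_sequentiallyI[of N]) (auto simp: indicator_def)
  qed
  also have "\<dots> \<le> liminf (\<lambda>n. \<integral>\<^sup>+x. indicator U (flow t x) * (ennreal (exp (Lint t x)) * indicator (cball 0 (real n)) x) \<partial>lborel)"
    by (intro nn_integral_liminf) measurable
  also have "\<dots> \<le> emeasure lborel U"
    using cut by (intro Liminf_le always_eventually) auto
  finally show ?thesis .
qed

lemma nn_integral_flow_le_forward:
  assumes [measurable]: "f \<in> borel_measurable borel" and t: "0 \<le> t"
  shows "(\<integral>\<^sup>+x. f (flow t x) * ennreal (exp (Lint t x)) \<partial>lborel) \<le> (\<integral>\<^sup>+x. f x \<partial>lborel)"
  using nn_integral_le_if_open[of "flow t" "\<lambda>x. ennreal (exp (Lint t x))" f 1] nn_integral_flow_open_le[OF t]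
  by simp

text \<open>All hypotheses are symmetric under time reversal, which carries the forward inequality
  over to negative times.\<close>

lemma regularized_field_uminus:
  "regularized_field (\<lambda>x. - G x) C (\<lambda>n x. - A n x) (\<lambda>n x k. - A' n x k) (\<lambda>x. - L x) M"
proof -
  interpret neg: log_lipschitz_field "\<lambda>x. - G x" C by (rule log_lipschitz_field_uminus)
  have mat: "matrix (\<lambda>k. - A' n x k) = - matrix (A' n x)" for n x
    by (simp add: matrix_def vec_eq_iff)
  have tr: "trace (- B) = - trace B" for B :: "real ^ 'd ^ 'd" by (simp add: trace_def sum_negf)
  show ?thesis
  proof unfold_locales
    show "\<exists>N. \<forall>n\<ge>N. \<forall>z. norm (- A n z - - G z) \<le> \<eta>" if "0 < \<eta>" for \<eta>
      using A_uniform[OF that] by (simp add: norm_minus_commute)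
    show "\<exists>K. \<forall>x y. norm (- A n x - - A n y) \<le> K * norm (x - y)" for n
      using A_lipschitz[of n] by (simp add: norm_minus_commute)
    show "((\<lambda>x. - A n x) has_derivative (\<lambda>k. - A' n x k)) (at x)" for n x
      by (intro derivative_intros A_derivative)
    show "continuous_on UNIV (\<lambda>x. matrix (\<lambda>k. - A' n x k))" for n
      unfolding mat by (intro continuous_intros A'_continuous)
    show "\<exists>K. \<forall>x. norm (matrix (\<lambda>k. - A' n x k)) \<le> K" for n
      unfolding mat using A'_bounded[of n] by simp
    show "\<bar>trace (matrix (\<lambda>k. - A' n x k))\<bar> \<le> M" for n x
      unfolding mat tr using div_A_bound[of n x] by simp
    show "\<bar>- L x\<bar> \<le> M" for x using L_bound[of x] by simp
    have "\<bar>- trace (matrix (A' n x)) - - L x\<bar> = \<bar>trace (matrix (A' n x)) - L x\<bar>" for n x by linarith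
    then show "(\<lambda>n. \<integral>\<^sup>+x\<in>cball 0 R. ennreal \<bar>trace (matrix (\<lambda>k. - A' n x k)) - - L x\<bar> \<partial>lborel) \<longlonglongrightarrow> 0" for R
      unfolding mat tr using div_A_converges[of R] by simp
  qed measurable
qed

lemma nn_integral_flow_le:
  assumes f [measurable]: "f \<in> borel_measurable borel"
  shows "(\<integral>\<^sup>+x. f (flow t x) * ennreal (exp (Lint t x)) \<partial>lborel) \<le> (\<integral>\<^sup>+x. f x \<partial>lborel)"
proof (cases "0 \<le> t")
  case True then show ?thesis by (rule nn_integral_flow_le_forward[OF f])
next
  case False
  interpret neg: regularized_field "\<lambda>x. - G x" C "\<lambda>n x. - A n x" "\<lambda>n x k. - A' n x k" "\<lambda>x. - L x" M
    by (rule regularized_field_uminus)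
  \<comment> \<open>The sign of \<open>L\<close> and the reversal of time cancel in the
    exponent.\<close>
  have "neg.Lint (- t) x = Lint t x" for x
  proof -
    have "neg.Lint (- t) x = (LBINT s=ereal 0..ereal (- t). - L (flow (- s) x))"
      unfolding neg.Lint_def by (simp add: flow_uminus)
    also have "\<dots> = - (LBINT s=ereal t..ereal 0. L (flow s x))"
      using interval_integral_reflect[of "ereal t" "ereal 0" "\<lambda>s. L (flow s x)"]
      by (simp add: interval_lebesgue_integral_uminus zero_ereal_def)
    also have "\<dots> = Lint t x"
      unfolding Lint_def using interval_integral_endpoints_reverse[of "ereal t" "ereal 0" "\<lambda>s. L (flow s x)"] by simp
    finally show ?thesis .
  qed
  then show ?thesis using neg.nn_integral_flow_le_forward[OF f, of "- t"] False by (simp add: flow_uminus)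
qed

text \<open>The inequality at time \<open>- t\<close>, applied to the weighted integrand
  \<open>g\<close>, is the reverse inequality, because the two exponents cancel by the cocycle
  identity.\<close>

lemma nn_integral_flow:
  assumes [measurable]: "f \<in> borel_measurable borel"
  shows "(\<integral>\<^sup>+x. f (flow t x) * ennreal (exp (Lint t x)) \<partial>lborel) = (\<integral>\<^sup>+x. f x \<partial>lborel)"
proof (rule antisym[OF nn_integral_flow_le])
  define g where "g x = f (flow t x) * ennreal (exp (Lint t x))" for x
  have [measurable]: "g \<in> borel_measurable borel" unfolding g_def by measurable
  have "g (flow (- t) x) * ennreal (exp (Lint (- t) x)) = f x" for x
    using Lint_flow_minus[of "- t" x]
    by (simp add: g_def mult.assoc ennreal_mult[symmetric] exp_add[symmetric])
  then show "(\<integral>\<^sup>+x. f x \<partial>lborel) \<le> (\<integral>\<^sup>+x. f (flow t x) * ennreal (exp (Lint t x)) \<partial>lborel)"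
    using nn_integral_flow_le[of g "- t"] by (simp add: g_def)
qed measurable

end

section \<open>Smooth kernels and mollification\<close>

text \<open>The standard flat function \<open>exp (- (1 / s))\<close> with powers of
  \<open>1 / s\<close> in front. With the powers included, the family is closed under
  differentiation: a derivative combines the indices \<open>n + 1\<close> and
  \<open>n + 2\<close>.\<close>

definition exp_bump :: "nat \<Rightarrow> real \<Rightarrow> real" where
  "exp_bump n s = (if 0 < s then (1 / s) ^ n * exp (- (1 / s)) else 0)"

lemma exp_bump_nonneg: "0 \<le> exp_bump n s"
  by (simp add: exp_bump_def)

lemma exp_bump_tendsto_0: "((\<lambda>s. (1 / s) ^ n * exp (- (1 / s))) \<longlongrightarrow> 0) (at_right (0 :: real))"
proof -
  have "((\<lambda>x. x ^ n / exp x) \<longlongrightarrow> 0) (at_top :: real filter)" by (rule tendsto_power_div_exp_0)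
  from filterlim_compose[OF this filterlim_inverse_at_top_right]
  show ?thesis by (simp add: exp_minus divide_inverse)
qed

lemma exp_bump_has_derivative:
  "(exp_bump n has_real_derivative (exp_bump (n + 2) s - real n * exp_bump (n + 1) s)) (at s)"
proof (cases s "0 :: real" rule: linorder_cases)
  case less
  have "((\<lambda>_. 0) has_real_derivative 0) (at s)" by simp
  then have "(exp_bump n has_real_derivative 0) (at s)"
    by (rule has_field_derivative_transform_within_open[where S = "{..<0}"]) (use less in \<open>auto simp: exp_bump_def\<close>)
  then show ?thesis using less by (simp add: exp_bump_def)
next
  case greater
  have "((\<lambda>s. (1 / s) ^ n * exp (- (1 / s))) has_real_derivative
     (real n * (1 / s) ^ (n - 1) * (- (1 / s\<^sup>2)) * exp (- (1 / s)) + (1 / s) ^ n * (exp (- (1 / s)) * (1 / s\<^sup>2)))) (at s)"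
  proof (cases n)
    case 0 then show ?thesis using greater by (auto intro!: derivative_eq_intros simp: power2_eq_square field_simps)
  next
    case (Suc m) then show ?thesis using greater
      by (auto intro!: derivative_eq_intros simp: power2_eq_square simp del: power_Suc)
  qed
  moreover have "real n * (1 / s) ^ (n - 1) * (- (1 / s\<^sup>2)) * exp (- (1 / s)) + (1 / s) ^ n * (exp (- (1 / s)) * (1 / s\<^sup>2))
     = exp_bump (n + 2) s - real n * exp_bump (n + 1) s"
    using greater by (cases n) (auto simp: exp_bump_def power2_eq_square field_simps)
  ultimately have "((\<lambda>s. (1 / s) ^ n * exp (- (1 / s))) has_real_derivative (exp_bump (n + 2) s - real n * exp_bump (n + 1) s)) (at s)"
    by simp
  then show ?thesis
    by (rule has_field_derivative_transform_within_open[where S = "{0<..}"]) (use greater in \<open>auto simp: exp_bump_def\<close>)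
next
  \<comment> \<open>At 0 the right difference quotient is the same expression with exponent
    \<open>n + 1\<close>, which tends to 0; the left one vanishes.\<close>
  case equal
  have "((\<lambda>h. (exp_bump n (0 + h) - exp_bump n 0) / h) \<longlongrightarrow> 0) (at_right 0)"
  proof (rule Lim_transform_eventually[OF exp_bump_tendsto_0[of "Suc n"]])
    show "\<forall>\<^sub>F h in at_right 0. (1 / h) ^ Suc n * exp (- (1 / h)) = (exp_bump n (0 + h) - exp_bump n 0) / h"
      by (auto simp: exp_bump_def eventually_at_filter)
  qed
  moreover have "((\<lambda>h. (exp_bump n (0 + h) - exp_bump n 0) / h) \<longlongrightarrow> 0) (at_left 0)"
  proof (rule Lim_transform_eventually[OF tendsto_const[of 0]])
    show "\<forall>\<^sub>F h in at_left 0. 0 = (exp_bump n (0 + h) - exp_bump n 0) / h"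
      by (auto simp: exp_bump_def eventually_at_filter)
  qed
  ultimately have "((\<lambda>h. (exp_bump n (0 + h) - exp_bump n 0) / h) \<longlongrightarrow> 0) (at 0)"
    by (simp add: filterlim_at_split)
  then show ?thesis using equal by (simp add: DERIV_def exp_bump_def)
qed

text \<open>The algebra generated by the mollifiers is closed under partial derivatives, which reduces
  \<^const>\<open>Ck\<close> for all orders to a first derivative of each generator.\<close>

inductive smooth :: "(real ^ 'd \<Rightarrow> real) \<Rightarrow> bool" where
  smooth_const: "smooth (\<lambda>x. c)"
| smooth_nth: "smooth (\<lambda>x. x $ i)"
| smooth_add: "smooth f \<Longrightarrow> smooth g \<Longrightarrow> smooth (\<lambda>x. f x + g x)"
| smooth_mult: "smooth f \<Longrightarrow> smooth g \<Longrightarrow> smooth (\<lambda>x. f x * g x)"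
| smooth_bump: "smooth (\<lambda>x. exp_bump n (1 - x \<bullet> x))"
| smooth_affine: "smooth f \<Longrightarrow> smooth (\<lambda>x. f (c *\<^sub>R x + a))"

lemmas smooth_rules = smooth_const smooth_nth smooth_add smooth_mult smooth_bump

text \<open>The derivative is displayed in coordinates, so that \<open>partial\<close>, which goes
  through \<open>frechet_derivative\<close>, can be read off by uniqueness.\<close>

definition has_grad :: "(real ^ 'd \<Rightarrow> real) \<Rightarrow> ('d \<Rightarrow> real ^ 'd \<Rightarrow> real) \<Rightarrow> bool" where
  "has_grad f f' \<longleftrightarrow> (\<forall>x. (f has_derivative (\<lambda>h. \<Sum>i\<in>UNIV. h $ i * f' i x)) (at x))"

lemma has_grad_partial:
  assumes "has_grad f f'" shows "partial i f = f' i"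
proof
  fix x
  have "frechet_derivative f (at x) = (\<lambda>h. \<Sum>i\<in>UNIV. h $ i * f' i x)"
    by (rule frechet_derivative_at[symmetric]) (use assms in \<open>simp add: has_grad_def\<close>)
  then have "partial i f x = (\<Sum>j\<in>UNIV. axis i 1 $ j * f' j x)" by (simp add: partial_def)
  also have "\<dots> = (\<Sum>j\<in>UNIV. if j = i then f' j x else 0)"
    by (intro sum.cong) (auto simp: axis_def)
  finally show "partial i f x = f' i x" by simp
qed

lemma has_grad_const: "has_grad (\<lambda>x. c) (\<lambda>i x. 0)"
  by (simp add: has_grad_def)

lemma has_grad_nth:
  fixes j :: "'d::finite"
  shows "has_grad (\<lambda>x. x $ j) (\<lambda>i x. if i = j then 1 else 0)"
proof -
  have "(\<Sum>i\<in>UNIV. h $ i * (if i = j then 1 else 0)) = h $ j" for h :: "real ^ 'd"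
  proof -
    have "(\<Sum>i\<in>UNIV. h $ i * (if i = j then 1 else 0)) = (\<Sum>i\<in>UNIV. if i = j then h $ i else 0)"
      by (intro sum.cong) auto
    then show ?thesis by simp
  qed
  then show ?thesis
    unfolding has_grad_def by (simp add: bounded_linear_imp_has_derivative bounded_linear_vec_nth)
qed

lemma has_grad_add: "has_grad f f' \<Longrightarrow> has_grad g g' \<Longrightarrow> has_grad (\<lambda>x. f x + g x) (\<lambda>i x. f' i x + g' i x)"
  unfolding has_grad_def distrib_left sum.distrib by (intro allI has_derivative_add) auto

lemma has_grad_mult:
  fixes f g :: "real ^ 'd \<Rightarrow> real"
  shows "has_grad f f' \<Longrightarrow> has_grad g g' \<Longrightarrow> has_grad (\<lambda>x. f x * g x) (\<lambda>i x. f' i x * g x + f x * g' i x)"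
  unfolding has_grad_def
proof
  fix x
  assume "\<forall>x. (f has_derivative (\<lambda>h. \<Sum>i\<in>UNIV. h $ i * f' i x)) (at x)" "\<forall>x. (g has_derivative (\<lambda>h. \<Sum>i\<in>UNIV. h $ i * g' i x)) (at x)"
  then have "((\<lambda>x. f x * g x) has_derivative (\<lambda>h. f x * (\<Sum>i\<in>UNIV. h $ i * g' i x) + (\<Sum>i\<in>UNIV. h $ i * f' i x) * g x)) (at x)"
    by (intro has_derivative_mult) auto
  moreover have "f x * (\<Sum>i\<in>UNIV. h $ i * g' i x) + (\<Sum>i\<in>UNIV. h $ i * f' i x) * g x = (\<Sum>i\<in>UNIV. h $ i * (f' i x * g x + f x * g' i x))" for h :: "real ^ 'd"
    by (simp add: sum_distrib_left sum_distrib_right sum.distrib[symmetric] algebra_simps)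
  ultimately show "((\<lambda>x. f x * g x) has_derivative (\<lambda>h. \<Sum>i\<in>UNIV. h $ i * (f' i x * g x + f x * g' i x))) (at x)" by simp
qed

lemma has_grad_bump: "has_grad (\<lambda>x. exp_bump n (1 - x \<bullet> x))
  (\<lambda>i x. (- 2) * x $ i * (exp_bump (n + 2) (1 - x \<bullet> x) - real n * exp_bump (n + 1) (1 - x \<bullet> x)))"
  unfolding has_grad_def
proof
  fix x :: "real ^ 'd"
  define b where "b = exp_bump (n + 2) (1 - x \<bullet> x) - real n * exp_bump (n + 1) (1 - x \<bullet> x)"
  have "((\<lambda>x. 1 - x \<bullet> x) has_derivative (\<lambda>h. - (x \<bullet> h + h \<bullet> x))) (at x)"
    by (auto intro!: derivative_eq_intros)
  from has_derivative_compose[OF this exp_bump_has_derivative[of n "1 - x \<bullet> x", unfolded has_field_derivative_def]]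
  have "((\<lambda>x. exp_bump n (1 - x \<bullet> x)) has_derivative (\<lambda>h. b * - (x \<bullet> h + h \<bullet> x))) (at x)"
    by (simp add: b_def)
  moreover have "b * - (x \<bullet> h + h \<bullet> x) = (\<Sum>i\<in>UNIV. h $ i * ((- 2) * x $ i * b))" for h
  proof -
    have "(\<Sum>i\<in>UNIV. h $ i * ((- 2) * x $ i * b)) = (- 2 * b) * (h \<bullet> x)"
      unfolding inner_vec_def sum_distrib_left by (intro sum.cong) auto
    then show ?thesis by (simp add: inner_commute)
  qed
  ultimately show "((\<lambda>x. exp_bump n (1 - x \<bullet> x)) has_derivative (\<lambda>h. \<Sum>i\<in>UNIV. h $ i * ((- 2) * x $ i * (exp_bump (n + 2) (1 - x \<bullet> x) - real n * exp_bump (n + 1) (1 - x \<bullet> x))))) (at x)"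
    by (simp add: b_def)
qed

lemma has_grad_affine: "has_grad f f' \<Longrightarrow> has_grad (\<lambda>x. f (c *\<^sub>R x + a)) (\<lambda>i x. c * f' i (c *\<^sub>R x + a))"
  unfolding has_grad_def
proof
  fix x
  assume f: "\<forall>x. (f has_derivative (\<lambda>h. \<Sum>i\<in>UNIV. h $ i * f' i x)) (at x)"
  have "((\<lambda>x. c *\<^sub>R x + a) has_derivative (\<lambda>h. c *\<^sub>R h)) (at x)" by (auto intro!: derivative_eq_intros)
  from has_derivative_compose[OF this f[rule_format]]
  show "((\<lambda>x. f (c *\<^sub>R x + a)) has_derivative (\<lambda>h. \<Sum>i\<in>UNIV. h $ i * (c * f' i (c *\<^sub>R x + a)))) (at x)"
    by (simp add: mult_ac)
qed

lemma smooth_has_grad: "smooth f \<Longrightarrow> \<exists>f'. has_grad f f' \<and> (\<forall>i. smooth (f' i))"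
proof (induction rule: smooth.induct)
  case (smooth_const c)
  show ?case using has_grad_const[of c] smooth.smooth_const[of 0] by (intro exI[of _ "\<lambda>i x. 0"]) auto
next
  case (smooth_nth j)
  show ?case using has_grad_nth[of j] by (intro exI[of _ "\<lambda>i x. if i = j then 1 else 0"]) (auto intro: smooth.smooth_const)
next
  case (smooth_add f g)
  then obtain f' g' where fg: "has_grad f f'" "has_grad g g'" "\<And>i. smooth (f' i)" "\<And>i. smooth (g' i)" by blast
  have "smooth (\<lambda>x. f' i x + g' i x)" for i
    by (intro smooth.smooth_add fg)
  then show ?case using has_grad_add[OF fg(1,2)] by (intro exI conjI allI)
next
  case (smooth_mult f g)
  then obtain f' g' where fg: "has_grad f f'" "has_grad g g'" "\<And>i. smooth (f' i)" "\<And>i. smooth (g' i)" by blast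
  have "smooth (\<lambda>x. f' i x * g x + f x * g' i x)" for i
    by (intro smooth.smooth_add smooth.smooth_mult fg smooth_mult)
  then show ?case using has_grad_mult[OF fg(1,2)] by (intro exI conjI allI)
next
  case (smooth_bump n)
  have "smooth (\<lambda>x. (- 2) * x $ i * (exp_bump (n + 2) (1 - x \<bullet> x) + (- real n) * exp_bump (n + 1) (1 - x \<bullet> x)))" for i
    by (intro smooth_rules)
  then show ?case using has_grad_bump[of n] by (intro exI conjI allI) auto
next
  case (smooth_affine f c a)
  then obtain f' where f: "has_grad f f'" "\<And>i. smooth (f' i)" by blast
  have "smooth (\<lambda>x. c * f' i (c *\<^sub>R x + a))" for i
    by (rule smooth.smooth_mult[OF smooth.smooth_const smooth.smooth_affine[OF f(2)]])
  then show ?case using has_grad_affine[OF f(1)] by (intro exI conjI allI)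
qed

lemma smooth_grad: "smooth f \<Longrightarrow> has_grad f (\<lambda>i. partial i f)"
proof -
  assume "smooth f"
  then obtain f' where f: "has_grad f f'" using smooth_has_grad by blast
  have "(\<lambda>i. partial i f) = f'" by (rule ext) (rule has_grad_partial[OF f])
  with f show ?thesis by simp
qed

lemma smooth_partial: "smooth f \<Longrightarrow> smooth (partial i f)"
proof -
  assume "smooth f"
  then obtain f' where f: "has_grad f f'" "\<And>i. smooth (f' i)" using smooth_has_grad by blast
  then show ?thesis using has_grad_partial[OF f(1)] by simp
qed

lemma smooth_has_derivative: "smooth f \<Longrightarrow> (f has_derivative (\<lambda>h. \<Sum>i\<in>UNIV. h $ i * partial i f x)) (at x)"
  using smooth_grad[of f] by (simp add: has_grad_def)

lemma smooth_continuous: "smooth f \<Longrightarrow> continuous_on S f"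
  by (intro continuous_at_imp_continuous_on ballI has_derivative_continuous[OF smooth_has_derivative])

lemma smooth_Ck: "smooth f \<Longrightarrow> Ck k f"
proof (induction k arbitrary: f)
  case 0 then show ?case by (simp add: smooth_continuous)
next
  case (Suc k)
  then show ?case using smooth_has_derivative[OF Suc.prems] smooth_partial[OF Suc.prems]
    by (auto simp: differentiable_def)
qed

lemma partial_add: "smooth f \<Longrightarrow> smooth g \<Longrightarrow> partial i (\<lambda>x. f x + g x) = (\<lambda>x. partial i f x + partial i g x)"
  by (rule has_grad_partial[OF has_grad_add[OF smooth_grad smooth_grad]])

lemma partial_mult: "smooth f \<Longrightarrow> smooth g \<Longrightarrow> partial i (\<lambda>x. f x * g x) = (\<lambda>x. partial i f x * g x + f x * partial i g x)"
  by (rule has_grad_partial[OF has_grad_mult[OF smooth_grad smooth_grad]])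

lemma partial_affine: "smooth f \<Longrightarrow> partial i (\<lambda>x. f (c *\<^sub>R x + a)) = (\<lambda>x. c * partial i f (c *\<^sub>R x + a))"
  by (rule has_grad_partial[OF has_grad_affine[OF smooth_grad]])

lemma partial_cmult: "smooth f \<Longrightarrow> partial i (\<lambda>x. c * f x) = (\<lambda>x. c * partial i f x)"
  using partial_mult[OF smooth_const, of f i c] by (simp add: has_grad_partial[OF has_grad_const])

text \<open>Induction over the generators: sums, products and affine substitutions inherit the
  symmetry, and the bump is the case that needs a computation.\<close>

lemma partial_commute:
  fixes f :: "real ^ 'd \<Rightarrow> real"
  shows "smooth f \<Longrightarrow> partial i (partial j f) = partial j (partial i f)"
proof (induction rule: smooth.induct)
  case (smooth_const c)
  show ?case by (simp add: has_grad_partial[OF has_grad_const])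
next
  case (smooth_nth k)
  show ?case by (simp add: has_grad_partial[OF has_grad_nth] has_grad_partial[OF has_grad_const])
next
  case (smooth_add f g)
  then show ?case by (simp add: partial_add smooth_partial)
next
  case (smooth_mult f g)
  then show ?case
    by (simp add: partial_add partial_mult smooth_partial smooth.smooth_mult) (simp add: fun_eq_iff)
next
  case (smooth_bump n)
  \<comment> \<open>The bump is radial: its \<open>k\<close>-th derivative is
    \<open>- 2 * x $ k * q\<close>, and the \<open>l\<close>-th derivative of \<open>q\<close> is
    \<open>- 2 * x $ l * q2\<close>, so the mixed second derivative is visibly symmetric in
    \<open>k\<close> and \<open>l\<close>.\<close>
  define q :: "real ^ 'd \<Rightarrow> real" where "q = (\<lambda>x. exp_bump (n + 2) (1 - x \<bullet> x) + (- real n) * exp_bump (n + 1) (1 - x \<bullet> x))"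
  define q2 :: "real ^ 'd \<Rightarrow> real" where "q2 = (\<lambda>x. exp_bump (n + 2 + 2) (1 - x \<bullet> x) - real (n + 2) * exp_bump (n + 2 + 1) (1 - x \<bullet> x)
     + (- real n) * (exp_bump (n + 1 + 2) (1 - x \<bullet> x) - real (n + 1) * exp_bump (n + 1 + 1) (1 - x \<bullet> x)))"
  have sq: "smooth q" unfolding q_def by (intro smooth_rules)
  have p1: "partial k (\<lambda>x. exp_bump n (1 - x \<bullet> x)) = (\<lambda>x. (- 2) * x $ k * q x)" for k
    using has_grad_partial[OF has_grad_bump[of n]] by (simp add: q_def)
  have pq: "partial l q = (\<lambda>x. (- 2) * x $ l * q2 x)" for l
  proof -
    have sb: "smooth (\<lambda>x :: real ^ 'd. exp_bump m (1 - x \<bullet> x))" for m by (rule smooth_rules)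
    have sc: "smooth (\<lambda>x :: real ^ 'd. (- real n) * exp_bump m (1 - x \<bullet> x))" for m by (intro smooth_rules)
    have pb: "partial l (\<lambda>x. exp_bump m (1 - x \<bullet> x)) = (\<lambda>x. (- 2) * x $ l * (exp_bump (m + 2) (1 - x \<bullet> x) - real m * exp_bump (m + 1) (1 - x \<bullet> x)))" for m
      by (rule has_grad_partial[OF has_grad_bump])
    show ?thesis
      unfolding q_def partial_add[OF sb sc] partial_cmult[OF sb] pb q2_def by (intro ext) algebra
  qed
  have p2: "partial l (\<lambda>x. (- 2) * x $ k * q x) = (\<lambda>x. (- 2) * (if l = k then 1 else 0) * q x + (- 2) * x $ k * ((- 2) * x $ l * q2 x))" for k l
  proof -
    have "partial l (\<lambda>x. (- 2) * x $ k) = (\<lambda>x. (- 2) * (if l = k then 1 else 0))"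
      using partial_cmult[OF smooth_nth, of l "- 2" k] by (simp add: has_grad_partial[OF has_grad_nth])
    moreover have "smooth (\<lambda>x :: real ^ 'd. (- 2) * x $ k)" by (intro smooth_rules)
    ultimately show ?thesis using partial_mult[of "\<lambda>x. (- 2) * x $ k" q l] sq by (simp add: pq)
  qed
  show ?case unfolding p1 p2 by (auto simp: fun_eq_iff)
next
  case (smooth_affine f c a)
  then show ?case by (simp add: partial_affine partial_cmult smooth_partial smooth.smooth_affine)
qed

section \<open>Kernels on the unit ball and their regularity\<close>

definition ball_kernel :: "(real ^ 'd \<Rightarrow> real) \<Rightarrow> bool" where
  "ball_kernel \<theta> \<longleftrightarrow> smooth \<theta> \<and> (\<forall>x. 1 < norm x \<longrightarrow> \<theta> x = 0)"

lemma kernel_smooth: "ball_kernel \<theta> \<Longrightarrow> smooth \<theta>"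
  and kernel_eq_0: "ball_kernel \<theta> \<Longrightarrow> 1 < norm x \<Longrightarrow> \<theta> x = 0"
  by (auto simp: ball_kernel_def)

lemma kernel_partial:
  assumes "ball_kernel \<theta>" shows "ball_kernel (partial i \<theta>)"
proof -
  have "partial i \<theta> x = 0" if x: "1 < norm x" for x
  proof -
    have "((\<lambda>_. 0) has_derivative (\<lambda>_. 0)) (at x)" by simp
    then have "(\<theta> has_derivative (\<lambda>_. 0)) (at x)"
    proof (rule has_derivative_transform_within_open)
      show "open (- cball (0 :: real ^ 'd) 1)" by (intro open_Compl closed_cball)
    qed (use x kernel_eq_0[OF assms] in auto)
    then have "frechet_derivative \<theta> (at x) = (\<lambda>_. 0)" by (rule frechet_derivative_at[symmetric])
    then show ?thesis by (simp add: partial_def)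
  qed
  then show ?thesis using smooth_partial[OF kernel_smooth[OF assms]] by (auto simp: ball_kernel_def)
qed

lemma kernel_bounded:
  assumes "ball_kernel \<theta>" obtains B where "0 < B" "\<And>x. \<bar>\<theta> x\<bar> \<le> B"
proof -
  have "compact (\<theta> ` cball 0 1)"
    by (intro compact_continuous_image smooth_continuous kernel_smooth assms) simp
  then have "bounded (\<theta> ` cball 0 1)" by (rule compact_imp_bounded)
  then obtain B where B: "\<And>x. x \<in> cball 0 1 \<Longrightarrow> \<bar>\<theta> x\<bar> \<le> B"
    unfolding bounded_iff by (metis imageI real_norm_def)
  have "\<bar>\<theta> x\<bar> \<le> \<bar>B\<bar> + 1" for x
    using B[of x] kernel_eq_0[OF assms, of x] by (cases "norm x \<le> 1") auto
  then show ?thesis by (intro that[of "\<bar>B\<bar> + 1"]) auto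
qed

lemma norm_grad_le: "\<bar>\<Sum>i\<in>UNIV. h $ i * a i\<bar> \<le> norm (h :: real ^ 'd) * (\<Sum>i\<in>UNIV. \<bar>a i\<bar>)"
proof -
  have "\<bar>\<Sum>i\<in>UNIV. h $ i * a i\<bar> \<le> (\<Sum>i\<in>UNIV. \<bar>h $ i * a i\<bar>)" by (rule sum_abs)
  also have "\<dots> \<le> (\<Sum>i\<in>UNIV. norm h * \<bar>a i\<bar>)"
    unfolding abs_mult by (intro sum_mono mult_right_mono component_le_norm_cart) auto
  finally show ?thesis by (simp add: sum_distrib_left)
qed

lemma smooth_lipschitz:
  fixes B :: real
  assumes f: "has_grad f f'" and B: "\<And>i x. \<bar>f' i x\<bar> \<le> B"
  shows "\<bar>f x - f (y :: real ^ 'd)\<bar> \<le> CARD('d) * B * norm (x - y)"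
proof -
  have "norm (f x - f y) \<le> CARD('d) * B * norm (x - y)"
  proof (rule differentiable_bound[where S = UNIV and f' = "\<lambda>x h. \<Sum>i\<in>UNIV. h $ i * f' i x"])
    show "(f has_derivative (\<lambda>h. \<Sum>i\<in>UNIV. h $ i * f' i x)) (at x within UNIV)" for x
      using f by (simp add: has_grad_def)
    show "onorm (\<lambda>h. \<Sum>i\<in>UNIV. h $ i * f' i x) \<le> CARD('d) * B" for x
    proof (rule onorm_le)
      fix h :: "real ^ 'd"
      have "(\<Sum>i\<in>UNIV. \<bar>f' i x\<bar>) \<le> (\<Sum>i\<in>(UNIV :: 'd set). B)" using B by (intro sum_mono) auto
      then have "norm h * (\<Sum>i\<in>UNIV. \<bar>f' i x\<bar>) \<le> norm h * (CARD('d) * B)" by (intro mult_left_mono) auto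
      then show "norm (\<Sum>i\<in>UNIV. h $ i * f' i x) \<le> CARD('d) * B * norm h"
        using norm_grad_le[of h "\<lambda>i. f' i x"] by (simp add: mult_ac)
    qed
  qed auto
  then show ?thesis by simp
qed

lemma kernel_lipschitz:
  fixes \<theta> :: "real ^ 'd \<Rightarrow> real"
  assumes "ball_kernel \<theta>" obtains K where "0 < K" "\<And>x y. \<bar>\<theta> x - \<theta> y\<bar> \<le> K * norm (x - y)"
proof -
  have "\<exists>B. 0 < B \<and> (\<forall>x. \<bar>partial i \<theta> x\<bar> \<le> B)" for i
    using kernel_bounded[OF kernel_partial[OF assms, of i]] by metis
  then obtain B where B: "\<And>i. 0 < B i" "\<And>i x. \<bar>partial i \<theta> x\<bar> \<le> B i" by metis
  have "\<bar>partial i \<theta> x\<bar> \<le> (\<Sum>i\<in>UNIV. B i)" for i x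
    using B(2)[of i x] member_le_sum[of i UNIV B] B(1) by (force simp: less_imp_le)
  from smooth_lipschitz[OF smooth_grad[OF kernel_smooth[OF assms]] this]
  have "\<bar>\<theta> x - \<theta> y\<bar> \<le> CARD('d) * (\<Sum>i\<in>UNIV. B i) * norm (x - y)" for x y .
  moreover have "0 < CARD('d) * (\<Sum>i\<in>UNIV. B i)" using B(1) by (simp add: sum_pos)
  ultimately show ?thesis by (intro that)
qed

text \<open>Mean value inequality for \<open>\<theta> (z + h)\<close> minus its linear part: the
  derivative is a difference of first partials, and these are Lipschitz because they are kernels
  themselves.\<close>

lemma kernel_taylor:
  fixes \<theta> :: "real ^ 'd \<Rightarrow> real"
  assumes "ball_kernel \<theta>"
  obtains K where "0 < K" "\<And>z k. \<bar>\<theta> (z + k) - \<theta> z - (\<Sum>i\<in>UNIV. k $ i * partial i \<theta> z)\<bar> \<le> K * (norm k)\<^sup>2"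
proof -
  have "\<exists>K. 0 < K \<and> (\<forall>x y. \<bar>partial i \<theta> x - partial i \<theta> y\<bar> \<le> K * norm (x - y))" for i
    using kernel_lipschitz[OF kernel_partial[OF assms, of i]] by metis
  then obtain K where K: "\<And>i. 0 < K i" "\<And>i x y. \<bar>partial i \<theta> x - partial i \<theta> y\<bar> \<le> K i * norm (x - y)" by metis
  define S where "S = (\<Sum>i\<in>UNIV. K i)"
  have "\<bar>\<theta> (z + k) - \<theta> z - (\<Sum>i\<in>UNIV. k $ i * partial i \<theta> z)\<bar> \<le> S * (norm k)\<^sup>2" for z k
  proof -
    define g where "g h = \<theta> (z + h) - (\<Sum>i\<in>UNIV. h $ i * partial i \<theta> z)" for h
    define g' where "g' h v = (\<Sum>i\<in>UNIV. v $ i * (partial i \<theta> (z + h) - partial i \<theta> z))" for h v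
    have "norm (g k - g 0) \<le> (S * norm k) * norm (k - 0)"
    proof (rule differentiable_bound[where S = "cball 0 (norm k)" and f' = g'])
      fix h :: "real ^ 'd" assume h: "h \<in> cball 0 (norm k)"
      have "((\<lambda>h. \<theta> (z + h)) has_derivative (\<lambda>v. \<Sum>i\<in>UNIV. v $ i * partial i \<theta> (z + h))) (at h)"
        by (rule has_derivative_compose[OF _ smooth_has_derivative[OF kernel_smooth[OF assms]]]) (auto intro!: derivative_eq_intros)
      moreover have "((\<lambda>h. \<Sum>i\<in>UNIV. h $ i * partial i \<theta> z) has_derivative (\<lambda>v. \<Sum>i\<in>UNIV. v $ i * partial i \<theta> z)) (at h)"
        by (intro has_derivative_sum has_derivative_mult_left bounded_linear_imp_has_derivative bounded_linear_vec_nth)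
      ultimately have gd: "(g has_derivative (\<lambda>v. (\<Sum>i\<in>UNIV. v $ i * partial i \<theta> (z + h)) - (\<Sum>i\<in>UNIV. v $ i * partial i \<theta> z))) (at h)"
        unfolding g_def[abs_def] by (rule has_derivative_diff)
      have g'h: "g' h = (\<lambda>v. (\<Sum>i\<in>UNIV. v $ i * partial i \<theta> (z + h)) - (\<Sum>i\<in>UNIV. v $ i * partial i \<theta> z))"
        by (rule ext) (simp add: g'_def right_diff_distrib sum_subtractf)
      show "(g has_derivative g' h) (at h within cball 0 (norm k))"
        unfolding g'h by (rule has_derivative_at_withinI[OF gd])
      show "onorm (g' h) \<le> S * norm k"
      proof (rule onorm_le)
        fix v :: "real ^ 'd"
        have "(\<Sum>i\<in>UNIV. \<bar>partial i \<theta> (z + h) - partial i \<theta> z\<bar>) \<le> (\<Sum>i\<in>UNIV. K i * norm k)"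
        proof (rule sum_mono)
          fix i
          have "\<bar>partial i \<theta> (z + h) - partial i \<theta> z\<bar> \<le> K i * norm h" using K(2)[of i "z + h" z] by simp
          also have "\<dots> \<le> K i * norm k" using h K(1)[of i] by (intro mult_left_mono) auto
          finally show "\<bar>partial i \<theta> (z + h) - partial i \<theta> z\<bar> \<le> K i * norm k" .
        qed
        then have "norm v * (\<Sum>i\<in>UNIV. \<bar>partial i \<theta> (z + h) - partial i \<theta> z\<bar>) \<le> norm v * (S * norm k)"
          by (intro mult_left_mono) (auto simp: S_def sum_distrib_right)
        then show "norm (g' h v) \<le> S * norm k * norm v"
          using norm_grad_le[of v "\<lambda>i. partial i \<theta> (z + h) - partial i \<theta> z"] by (simp add: g'_def mult_ac)
      qed
    qed auto
    then show ?thesis by (simp add: g_def power2_eq_square algebra_simps)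
  qed
  moreover have "0 < S" using K(1) by (simp add: S_def sum_pos)
  ultimately show ?thesis by (intro that)
qed

section \<open>Convolution with a kernel at scale \<open>r\<close>, without normalisation\<close>

definition conv :: "(real ^ 'd \<Rightarrow> real) \<Rightarrow> real \<Rightarrow> (real ^ 'd \<Rightarrow> real) \<Rightarrow> real ^ 'd \<Rightarrow> real" where
  "conv \<theta> r w x = (LINT y|lebesgue. w y * \<theta> ((1 / r) *\<^sub>R (x - y)))"

lemma kernel_scaled_eq_0:
  assumes "ball_kernel \<theta>" "0 < r" "y \<notin> cball x r"
  shows "\<theta> ((1 / r) *\<^sub>R (x - y)) = 0"
  using assms by (intro kernel_eq_0) (auto simp: dist_norm)

lemma kernel_scaled_continuous:
  assumes "ball_kernel \<theta>" shows "continuous_on UNIV (\<lambda>y. \<theta> ((1 / r) *\<^sub>R (x - y)))"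
  by (rule continuous_on_compose2[OF smooth_continuous[OF kernel_smooth[OF assms]], of UNIV])
    (auto intro!: continuous_intros)

lemma kernel_scaled_measurable:
  assumes "ball_kernel \<theta>" shows "(\<lambda>y. \<theta> ((1 / r) *\<^sub>R (x - y))) \<in> borel_measurable borel"
  by (rule borel_measurable_continuous_onI[OF kernel_scaled_continuous[OF assms]])

lemma measurable_lebesgueI: "f \<in> borel_measurable borel \<Longrightarrow> f \<in> borel_measurable lebesgue"
  by (rule measurable_completion) simp

lemma conv_integrable:
  assumes \<theta>: "ball_kernel \<theta>" and w: "L1_loc w" and r: "0 < r"
  shows "integrable lebesgue (\<lambda>y. w y * \<theta> ((1 / r) *\<^sub>R (x - y)))"
proof -
  obtain B where B: "0 < B" "\<And>z. \<bar>\<theta> z\<bar> \<le> B" by (rule kernel_bounded[OF \<theta>]) blast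
  define v where "v y = indicator (cball x r) y *\<^sub>R w y" for y
  have v: "integrable lebesgue v"
    using w by (simp add: L1_loc_def set_integrable_def v_def[abs_def])
  have eq: "(\<lambda>y. w y * \<theta> ((1 / r) *\<^sub>R (x - y))) = (\<lambda>y. v y * \<theta> ((1 / r) *\<^sub>R (x - y)))"
    using kernel_scaled_eq_0[OF \<theta> r] by (auto simp: v_def indicator_def fun_eq_iff)
  show ?thesis
    unfolding eq
  proof (rule Bochner_Integration.integrable_bound)
    show "integrable lebesgue (\<lambda>y. B * v y)" using v by simp
    show "(\<lambda>y. v y * \<theta> ((1 / r) *\<^sub>R (x - y))) \<in> borel_measurable lebesgue"
      by (intro borel_measurable_times borel_measurable_integrable[OF v] measurable_lebesgueI kernel_scaled_measurable \<theta>)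
    show "AE y in lebesgue. norm (v y * \<theta> ((1 / r) *\<^sub>R (x - y))) \<le> norm (B * v y)"
    proof (rule AE_I2)
      fix y
      have "\<bar>v y\<bar> * \<bar>\<theta> ((1 / r) *\<^sub>R (x - y))\<bar> \<le> \<bar>v y\<bar> * B" using B(2) by (intro mult_left_mono) auto
      then show "norm (v y * \<theta> ((1 / r) *\<^sub>R (x - y))) \<le> norm (B * v y)"
        using B(1) by (simp add: abs_mult mult.commute)
    qed
  qed
qed

lemma L1_loc_continuous:
  fixes w :: "real ^ 'd \<Rightarrow> real"
  assumes "continuous_on UNIV w" shows "L1_loc w"
  unfolding L1_loc_def
proof (intro allI impI)
  fix K :: "(real ^ 'd) set" assume K: "compact K"
  have c: "continuous_on K w" using assms continuous_on_subset by blast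
  have "integrable lborel (\<lambda>x. indicator K x *\<^sub>R w x)"
    by (rule borel_integrable_compact[OF K c])
  then show "w absolutely_integrable_on K"
    unfolding set_integrable_def by (subst integrable_completion) auto
qed

lemma L1_loc_bounded:
  fixes w :: "real ^ 'd \<Rightarrow> real"
  assumes [measurable]: "w \<in> borel_measurable borel" and "\<And>x. \<bar>w x\<bar> \<le> M"
  shows "L1_loc w"
  unfolding L1_loc_def
proof (intro allI impI)
  fix K :: "(real ^ 'd) set" assume K: "compact K"
  then have [measurable]: "K \<in> sets borel" by (simp add: compact_imp_closed)
  have "integrable lborel (\<lambda>x. indicator K x *\<^sub>R w x)"
    using emeasure_compact_finite[OF K] assms
    by (intro integrableI_bounded_set_indicator[where B = M]) auto
  then show "w absolutely_integrable_on K"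
    unfolding set_integrable_def by (subst integrable_completion) auto
qed

lemma L1_loc_abs_integral:
  assumes "L1_loc w"
  shows "integrable lebesgue (\<lambda>y. indicator (cball x R) y * \<bar>w y\<bar>)"
proof -
  have "integrable lebesgue (\<lambda>y. \<bar>indicator (cball x R) y *\<^sub>R w y\<bar>)"
    using assms unfolding L1_loc_def set_integrable_def by (intro integrable_abs) simp
  then show ?thesis by (simp add: abs_mult)
qed

lemma conv_diff:
  assumes "ball_kernel \<theta>" "0 < r" "L1_loc v" "L1_loc w"
  shows "conv \<theta> r (\<lambda>y. v y - w y) x = conv \<theta> r v x - conv \<theta> r w x"
  unfolding conv_def left_diff_distrib
  by (rule Bochner_Integration.integral_diff[OF conv_integrable[OF assms(1,3,2)] conv_integrable[OF assms(1,4,2)]])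

lemma conv_cmult: "conv \<theta> r (\<lambda>y. c * w y) x = c * conv \<theta> r w x"
  unfolding conv_def by (simp add: mult.assoc)

lemma conv_sum_kernel:
  assumes "\<And>i. i \<in> I \<Longrightarrow> ball_kernel (\<theta> i)" "0 < r" "L1_loc w"
  shows "conv (\<lambda>z. \<Sum>i\<in>I. \<theta> i z) r w x = (\<Sum>i\<in>I. conv (\<theta> i) r w x)"
  unfolding conv_def sum_distrib_left
  by (rule Bochner_Integration.integral_sum) (intro conv_integrable assms)

text \<open>Two balls are allowed because a difference of convolutions lives near both centres; this
  is the source of the factor 2.\<close>

lemma integral_abs_le_indicator:
  fixes f :: "real ^ 'd \<Rightarrow> real"
  assumes f: "integrable lebesgue f" and c: "0 \<le> c" and r: "0 \<le> r"
    and le: "\<And>y. \<bar>f y\<bar> \<le> c * (indicator (cball x r) y + indicator (cball x' r) y)"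
  shows "\<bar>LINT y|lebesgue. f y\<bar> \<le> 2 * c * (unit_ball_vol CARD('d) * r ^ CARD('d))"
proof -
  have fin: "integrable lebesgue (indicator (cball a r) :: real ^ 'd \<Rightarrow> real)" for a
    by (subst integrable_completion) (auto intro!: integrable_real_indicator emeasure_lborel_cball_finite)
  have "\<bar>LINT y|lebesgue. f y\<bar> \<le> (LINT y|lebesgue. \<bar>f y\<bar>)" by (rule integral_abs_bound)
  also have "\<dots> \<le> (LINT y|lebesgue. c * (indicator (cball x r) y + indicator (cball x' r) y))"
    using f fin le by (intro integral_mono) auto
  also have "\<dots> = c * (measure lborel (cball x r) + measure lborel (cball x' r))"
    using fin by (simp add: integral_completion)
  also have "\<dots> = 2 * c * (unit_ball_vol CARD('d) * r ^ CARD('d))"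
    using r by (simp add: content_cball)
  finally show ?thesis .
qed

lemma conv_abs_le:
  fixes \<theta> :: "real ^ 'd \<Rightarrow> real"
  assumes \<theta>: "ball_kernel \<theta>" and w: "L1_loc w" and r: "0 < r" and B: "\<And>z. \<bar>\<theta> z\<bar> \<le> B"
    and N: "\<And>y. y \<in> cball x r \<Longrightarrow> \<bar>w y\<bar> \<le> N"
  shows "\<bar>conv \<theta> r w x\<bar> \<le> 2 * (N * B) * (unit_ball_vol CARD('d) * r ^ CARD('d))"
  unfolding conv_def
proof (rule integral_abs_le_indicator[OF conv_integrable[OF \<theta> w r]])
  have N0: "0 \<le> N" using N[of x] r by simp
  have B0: "0 \<le> B" using B[of 0] by simp
  show "0 \<le> N * B" using N0 B0 by simp
  show "\<bar>w y * \<theta> ((1 / r) *\<^sub>R (x - y))\<bar> \<le> N * B * (indicator (cball x r) y + indicator (cball x r) y)" for y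
  proof (cases "y \<in> cball x r")
    case True
    have "\<bar>w y\<bar> * \<bar>\<theta> ((1 / r) *\<^sub>R (x - y))\<bar> \<le> N * B" using N[OF True] B N0 by (intro mult_mono) auto
    also have "\<dots> \<le> N * B * 2" using N0 B0 by simp
    finally show ?thesis using True by (simp add: abs_mult)
  next
    case False then show ?thesis using kernel_scaled_eq_0[OF \<theta> r False] by simp
  qed
qed (use r in simp)

lemma conv_lipschitz:
  fixes \<theta> :: "real ^ 'd \<Rightarrow> real"
  assumes \<theta>: "ball_kernel \<theta>" and w: "L1_loc w" and r: "0 < r" and K: "\<And>z z'. \<bar>\<theta> z - \<theta> z'\<bar> \<le> K * norm (z - z')"
    and N: "\<And>y. \<bar>w y\<bar> \<le> N"
  shows "\<bar>conv \<theta> r w x - conv \<theta> r w x'\<bar> \<le> 2 * (N * (K * (norm (x - x') / r))) * (unit_ball_vol CARD('d) * r ^ CARD('d))"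
proof -
  have N0: "0 \<le> N" using N[of x] by simp
  have "\<bar>\<theta> (axis undefined 1) - \<theta> 0\<bar> \<le> K" using K[of "axis undefined 1" 0] by simp
  then have K0: "0 \<le> K" by linarith
  define D where "D = K * (norm (x - x') / r)"
  have D0: "0 \<le> D" using K0 r by (simp add: D_def)
  have lip: "\<bar>\<theta> ((1 / r) *\<^sub>R (x - y)) - \<theta> ((1 / r) *\<^sub>R (x' - y))\<bar> \<le> D" for y
  proof -
    have "norm ((1 / r) *\<^sub>R (x - y) - (1 / r) *\<^sub>R (x' - y)) = norm ((1 / r) *\<^sub>R (x - x'))"
      by (simp add: algebra_simps)
    also have "\<dots> = norm (x - x') / r" using r by simp
    finally show ?thesis using K[of "(1 / r) *\<^sub>R (x - y)" "(1 / r) *\<^sub>R (x' - y)"] by (simp add: D_def)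
  qed
  have "conv \<theta> r w x - conv \<theta> r w x' = (LINT y|lebesgue. w y * \<theta> ((1 / r) *\<^sub>R (x - y)) - w y * \<theta> ((1 / r) *\<^sub>R (x' - y)))"
    unfolding conv_def by (rule Bochner_Integration.integral_diff[symmetric]) (intro conv_integrable \<theta> w r)+
  also have "\<bar>\<dots>\<bar> \<le> 2 * (N * D) * (unit_ball_vol CARD('d) * r ^ CARD('d))"
  proof (rule integral_abs_le_indicator)
    show "integrable lebesgue (\<lambda>y. w y * \<theta> ((1 / r) *\<^sub>R (x - y)) - w y * \<theta> ((1 / r) *\<^sub>R (x' - y)))"
      by (intro Bochner_Integration.integrable_diff conv_integrable \<theta> w r)
    show "0 \<le> N * D" using N0 D0 by simp
    fix y
    show "\<bar>w y * \<theta> ((1 / r) *\<^sub>R (x - y)) - w y * \<theta> ((1 / r) *\<^sub>R (x' - y))\<bar> \<le> N * D * (indicator (cball x r) y + indicator (cball x' r) y)"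
    proof (cases "y \<in> cball x r \<union> cball x' r")
      case True
      then have "1 \<le> indicator (cball x r) y + (indicator (cball x' r) y :: real)" by (auto simp: indicator_def)
      then have "N * D * 1 \<le> N * D * (indicator (cball x r) y + indicator (cball x' r) y)" using N0 D0 by (intro mult_left_mono) auto
      moreover have "\<bar>w y\<bar> * \<bar>\<theta> ((1 / r) *\<^sub>R (x - y)) - \<theta> ((1 / r) *\<^sub>R (x' - y))\<bar> \<le> N * D"
        using N lip N0 by (intro mult_mono) auto
      ultimately show ?thesis by (simp add: abs_mult[symmetric] right_diff_distrib)
    next
      case False
      then show ?thesis using kernel_scaled_eq_0[OF \<theta> r, of y x] kernel_scaled_eq_0[OF \<theta> r, of y x'] by simp
    qed
  qed (use r in simp)
  finally show ?thesis by (simp add: D_def)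
qed

lemma conv_one:
  fixes \<theta> :: "real ^ 'd \<Rightarrow> real"
  assumes \<theta>: "ball_kernel \<theta>" and r: "0 < r"
  shows "conv \<theta> r (\<lambda>_. 1) x = r ^ CARD('d) * (LINT z|lborel. \<theta> z)"
proof -
  have [measurable]: "\<theta> \<in> borel_measurable borel"
    by (intro borel_measurable_continuous_onI smooth_continuous kernel_smooth \<theta>)
  have "conv \<theta> r (\<lambda>_. 1) x = (LINT y|lborel. \<theta> ((1 / r) *\<^sub>R (x - y)))"
    unfolding conv_def by (simp add: integral_completion)
  also have "\<dots> = (LINT z|lborel. \<bar>- r\<bar> ^ CARD('d) * \<theta> ((1 / r) *\<^sub>R (x - (x + (- r) *\<^sub>R z))))"
    using r by (subst lborel_affine[of "- r" x]) (simp_all add: integral_density integral_distr)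
  also have "\<dots> = (LINT z|lborel. r ^ CARD('d) * \<theta> z)" using r by simp
  finally show ?thesis by simp
qed

text \<open>\<open>w\<close> is only locally integrable, so all regularity comes from the kernel:
  its quadratic Taylor remainder, integrated against \<open>\<bar>w\<bar>\<close>, is of order
  \<open>(norm h)\<^sup>2\<close>.\<close>

lemma conv_has_grad:
  fixes \<theta> :: "real ^ 'd \<Rightarrow> real"
  assumes \<theta>: "ball_kernel \<theta>" and w: "L1_loc w" and r: "0 < r"
  shows "has_grad (conv \<theta> r w) (\<lambda>i x. (1 / r) * conv (partial i \<theta>) r w x)"
  unfolding has_grad_def
proof
  fix x :: "real ^ 'd"
  obtain K where K: "0 < K" "\<And>z k. \<bar>\<theta> (z + k) - \<theta> z - (\<Sum>i\<in>UNIV. k $ i * partial i \<theta> z)\<bar> \<le> K * (norm k)\<^sup>2"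
    by (rule kernel_taylor[OF \<theta>]) blast
  \<comment> \<open>For \<open>norm h \<le> 1\<close> the radius \<open>r + 1\<close> contains the
    supports of the kernels centred at \<open>x\<close> and at \<open>x + h\<close>.\<close>
  define W where "W = (LINT y|lebesgue. indicator (cball x (r + 1)) y * \<bar>w y\<bar>)"
  have W: "0 \<le> W" unfolding W_def by (intro integral_nonneg_AE) auto
  define D where "D h = (\<Sum>i\<in>UNIV. h $ i * ((1 / r) * conv (partial i \<theta>) r w x))" for h
  have rem: "\<bar>conv \<theta> r w (x + h) - conv \<theta> r w x - D h\<bar> \<le> (K / r\<^sup>2 * W) * (norm h)\<^sup>2" if h: "norm h \<le> 1" for h
  proof -
    have pint: "integrable lebesgue (\<lambda>y. w y * partial i \<theta> ((1 / r) *\<^sub>R (x - y)))" for i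
      by (intro conv_integrable kernel_partial \<theta> w r)
    define R where "R y = w y * (\<theta> ((1 / r) *\<^sub>R (x + h - y)) - \<theta> ((1 / r) *\<^sub>R (x - y)) - (\<Sum>i\<in>UNIV. (h $ i / r) * partial i \<theta> ((1 / r) *\<^sub>R (x - y))))" for y
    have Deq: "D h = (LINT y|lebesgue. (\<Sum>i\<in>UNIV. (h $ i / r) * (w y * partial i \<theta> ((1 / r) *\<^sub>R (x - y)))))"
      using pint by (simp add: D_def conv_def Bochner_Integration.integral_sum)
    have Rint: "integrable lebesgue (\<lambda>y. (w y * \<theta> ((1 / r) *\<^sub>R (x + h - y)) - w y * \<theta> ((1 / r) *\<^sub>R (x - y))) - (\<Sum>i\<in>UNIV. (h $ i / r) * (w y * partial i \<theta> ((1 / r) *\<^sub>R (x - y)))))"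
      using pint by (intro Bochner_Integration.integrable_diff Bochner_Integration.integrable_sum integrable_mult_right conv_integrable kernel_partial \<theta> w r)
    have Req: "R y = (w y * \<theta> ((1 / r) *\<^sub>R (x + h - y)) - w y * \<theta> ((1 / r) *\<^sub>R (x - y))) - (\<Sum>i\<in>UNIV. (h $ i / r) * (w y * partial i \<theta> ((1 / r) *\<^sub>R (x - y))))" for y
      unfolding R_def by (simp add: right_diff_distrib sum_distrib_left mult_ac)
    have "conv \<theta> r w (x + h) - conv \<theta> r w x - D h = (LINT y|lebesgue. R y)"
      unfolding Req Deq conv_def using pint
      by (subst Bochner_Integration.integral_diff, (intro Bochner_Integration.integrable_diff Bochner_Integration.integrable_sum integrable_mult_right conv_integrable \<theta> w r pint)+)
        (subst Bochner_Integration.integral_diff, (intro conv_integrable \<theta> w r)+, simp)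
    also have "\<bar>\<dots>\<bar> \<le> (LINT y|lebesgue. \<bar>R y\<bar>)" by (rule integral_abs_bound)
    also have "\<dots> \<le> (LINT y|lebesgue. (K / r\<^sup>2 * (norm h)\<^sup>2) * (indicator (cball x (r + 1)) y * \<bar>w y\<bar>))"
    proof (rule integral_mono)
      show "integrable lebesgue (\<lambda>y. \<bar>R y\<bar>)" unfolding Req by (rule integrable_abs[OF Rint])
      show "integrable lebesgue (\<lambda>y. (K / r\<^sup>2 * (norm h)\<^sup>2) * (indicator (cball x (r + 1)) y * \<bar>w y\<bar>))"
        by (intro integrable_mult_right L1_loc_abs_integral w)
      fix y
      show "\<bar>R y\<bar> \<le> (K / r\<^sup>2 * (norm h)\<^sup>2) * (indicator (cball x (r + 1)) y * \<bar>w y\<bar>)"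
      proof (cases "y \<in> cball x (r + 1)")
        case True
        have "\<bar>\<theta> ((1 / r) *\<^sub>R (x - y) + (1 / r) *\<^sub>R h) - \<theta> ((1 / r) *\<^sub>R (x - y)) - (\<Sum>i\<in>UNIV. ((1 / r) *\<^sub>R h) $ i * partial i \<theta> ((1 / r) *\<^sub>R (x - y)))\<bar> \<le> K * (norm ((1 / r) *\<^sub>R h))\<^sup>2"
          by (rule K(2))
        moreover have "(1 / r) *\<^sub>R (x - y) + (1 / r) *\<^sub>R h = (1 / r) *\<^sub>R (x + h - y)" by (simp add: algebra_simps)
        moreover have "K * (norm ((1 / r) *\<^sub>R h))\<^sup>2 = K / r\<^sup>2 * (norm h)\<^sup>2" using r by (simp add: power_divide)
        ultimately have "\<bar>\<theta> ((1 / r) *\<^sub>R (x + h - y)) - \<theta> ((1 / r) *\<^sub>R (x - y)) - (\<Sum>i\<in>UNIV. (h $ i / r) * partial i \<theta> ((1 / r) *\<^sub>R (x - y)))\<bar> \<le> K / r\<^sup>2 * (norm h)\<^sup>2"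
          by simp
        from mult_left_mono[OF this, of "\<bar>w y\<bar>"] show ?thesis using True by (simp add: R_def abs_mult mult_ac)
      next
        case False
        then have far: "r + 1 < norm (x - y)" by (simp add: dist_norm)
        have "norm (x - y) \<le> norm (x + h - y) + norm h"
          using norm_triangle_ineq4[of "x + h - y" h] by simp
        then have "y \<notin> cball (x + h) r" using far h by (simp add: dist_norm)
        moreover have "y \<notin> cball x r" using False by auto
        ultimately have "R y = 0"
          using kernel_scaled_eq_0[OF \<theta> r] kernel_scaled_eq_0[OF kernel_partial[OF \<theta>] r] by (simp add: R_def)
        then show ?thesis using False by simp
      qed
    qed
    also have "\<dots> = (K / r\<^sup>2 * W) * (norm h)\<^sup>2" by (simp add: W_def)
    finally show ?thesis .
  qed
  have bl: "bounded_linear D"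
    unfolding D_def by (intro bounded_linear_sum bounded_linear_mult_left[THEN bounded_linear_compose] bounded_linear_vec_nth)
  show "(conv \<theta> r w has_derivative (\<lambda>h. \<Sum>i\<in>UNIV. h $ i * ((1 / r) * conv (partial i \<theta>) r w x))) (at x)"
    unfolding D_def[symmetric] has_derivative_at_alt
  proof (intro conjI allI impI)
    show "bounded_linear (\<lambda>h. D h)" using bl by simp
    fix e :: real assume e: "0 < e"
    define Q where "Q = K / r\<^sup>2 * W + 1"
    have Q: "0 < Q" using K(1) W r by (simp add: Q_def add_nonneg_pos)
    show "\<exists>d>0. \<forall>y. norm (y - x) < d \<longrightarrow> norm (conv \<theta> r w y - conv \<theta> r w x - D (y - x)) \<le> e * norm (y - x)"
    proof (intro exI[of _ "min 1 (e / Q)"] conjI allI impI)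
      show "0 < min 1 (e / Q)" using e Q by simp
      fix y assume y: "norm (y - x) < min 1 (e / Q)"
      have "norm (conv \<theta> r w y - conv \<theta> r w x - D (y - x)) \<le> (K / r\<^sup>2 * W) * (norm (y - x))\<^sup>2"
        using rem[of "y - x"] y by simp
      also have "\<dots> \<le> Q * (norm (y - x))\<^sup>2" by (intro mult_right_mono) (auto simp: Q_def)
      also have "\<dots> = (Q * norm (y - x)) * norm (y - x)" by (simp add: power2_eq_square)
      also have "\<dots> \<le> e * norm (y - x)"
        using y Q by (intro mult_right_mono) (auto simp: field_simps)
      finally show "norm (conv \<theta> r w y - conv \<theta> r w x - D (y - x)) \<le> e * norm (y - x)" .
    qed
  qed
qed

text \<open>Convolving a constant gives a constant, so a partial derivative of a kernel has mean
  zero. Constants can therefore be subtracted before such a convolution is estimated.\<close>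

lemma conv_partial_one:
  fixes \<theta> :: "real ^ 'd \<Rightarrow> real"
  assumes \<theta>: "ball_kernel \<theta>" and r: "0 < r"
  shows "conv (partial i \<theta>) r (\<lambda>_. 1) x = 0"
proof -
  have "L1_loc (\<lambda>_ :: real ^ 'd. 1)" by (intro L1_loc_continuous continuous_intros)
  from has_grad_partial[OF conv_has_grad[OF \<theta> this r], of i]
  have "partial i (conv \<theta> r (\<lambda>_. 1)) = (\<lambda>x. (1 / r) * conv (partial i \<theta>) r (\<lambda>_. 1) x)" .
  moreover have "conv \<theta> r (\<lambda>_. 1) = (\<lambda>x. r ^ CARD('d) * (LINT z|lborel. \<theta> z))"
    using conv_one[OF \<theta> r] by (rule ext)
  then have "partial i (conv \<theta> r (\<lambda>_. 1)) = (\<lambda>x. 0)"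
    using has_grad_partial[OF has_grad_const] by simp
  ultimately show ?thesis using r by (simp add: fun_eq_iff)
qed

lemma kernel_scaled_test_function:
  assumes \<theta>: "ball_kernel \<theta>" and r: "0 < r"
  shows "test_function (\<lambda>y. \<theta> ((1 / r) *\<^sub>R (x - y)))"
    and "partial i (\<lambda>y. \<theta> ((1 / r) *\<^sub>R (x - y))) = (\<lambda>y. - (1 / r) * partial i \<theta> ((1 / r) *\<^sub>R (x - y)))"
proof -
  have eq: "(\<lambda>y. f ((1 / r) *\<^sub>R (x - y))) = (\<lambda>y. f ((- (1 / r)) *\<^sub>R y + (1 / r) *\<^sub>R x))" for f :: "real ^ 'a \<Rightarrow> real"
    by (simp add: algebra_simps)
  have s: "smooth (\<lambda>y. \<theta> ((1 / r) *\<^sub>R (x - y)))"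
    unfolding eq by (rule smooth_affine[OF kernel_smooth[OF \<theta>]])
  have sub: "{y. \<theta> ((1 / r) *\<^sub>R (x - y)) \<noteq> 0} \<subseteq> cball x r"
    using kernel_scaled_eq_0[OF \<theta> r] by blast
  have "compact (closure {y. \<theta> ((1 / r) *\<^sub>R (x - y)) \<noteq> 0})"
    using bounded_subset[OF bounded_cball sub] by (simp add: compact_closure)
  then show "test_function (\<lambda>y. \<theta> ((1 / r) *\<^sub>R (x - y)))"
    using smooth_Ck[OF s] by (simp add: test_function_def)
  have "partial i (\<lambda>y. \<theta> ((- (1 / r)) *\<^sub>R y + (1 / r) *\<^sub>R x)) = (\<lambda>y. - (1 / r) * partial i \<theta> ((- (1 / r)) *\<^sub>R y + (1 / r) *\<^sub>R x))"
    by (rule partial_affine[OF kernel_smooth[OF \<theta>]])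
  then show "partial i (\<lambda>y. \<theta> ((1 / r) *\<^sub>R (x - y))) = (\<lambda>y. - (1 / r) * partial i \<theta> ((1 / r) *\<^sub>R (x - y)))"
    using eq[of \<theta>] eq[of "partial i \<theta>"] by (simp add: fun_eq_iff)
qed

text \<open>The scaled kernel is itself a test function; its derivative in \<open>y\<close> carries
  \<open>- (1 / r)\<close>, which accounts for the factor \<open>r\<close>.\<close>

lemma conv_weak_partial:
  assumes fg: "weak_partial i f g" and \<theta>: "ball_kernel \<theta>" and r: "0 < r"
  shows "conv (partial i \<theta>) r f x = r * conv \<theta> r g x"
proof -
  have "(LINT y|lebesgue. f y * partial i (\<lambda>y. \<theta> ((1 / r) *\<^sub>R (x - y))) y) = - conv \<theta> r g x"
    using fg kernel_scaled_test_function(1)[OF \<theta> r] unfolding weak_partial_def conv_def by blast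
  moreover have "(LINT y|lebesgue. f y * partial i (\<lambda>y. \<theta> ((1 / r) *\<^sub>R (x - y))) y) = (LINT y|lebesgue. - (1 / r) * (f y * partial i \<theta> ((1 / r) *\<^sub>R (x - y))))"
    unfolding kernel_scaled_test_function(2)[OF \<theta> r] by (simp add: mult_ac)
  moreover have "\<dots> = - (1 / r) * conv (partial i \<theta>) r f x"
    unfolding conv_def by (rule integral_mult_right_zero)
  ultimately show ?thesis using r by (simp add: field_simps)
qed

lemma kernel_times_nth: "ball_kernel \<theta> \<Longrightarrow> ball_kernel (\<lambda>z. z $ i * \<theta> z)"
  unfolding ball_kernel_def by (auto intro: smooth_mult smooth_nth)

text \<open>Turns the convolution into an integral over a fixed box, the form in which it can be
  differentiated in the scale under the integral.\<close>

lemma conv_eq_integral_cbox: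
  assumes \<theta>: "ball_kernel \<theta>" and w: "L1_loc w" and r: "0 < r" and sub: "cball x r \<subseteq> cbox a b"
  shows "conv \<theta> r w x = integral (cbox a b) (\<lambda>y. w y * \<theta> ((1 / r) *\<^sub>R (x - y)))"
proof -
  have "conv \<theta> r w x = integral UNIV (\<lambda>y. w y * \<theta> ((1 / r) *\<^sub>R (x - y)))"
    unfolding conv_def
    using has_integral_integral_lebesgue[OF conv_integrable[OF \<theta> w r, of x]] by (simp add: integral_unique)
  also have "(\<lambda>y. w y * \<theta> ((1 / r) *\<^sub>R (x - y))) = (\<lambda>y. if y \<in> cbox a b then w y * \<theta> ((1 / r) *\<^sub>R (x - y)) else 0)"
  proof
    fix y
    show "w y * \<theta> ((1 / r) *\<^sub>R (x - y)) = (if y \<in> cbox a b then w y * \<theta> ((1 / r) *\<^sub>R (x - y)) else 0)"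
      using kernel_scaled_eq_0[OF \<theta> r, of y x] sub by (cases "y \<in> cball x r") auto
  qed
  also have "integral UNIV \<dots> = integral (cbox a b) (\<lambda>y. w y * \<theta> ((1 / r) *\<^sub>R (x - y)))"
    by (rule integral_restrict_UNIV)
  finally show ?thesis .
qed

text \<open>The scale derivative of \<open>\<theta> ((1 / r) *\<^sub>R (x - y))\<close> is
  \<open>- (1 / r)\<close> times the Euler operator \<open>z \<bullet> grad \<theta>\<close> at the
  rescaled point.\<close>

lemma conv_scale_derivative:
  fixes \<theta> :: "real ^ 'd \<Rightarrow> real"
  assumes \<theta>: "ball_kernel \<theta>" and w: "continuous_on UNIV w" and r: "0 < r"
  shows "((\<lambda>r. conv \<theta> r w x) has_real_derivative
     - (1 / r) * (\<Sum>i\<in>UNIV. conv (\<lambda>z. z $ i * partial i \<theta> z) r w x)) (at r)"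
proof -
  have L1: "L1_loc w" by (rule L1_loc_continuous[OF w])
  obtain a b where ab: "cball x (2 * r) \<subseteq> cbox a b"
    using bounded_subset_cbox_symmetric[OF bounded_cball] by metis
  \<comment> \<open>Every scale in \<open>U\<close> has its kernel supported in the box chosen for
    \<open>2 * r\<close>, so one box serves the Leibniz rule.\<close>
  define U where "U = {0<..<2 * r}"
  define f where "f s y = w y * \<theta> ((1 / s) *\<^sub>R (x - y))" for s y
  define q where "q z = (\<Sum>i\<in>UNIV. z $ i * partial i \<theta> z)" for z
  have sq: "smooth (\<lambda>z. z $ i * partial i \<theta> z)" for i
    by (intro smooth_mult smooth_nth smooth_partial kernel_smooth \<theta>)
  have cq: "continuous_on UNIV q" unfolding q_def by (intro continuous_on_sum smooth_continuous sq)
  define fx where "fx s y = w y * (- (1 / s) * q ((1 / s) *\<^sub>R (x - y)))" for s y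
  have der: "((\<lambda>s. f s y) has_real_derivative fx s y) (at s within U)" if "s \<in> U" for s y
  proof -
    have s: "0 < s" using that by (simp add: U_def)
    have "((\<lambda>s. (1 / s) *\<^sub>R (x - y)) has_derivative (\<lambda>h. (- h / s\<^sup>2) *\<^sub>R (x - y))) (at s within U)"
      using s by (auto intro!: derivative_eq_intros simp: power2_eq_square field_simps)
    from has_derivative_compose[OF this smooth_has_derivative[OF kernel_smooth[OF \<theta>]]]
    have d: "((\<lambda>s. \<theta> ((1 / s) *\<^sub>R (x - y))) has_derivative
      (\<lambda>h. \<Sum>i\<in>UNIV. ((- h / s\<^sup>2) *\<^sub>R (x - y)) $ i * partial i \<theta> ((1 / s) *\<^sub>R (x - y)))) (at s within U)" .
    have eq: "(\<lambda>h. \<Sum>i\<in>UNIV. ((- h / s\<^sup>2) *\<^sub>R (x - y)) $ i * partial i \<theta> ((1 / s) *\<^sub>R (x - y))) = (*) (- (1 / s) * q ((1 / s) *\<^sub>R (x - y)))"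
    proof
      fix h
      show "(\<Sum>i\<in>UNIV. ((- h / s\<^sup>2) *\<^sub>R (x - y)) $ i * partial i \<theta> ((1 / s) *\<^sub>R (x - y))) = (- (1 / s) * q ((1 / s) *\<^sub>R (x - y))) * h"
      unfolding q_def sum_distrib_left sum_distrib_right
      by (intro sum.cong refl) (use s in \<open>simp add: power2_eq_square field_simps\<close>)
    qed
    from d have "((\<lambda>s. \<theta> ((1 / s) *\<^sub>R (x - y))) has_real_derivative (- (1 / s) * q ((1 / s) *\<^sub>R (x - y)))) (at s within U)"
      unfolding has_field_derivative_def eq .
    then show ?thesis unfolding f_def fx_def by (rule DERIV_cmult)
  qed
  have cont: "continuous_on (U \<times> cbox a b) (\<lambda>(s, y). fx s y)"
  proof -
    have "continuous_on (U \<times> cbox a b) (\<lambda>p. q ((1 / fst p) *\<^sub>R (x - snd p)))"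
      by (rule continuous_on_compose2[OF cq]) (auto intro!: continuous_intros simp: U_def)
    moreover have "continuous_on (U \<times> cbox a b) (\<lambda>p. w (snd p))"
      by (rule continuous_on_compose2[OF w]) (auto intro!: continuous_intros)
    ultimately have "continuous_on (U \<times> cbox a b) (\<lambda>p. w (snd p) * (- (1 / fst p) * q ((1 / fst p) *\<^sub>R (x - snd p))))"
      by (intro continuous_intros) (auto simp: U_def)
    then show ?thesis by (simp add: fx_def split_beta)
  qed
  have int: "f s integrable_on cbox a b" for s
    unfolding f_def
    by (intro integrable_continuous continuous_on_mult continuous_on_subset[OF w] continuous_on_subset[OF kernel_scaled_continuous[OF \<theta>]]) auto
  have rU: "r \<in> U" using r by (simp add: U_def)
  have "((\<lambda>s. integral (cbox a b) (f s)) has_real_derivative integral (cbox a b) (fx r)) (at r within U)"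
    by (rule leibniz_rule_field_derivative[OF der int cont rU]) (auto simp: U_def)
  moreover have "at r within U = at r" using rU by (intro at_within_open) (auto simp: U_def)
  ultimately have lei: "((\<lambda>s. integral (cbox a b) (f s)) has_real_derivative integral (cbox a b) (fx r)) (at r)" by simp
  have "integral (cbox a b) (fx r) = - (1 / r) * (\<Sum>i\<in>UNIV. conv (\<lambda>z. z $ i * partial i \<theta> z) r w x)"
  proof -
    have k: "ball_kernel (\<lambda>z. z $ i * partial i \<theta> z)" for i by (intro kernel_times_nth kernel_partial \<theta>)
    have "ball_kernel q" unfolding q_def ball_kernel_def
    proof
      have "smooth (\<lambda>z. \<Sum>i\<in>I. z $ i * partial i \<theta> z)" if "finite I" for I
        using that by (induction I) (auto intro!: smooth_add smooth_const sq)
      then show "smooth (\<lambda>z. \<Sum>i\<in>UNIV. z $ i * partial i \<theta> z)" by simp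
    qed (use kernel_eq_0[OF kernel_partial[OF \<theta>]] in auto)
    have "integral (cbox a b) (fx r) = integral (cbox a b) (\<lambda>y. - (1 / r) * (w y * q ((1 / r) *\<^sub>R (x - y))))"
      by (rule arg_cong[of _ _ "integral _"]) (simp add: fx_def fun_eq_iff)
    also have "\<dots> = - (1 / r) * integral (cbox a b) (\<lambda>y. w y * q ((1 / r) *\<^sub>R (x - y)))"
      by (rule integral_mult_right)
    also have "integral (cbox a b) (\<lambda>y. w y * q ((1 / r) *\<^sub>R (x - y))) = conv q r w x"
      using ab r by (intro conv_eq_integral_cbox[symmetric] \<open>ball_kernel q\<close> L1) auto
    also have "conv q r w x = (\<Sum>i\<in>UNIV. conv (\<lambda>z. z $ i * partial i \<theta> z) r w x)"
      unfolding q_def by (rule conv_sum_kernel) (use k r L1 in auto)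
    finally show ?thesis .
  qed
  with lei have *: "((\<lambda>s. integral (cbox a b) (f s)) has_real_derivative - (1 / r) * (\<Sum>i\<in>UNIV. conv (\<lambda>z. z $ i * partial i \<theta> z) r w x)) (at r)" by simp
  show ?thesis
  proof (rule has_field_derivative_transform_within_open[OF *, of U])
    show "integral (cbox a b) (f s) = conv \<theta> s w x" if "s \<in> U" for s
      using that ab unfolding f_def by (intro conv_eq_integral_cbox[symmetric] \<theta> L1) (auto simp: U_def)
  qed (use rU in \<open>auto simp: U_def\<close>)
qed

section \<open>Fields with bounded divergence are log-Lipschitz\<close>

text \<open>The segment from \<open>y\<close> to \<open>x\<close> is cut into \<open>n\<close>
  pieces shorter than the modulus for tolerance 1, so \<open>n\<close> is a bound.\<close>

lemma uniformly_continuous_oscillation: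
  fixes G :: "'a::real_normed_vector \<Rightarrow> 'b::real_normed_vector"
  assumes "uniformly_continuous_on UNIV G"
  obtains B where "0 < B" "\<And>x y. norm (x - y) \<le> 1 \<Longrightarrow> norm (G x - G y) \<le> B"
proof -
  obtain d where d: "0 < d" "\<And>x y. dist x y < d \<Longrightarrow> dist (G x) (G y) < 1"
    using assms unfolding uniformly_continuous_on_def by (metis UNIV_I zero_less_one dist_commute)
  obtain n :: nat where n: "1 / d < real n" using reals_Archimedean2 by blast
  then have n0: "0 < real n" using d(1) by (meson divide_pos_pos less_trans zero_less_one)
  have "norm (G x - G y) \<le> real n" if xy: "norm (x - y) \<le> 1" for x y
  proof -
    define p where "p k = y + (real k / real n) *\<^sub>R (x - y)" for k
    have "norm (G (p (Suc k)) - G (p k)) \<le> 1" for k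
    proof -
      have "p (Suc k) - p k = (1 / real n) *\<^sub>R (x - y)"
        by (simp add: p_def scaleR_left_diff_distrib[symmetric] diff_divide_distrib[symmetric])
      then have "dist (p (Suc k)) (p k) = norm (x - y) / real n" using n0 by (simp add: dist_norm)
      also have "\<dots> \<le> 1 / real n" using xy n0 by (intro divide_right_mono) auto
      also have "\<dots> < d" using n n0 d(1) by (simp add: field_simps)
      finally show ?thesis using d(2) by (auto simp: dist_norm less_imp_le)
    qed
    moreover have "(\<Sum>k<n. G (p (Suc k)) - G (p k)) = G (p n) - G (p 0)"
      by (rule sum_lessThan_telescope)
    then have "G x - G y = (\<Sum>k<n. G (p (Suc k)) - G (p k))"
      using n0 by (simp add: p_def)
    ultimately show ?thesis
      using sum_norm_le[of "{..<n}" "\<lambda>k. G (p (Suc k)) - G (p k)" "\<lambda>k. 1"] by simp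
  qed
  then show ?thesis using n0 by (intro that) auto
qed

text \<open>A measurable function is an almost everywhere limit of continuous ones; truncating these
  at \<open>M\<close> gives a constant majorant on the ball, so that convergence is
  dominated.\<close>

lemma integral_approx_continuous:
  fixes L :: "'a::euclidean_space \<Rightarrow> real"
  assumes [measurable]: "L \<in> borel_measurable borel" and M: "\<And>x. \<bar>L x\<bar> \<le> M" and \<delta>: "0 < \<delta>"
  obtains g where "continuous_on UNIV g" "(\<integral>\<^sup>+x. indicator (cball a R) x * ennreal \<bar>L x - g x\<bar> \<partial>lborel) \<le> ennreal \<delta>"
proof -
  have "L \<in> borel_measurable lebesgue" by (intro measurable_completion) simp
  then have "L measurable_on UNIV" using lebesgue_measurable_imp_measurable_on[of L UNIV] by simp
  then obtain N h where N: "negligible N" "\<And>n. continuous_on UNIV (h n)" "\<And>x. x \<notin> N \<Longrightarrow> (\<lambda>n. h n x) \<longlonglongrightarrow> L x"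
    unfolding measurable_on_def by auto
  define g where "g n x = max (- M) (min M (h n x))" for n x
  have M0: "0 \<le> M" using M[of 0] by simp
  have gM: "\<bar>g n x\<bar> \<le> M" for n x using M0 by (auto simp: g_def)
  have cg: "continuous_on UNIV (g n)" for n unfolding g_def by (intro continuous_intros N)
  have [measurable]: "g n \<in> borel_measurable borel" for n by (rule borel_measurable_continuous_onI[OF cg])
  have lim: "(\<lambda>n. g n x) \<longlonglongrightarrow> L x" if "x \<notin> N" for x
  proof -
    have "(\<lambda>n. max (- M) (min M (h n x))) \<longlonglongrightarrow> max (- M) (min M (L x))"
      by (intro tendsto_intros N(3) that)
    then show ?thesis using M[of x] by (simp add: g_def abs_le_iff)
  qed
  have "AE x in lebesgue. x \<notin> N"
    using N(1) by (intro AE_not_in) (simp add: negligible_iff_null_sets)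
  then have ae: "AE x in lborel. (\<lambda>n. g n x) \<longlonglongrightarrow> L x"
    unfolding AE_completion_iff by (rule AE_mp) (auto intro!: AE_I2 lim)
  have "(\<lambda>n. \<integral>\<^sup>+x. indicator (cball a R) x * ennreal \<bar>L x - g n x\<bar> \<partial>lborel) \<longlonglongrightarrow> (\<integral>\<^sup>+x. 0 \<partial>(lborel :: 'a measure))"
  proof (rule nn_integral_dominated_convergence[where w = "\<lambda>x. ennreal (2 * M) * indicator (cball a R) x"])
    show "(\<integral>\<^sup>+x. ennreal (2 * M) * indicator (cball a R) x \<partial>lborel) < \<infinity>"
      using emeasure_lborel_cball_finite[of a R] by (simp add: nn_integral_cmult ennreal_mult_less_top)
    show "AE x in lborel. indicator (cball a R) x * ennreal \<bar>L x - g n x\<bar> \<le> ennreal (2 * M) * indicator (cball a R) x" for n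
    proof (rule AE_I2)
      fix x
      have "\<bar>L x - g n x\<bar> \<le> 2 * M" using M[of x] gM[of n x] by linarith
      then show "indicator (cball a R) x * ennreal \<bar>L x - g n x\<bar> \<le> ennreal (2 * M) * indicator (cball a R) x"
        by (auto simp: indicator_def intro: ennreal_leI)
    qed
    show "AE x in lborel. (\<lambda>n. indicator (cball a R) x * ennreal \<bar>L x - g n x\<bar>) \<longlonglongrightarrow> 0"
      using ae
    proof eventually_elim
      case (elim x)
      have "(\<lambda>n. ennreal \<bar>L x - g n x\<bar>) \<longlonglongrightarrow> ennreal \<bar>L x - L x\<bar>"
        by (intro tendsto_ennrealI tendsto_intros elim)
      then have "(\<lambda>n. ennreal \<bar>L x - g n x\<bar>) \<longlonglongrightarrow> 0" by simp
      then show ?case by (cases "x \<in> cball a R") auto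
    qed
  qed measurable
  then have "eventually (\<lambda>n. (\<integral>\<^sup>+x. indicator (cball a R) x * ennreal \<bar>L x - g n x\<bar> \<partial>lborel) < ennreal \<delta>) sequentially"
    using \<delta> by (intro order_tendstoD(2)) auto
  then obtain n where "(\<integral>\<^sup>+x. indicator (cball a R) x * ennreal \<bar>L x - g n x\<bar> \<partial>lborel) < ennreal \<delta>"
    unfolding eventually_sequentially by blast
  then show ?thesis using cg by (intro that[of "g n"]) auto
qed

section \<open>The mollifier and its companion\<close>

definition \<psi> :: "real ^ 'd \<Rightarrow> real" where
  "\<psi> = (\<lambda>x. exp_bump 0 (1 - x \<bullet> x))"

definition \<eta> :: "real ^ 'd \<Rightarrow> real" where
  "\<eta> = (\<lambda>x. 2 * exp_bump 2 (1 - x \<bullet> x))"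

lemma ball_kernel_exp_bump: "ball_kernel (\<lambda>x. exp_bump n (1 - x \<bullet> x))"
proof -
  have "exp_bump n (1 - x \<bullet> x) = 0" if "1 < norm x" for x :: "real ^ 'd"
  proof -
    have "1 < (norm x)\<^sup>2" using that by (simp add: one_less_power)
    then show ?thesis by (simp add: exp_bump_def power2_norm_eq_inner)
  qed
  then show ?thesis using smooth_bump by (auto simp: ball_kernel_def)
qed

lemma ball_kernel_\<psi>: "ball_kernel \<psi>"
  unfolding \<psi>_def by (rule ball_kernel_exp_bump)

lemma ball_kernel_\<eta>: "ball_kernel \<eta>"
  using ball_kernel_exp_bump[of 2] unfolding \<eta>_def ball_kernel_def by (auto intro: smooth_mult smooth_const)

lemma \<eta>_nonneg: "0 \<le> \<eta> x"
  by (simp add: \<eta>_def exp_bump_nonneg)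

lemma \<eta>_even: "\<eta> (- x) = \<eta> x"
  by (simp add: \<eta>_def)

lemma \<eta>_measurable [measurable]: "\<eta> \<in> borel_measurable borel"
  by (intro borel_measurable_continuous_onI smooth_continuous kernel_smooth ball_kernel_\<eta>)

lemma partial_\<psi>: "partial i \<psi> = (\<lambda>z. - 1 * (z $ i * \<eta> z))"
  unfolding \<psi>_def \<eta>_def using has_grad_partial[OF has_grad_bump[of 0], of i] by (simp add: fun_eq_iff numeral_2_eq_2)

text \<open>Summed over \<open>k\<close>, this says that minus the Laplacian of
  \<open>\<psi>\<close> is the dimension times \<open>\<eta>\<close> plus
  \<open>z \<bullet> grad \<eta>\<close>. Up to sign and powers of \<open>r\<close>, that is the
  kernel which appears when the normalised mollification is differentiated in the scale.\<close>

lemma partial_partial_\<psi>: "partial k (partial k \<psi>) = (\<lambda>z. - \<eta> z - z $ k * partial k \<eta> z)"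
proof -
  have s: "smooth (\<eta> :: real ^ 'a \<Rightarrow> real)" by (rule kernel_smooth[OF ball_kernel_\<eta>])
  have s': "smooth (\<lambda>z :: real ^ 'a. z $ k * \<eta> z)" by (intro smooth_mult smooth_nth s)
  show ?thesis
    unfolding partial_\<psi> partial_cmult[OF s'] partial_mult[OF smooth_nth s] has_grad_partial[OF has_grad_nth]
    by (simp add: fun_eq_iff)
qed

definition mass :: "'d::finite itself \<Rightarrow> real" where
  "mass _ = (LINT z|lborel. \<eta> (z :: real ^ 'd))"

lemma mass_pos: "0 < mass TYPE('d::finite)"
proof -
  \<comment> \<open>For \<open>norm z \<le> 1 / 2\<close> one has
    \<open>1 - z \<bullet> z \<ge> 3 / 4\<close>, hence the exponent \<open>4 / 3\<close>.\<close>
  define m where "m = 2 * exp (- (4 / 3) :: real)"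
  have int: "integrable lborel (\<eta> :: real ^ 'd \<Rightarrow> real)"
  proof -
    have "L1_loc (\<lambda>_ :: real ^ 'd. 1)" by (intro L1_loc_continuous continuous_intros)
    from conv_integrable[OF ball_kernel_\<eta> this, of 1 0] have "integrable lebesgue (\<eta> :: real ^ 'd \<Rightarrow> real)"
      by (simp add: \<eta>_even)
    then show ?thesis by (subst (asm) integrable_completion) auto
  qed
  have low: "m * indicator (cball 0 (1 / 2)) z \<le> \<eta> z" for z :: "real ^ 'd"
  proof (cases "norm z \<le> 1 / 2")
    case True
    have "(norm z)\<^sup>2 \<le> (1 / 2)\<^sup>2" using True by (intro power_mono) auto
    then have "z \<bullet> z \<le> (1 / 2)\<^sup>2" unfolding power2_norm_eq_inner .
    then have s: "3 / 4 \<le> 1 - z \<bullet> z" by (simp add: power_divide)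
    have s1: "1 - z \<bullet> z \<le> 1" by simp
    have "1 / (1 - z \<bullet> z) \<le> 4 / 3" using s by (simp add: field_simps)
    then have e: "exp (- (4 / 3)) \<le> exp (- (1 / (1 - z \<bullet> z)))" by simp
    have "1 \<le> 1 / (1 - z \<bullet> z)" using s s1 by (simp add: field_simps)
    then have "1 \<le> (1 / (1 - z \<bullet> z))\<^sup>2" by (rule one_le_power)
    from mult_mono[OF this e] have "exp (- (4 / 3)) \<le> exp_bump 2 (1 - z \<bullet> z)"
      using s by (simp add: exp_bump_def)
    then show ?thesis using True by (simp add: m_def \<eta>_def)
  qed (simp add: \<eta>_nonneg)
  have "0 < m * measure lborel (cball (0 :: real ^ 'd) (1 / 2))"
    by (simp add: m_def content_cball_pos)
  also have "\<dots> = (LINT z|lborel. m * indicator (cball (0 :: real ^ 'd) (1 / 2)) z)" by simp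
  also have "\<dots> \<le> (LINT z|lborel. \<eta> (z :: real ^ 'd))"
    using low int emeasure_lborel_cball_finite[of "0 :: real ^ 'd" "1 / 2"] by (intro integral_mono) (auto intro!: integrable_real_indicator)
  finally show ?thesis by (simp add: mass_def)
qed

text \<open>The Laplacian enters in convolved form: the pure second derivatives are merely locally
  integrable, and it is their sum that has a bounded representative \<open>L\<close>. Here
  \<open>L\<close> is Borel and bounded by \<open>M\<close> at every point.\<close>

locale bounded_laplacian =
  fixes u :: "real ^ 'd \<Rightarrow> real" and G :: "real ^ 'd \<Rightarrow> real ^ 'd" and L :: "real ^ 'd \<Rightarrow> real" and M :: real
  assumes grad: "\<And>i. weak_partial i u (\<lambda>x. G x $ i)"
    and G_uniformly_continuous: "uniformly_continuous_on UNIV G"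
    and laplacian: "\<And>\<theta> r x. ball_kernel \<theta> \<Longrightarrow> 0 < r \<Longrightarrow>
      (\<Sum>k\<in>UNIV. conv (partial k \<theta>) r (\<lambda>y. G y $ k) x) = r * conv \<theta> r L x"
    and L_measurable [measurable]: "L \<in> borel_measurable borel"
    and L_bound: "\<And>x. \<bar>L x\<bar> \<le> M"
begin

lemma G_continuous: "continuous_on UNIV (\<lambda>x. G x $ i)"
  using uniformly_continuous_imp_continuous[OF G_uniformly_continuous] by (intro continuous_intros)

lemma G_L1: "L1_loc (\<lambda>x. G x $ i)"
  by (rule L1_loc_continuous[OF G_continuous])

lemma u_L1: "L1_loc u"
  using grad by (auto simp: weak_partial_def)

lemma L_L1: "L1_loc L"
  by (rule L1_loc_bounded[OF L_measurable L_bound])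

lemma M_nonneg: "0 \<le> M"
  using L_bound[of 0] by simp

text \<open>This is where \<open>G\<close> being a gradient is used: up to a factor
  \<open>r\<close>, both sides are the convolution of \<open>u\<close> with the mixed second
  derivative of the kernel.\<close>

lemma curl_free:
  assumes \<theta>: "ball_kernel \<theta>" and r: "0 < r"
  shows "conv (partial k \<theta>) r (\<lambda>y. G y $ i) x = conv (partial i \<theta>) r (\<lambda>y. G y $ k) x"
proof -
  have "r * conv (partial k \<theta>) r (\<lambda>y. G y $ i) x = conv (partial i (partial k \<theta>)) r u x"
    by (rule conv_weak_partial[OF grad kernel_partial[OF \<theta>] r, symmetric])
  also have "partial i (partial k \<theta>) = partial k (partial i \<theta>)"
    by (rule partial_commute[OF kernel_smooth[OF \<theta>]])
  also have "conv (partial k (partial i \<theta>)) r u x = r * conv (partial i \<theta>) r (\<lambda>y. G y $ k) x"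
    by (rule conv_weak_partial[OF grad kernel_partial[OF \<theta>] r])
  finally show ?thesis using r by simp
qed

section \<open>Dependence of the mollified field on the scale\<close>

definition a :: "real \<Rightarrow> real ^ 'd \<Rightarrow> 'd \<Rightarrow> real" where
  "a r x i = conv \<eta> r (\<lambda>y. G y $ i) x / r ^ CARD('d)"

definition b :: "real \<Rightarrow> real ^ 'd \<Rightarrow> 'd \<Rightarrow> real" where
  "b r x i = conv (partial i \<psi>) r L x / r ^ CARD('d)"

text \<open>This identity is the reason for the choice of the mollifier: the profile of \<open>\<eta>\<close> is minus
  twice the derivative of the profile of \<open>\<psi>\<close>, so the derivative of the mollification in the
  scale is a Laplacian, which falls on \<open>u\<close>.\<close>

lemma a_scale_derivative:
  assumes r: "0 < r"
  shows "((\<lambda>r. a r x i) has_real_derivative b r x i) (at r)"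
proof -
  define d where "d = CARD('d)"
  have d0: "0 < d" by (simp add: d_def)
  define S where "S = (\<Sum>k\<in>UNIV. conv (\<lambda>z. z $ k * partial k \<eta> z) r (\<lambda>y. G y $ i) x)"
  define c where "c = conv \<eta> r (\<lambda>y. G y $ i) x"
  have "((\<lambda>r. conv \<eta> r (\<lambda>y. G y $ i) x) has_real_derivative - (1 / r) * S) (at r)"
    unfolding S_def by (rule conv_scale_derivative[OF ball_kernel_\<eta> G_continuous r])
  moreover have "((\<lambda>r. r ^ d) has_real_derivative real d * r ^ (d - 1)) (at r)"
    by (auto intro!: derivative_eq_intros)
  ultimately have D: "((\<lambda>r. a r x i) has_real_derivative ((- (1 / r) * S) * r ^ d - c * (real d * r ^ (d - 1))) / (r ^ d * r ^ d)) (at r)"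
    unfolding a_def d_def[symmetric] c_def using r by (intro DERIV_divide) auto
  have kz: "ball_kernel (\<lambda>z. z $ k * partial k \<eta> z)" for k :: 'd
    by (intro kernel_times_nth kernel_partial ball_kernel_\<eta>)
  have kk: "conv (partial k (partial k \<psi>)) r (\<lambda>y. G y $ i) x = - c - conv (\<lambda>z. z $ k * partial k \<eta> z) r (\<lambda>y. G y $ i) x" for k
  proof -
    have "conv (partial k (partial k \<psi>)) r (\<lambda>y. G y $ i) x =
      (LINT y|lebesgue. - (G y $ i * \<eta> ((1 / r) *\<^sub>R (x - y))) - G y $ i * (\<lambda>z. z $ k * partial k \<eta> z) ((1 / r) *\<^sub>R (x - y)))"
      unfolding conv_def partial_partial_\<psi> by (simp add: right_diff_distrib)
    also have "\<dots> = (LINT y|lebesgue. - (G y $ i * \<eta> ((1 / r) *\<^sub>R (x - y)))) - conv (\<lambda>z. z $ k * partial k \<eta> z) r (\<lambda>y. G y $ i) x"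
      unfolding conv_def
      by (rule Bochner_Integration.integral_diff[OF Bochner_Integration.integrable_minus[OF conv_integrable[OF ball_kernel_\<eta> G_L1 r]] conv_integrable[OF kz G_L1 r]])
    finally show ?thesis by (simp add: c_def conv_def)
  qed
  have "(\<Sum>k\<in>UNIV. conv (partial k (partial k \<psi>)) r (\<lambda>y. G y $ i) x) = - real d * c - S"
    unfolding kk S_def by (simp add: sum_subtractf d_def)
  \<comment> \<open>Vanishing curl trades the pair of \<open>partial k (partial k \<psi>)\<close>
    and the \<open>i\<close>-th component of \<open>G\<close> for the pair of
    \<open>partial k (partial i \<psi>)\<close> and the \<open>k\<close>-th component; the sum over
    \<open>k\<close> is then the divergence tested with the kernel
    \<open>partial i \<psi>\<close>.\<close>
  moreover have "(\<Sum>k\<in>UNIV. conv (partial k (partial k \<psi>)) r (\<lambda>y. G y $ i) x) = (\<Sum>k\<in>UNIV. conv (partial k (partial i \<psi>)) r (\<lambda>y. G y $ k) x)"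
  proof (intro sum.cong refl)
    fix k
    show "conv (partial k (partial k \<psi>)) r (\<lambda>y. G y $ i) x = conv (partial k (partial i \<psi>)) r (\<lambda>y. G y $ k) x"
      using curl_free[where \<theta> = "partial k \<psi>" and k = k and i = i and x = x, OF kernel_partial[OF ball_kernel_\<psi>] r]
        partial_commute[OF kernel_smooth[OF ball_kernel_\<psi>], of i k] by simp
  qed
  moreover have "\<dots> = r * conv (partial i \<psi>) r L x"
    by (rule laplacian[OF kernel_partial[OF ball_kernel_\<psi>] r])
  ultimately have "- real d * c - S = r * conv (partial i \<psi>) r L x" by simp
  moreover have "((- (1 / r) * S) * r ^ d - c * (real d * r ^ (d - 1))) / (r ^ d * r ^ d) = (- real d * c - S) / (r * r ^ d)"
  proof -
    obtain e where "d = Suc e" using d0 by (cases d) auto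
    then show ?thesis using r by (simp add: field_simps)
  qed
  ultimately have "((- (1 / r) * S) * r ^ d - c * (real d * r ^ (d - 1))) / (r ^ d * r ^ d) = b r x i"
    using r by (simp add: b_def d_def)
  with D show ?thesis by simp
qed

text \<open>Both bounds are integrated over the scale: the constant \<open>K\<close> is integrable
  down to 0 and gives the rate \<open>K * r\<close> of convergence to \<open>G\<close>, while
  \<open>K * norm (x - x') / r\<close> integrates to the logarithm.\<close>

lemma b_bounds:
  obtains K where "0 < K" "\<And>r x i. 0 < r \<Longrightarrow> \<bar>b r x i\<bar> \<le> K"
    "\<And>r x x' i. 0 < r \<Longrightarrow> \<bar>b r x i - b r x' i\<bar> \<le> K * norm (x - x') / r"
proof -
  have k: "ball_kernel (partial i \<psi>)" for i :: 'd by (intro kernel_partial ball_kernel_\<psi>)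
  have "\<exists>B. 0 < B \<and> (\<forall>z. \<bar>partial i \<psi> z\<bar> \<le> B)" for i :: 'd
    using kernel_bounded[OF k] by metis
  then obtain B where B: "\<And>i. 0 < B i" "\<And>i z. \<bar>partial i \<psi> z\<bar> \<le> B (i :: 'd)" by metis
  have "\<exists>K. 0 < K \<and> (\<forall>z z'. \<bar>partial i \<psi> z - partial i \<psi> z'\<bar> \<le> K * norm (z - z'))" for i :: 'd
    using kernel_lipschitz[OF k] by metis
  then obtain K where K: "\<And>i. 0 < K i" "\<And>i z z'. \<bar>partial i \<psi> z - partial i \<psi> z'\<bar> \<le> K (i :: 'd) * norm (z - z')" by metis
  define V where "V = unit_ball_vol (real CARD('d))"
  have V: "0 \<le> V" by (simp add: V_def)
  \<comment> \<open>The summand 1 keeps \<open>Q\<close> positive when \<open>M = 0\<close>.\<close>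
  define Q where "Q = (\<Sum>i\<in>UNIV. 2 * (M * B i) * V + 2 * (M * K i) * V) + 1"
  have Qi: "2 * (M * B i) * V \<le> Q" "2 * (M * K i) * V \<le> Q" for i
  proof -
    have n: "0 \<le> 2 * (M * B i) * V" "0 \<le> 2 * (M * K i) * V" for i
      using M_nonneg B(1)[of i] K(1)[of i] V by auto
    have "2 * (M * B i) * V + 2 * (M * K i) * V \<le> Q"
      unfolding Q_def using n by (intro add_increasing2 member_le_sum) auto
    then show "2 * (M * B i) * V \<le> Q" "2 * (M * K i) * V \<le> Q" using n[of i] by linarith+
  qed
  have Q: "0 < Q"
    unfolding Q_def using M_nonneg B(1) K(1) V by (intro add_nonneg_pos sum_nonneg add_nonneg_nonneg mult_nonneg_nonneg) (auto simp: less_imp_le)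
  show ?thesis
  proof (rule that[OF Q])
    fix r :: real and x x' i assume r: "0 < r"
    have "\<bar>conv (partial i \<psi>) r L x\<bar> \<le> 2 * (M * B i) * (V * r ^ CARD('d))"
      unfolding V_def by (rule conv_abs_le[OF k L_L1 r B(2) L_bound])
    also have "\<dots> \<le> Q * r ^ CARD('d)" using mult_right_mono[OF Qi(1)[of i], of "r ^ CARD('d)"] r by (simp add: mult.assoc)
    finally show "\<bar>b r x i\<bar> \<le> Q" using r by (simp add: b_def field_simps)
    have "\<bar>conv (partial i \<psi>) r L x - conv (partial i \<psi>) r L x'\<bar> \<le> 2 * (M * (K i * (norm (x - x') / r))) * (V * r ^ CARD('d))"
      unfolding V_def by (rule conv_lipschitz[OF k L_L1 r K(2) L_bound])
    also have "\<dots> = (2 * (M * K i) * V) * (norm (x - x') / r * r ^ CARD('d))" by simp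
    also have "\<dots> \<le> Q * (norm (x - x') / r * r ^ CARD('d))" using Qi(2)[of i] r by (intro mult_right_mono) auto
    finally have "\<bar>conv (partial i \<psi>) r L x - conv (partial i \<psi>) r L x'\<bar> / r ^ CARD('d) \<le> Q * norm (x - x') / r"
      using r by (simp add: field_simps)
    then show "\<bar>b r x i - b r x' i\<bar> \<le> Q * norm (x - x') / r"
      using r by (simp add: b_def diff_divide_distrib[symmetric])
  qed
qed

lemma a_tendsto:
  assumes \<epsilon>: "0 < \<epsilon>"
  shows "\<exists>s0>0. \<forall>s x i. 0 < s \<longrightarrow> s \<le> s0 \<longrightarrow> \<bar>a s x i - mass TYPE('d) * G x $ i\<bar> \<le> \<epsilon>"
proof -
  obtain B where B: "0 < B" "\<And>z. \<bar>\<eta> (z :: real ^ 'd)\<bar> \<le> B" using kernel_bounded[OF ball_kernel_\<eta>] by metis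
  define V where "V = unit_ball_vol (real CARD('d))"
  have V: "0 < V" by (simp add: V_def)
  define \<omega> where "\<omega> = \<epsilon> / (2 * B * V)"
  have \<omega>: "0 < \<omega>" using \<epsilon> B V by (simp add: \<omega>_def)
  obtain d where d: "0 < d" "\<And>x y. dist x y < d \<Longrightarrow> dist (G x) (G y) < \<omega>"
    using G_uniformly_continuous \<omega> unfolding uniformly_continuous_on_def by (metis UNIV_I dist_commute)
  have "\<bar>a s x i - mass TYPE('d) * G x $ i\<bar> \<le> \<epsilon>" if s: "0 < s" "s \<le> d / 2" for s x i
  proof -
    have c1: "L1_loc (\<lambda>_ :: real ^ 'd. G x $ i)" by (intro L1_loc_continuous continuous_intros)
    have "conv \<eta> s (\<lambda>y. G y $ i - G x $ i) x = conv \<eta> s (\<lambda>y. G y $ i) x - conv \<eta> s (\<lambda>y. G x $ i * 1) x"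
      using conv_diff[OF ball_kernel_\<eta> s(1) G_L1 c1] by simp
    also have "conv \<eta> s (\<lambda>y. G x $ i * 1) x = G x $ i * (s ^ CARD('d) * mass TYPE('d))"
      unfolding conv_cmult conv_one[OF ball_kernel_\<eta> s(1)] mass_def ..
    finally have eq: "a s x i - mass TYPE('d) * G x $ i = conv \<eta> s (\<lambda>y. G y $ i - G x $ i) x / s ^ CARD('d)"
      using s by (simp add: a_def field_simps)
    have "\<bar>conv \<eta> s (\<lambda>y. G y $ i - G x $ i) x\<bar> \<le> 2 * (\<omega> * B) * (V * s ^ CARD('d))"
      unfolding V_def
    proof (rule conv_abs_le[OF ball_kernel_\<eta> _ s(1) B(2)])
      show "L1_loc (\<lambda>y. G y $ i - G x $ i)" by (intro L1_loc_continuous continuous_on_diff G_continuous continuous_on_const)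
      fix y assume "y \<in> cball x s"
      then have "dist y x < d" using s d(1) by (simp add: dist_commute)
      then have "norm (G y - G x) < \<omega>" using d(2) by (simp add: dist_norm)
      then show "\<bar>G y $ i - G x $ i\<bar> \<le> \<omega>" using component_le_norm_cart[of "G y - G x" i] by simp
    qed
    also have "\<dots> = \<epsilon> * s ^ CARD('d)" using B V by (simp add: \<omega>_def)
    finally show ?thesis unfolding eq using s by (simp add: field_simps)
  qed
  then show ?thesis using d(1) by (intro exI[of _ "d / 2"]) auto
qed

text \<open>Uniform continuity identifies the limit at scale 0 but gives no rate; the rate comes
  from the bounded scale derivative between a tiny scale \<open>s\<close> and
  \<open>r\<close>.\<close>

lemma a_close:
  assumes K: "\<And>r x i. 0 < r \<Longrightarrow> \<bar>b r x i\<bar> \<le> K" and r: "0 < r"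
  shows "\<bar>a r x i - mass TYPE('d) * G x $ i\<bar> \<le> K * r"
proof (rule field_le_epsilon)
  fix \<epsilon> :: real assume "0 < \<epsilon>"
  then obtain s0 where s0: "0 < s0" "\<And>s x i. 0 < s \<Longrightarrow> s \<le> s0 \<Longrightarrow> \<bar>a s x i - mass TYPE('d) * G x $ i\<bar> \<le> \<epsilon>"
    using a_tendsto by metis
  define s where "s = min s0 (r / 2)"
  have s: "0 < s" "s < r" "s \<le> s0" using s0 r by (auto simp: s_def)
  obtain z where z: "s < z" "z < r" "a r x i - a s x i = (r - s) * b z x i"
    using MVT2[of s r "\<lambda>r. a r x i" "\<lambda>r. b r x i"] a_scale_derivative s by auto
  have "\<bar>a r x i - a s x i\<bar> = (r - s) * \<bar>b z x i\<bar>" using z s by (simp add: abs_mult)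
  also have "\<dots> \<le> r * K" using K[of z x i] z s by (intro mult_mono) auto
  finally show "\<bar>a r x i - mass TYPE('d) * G x $ i\<bar> \<le> K * r + \<epsilon>"
    using s0(2)[OF s(1,3), of x i] by (simp add: mult.commute)
qed

text \<open>From scale 1 down to \<open>s\<close> the difference at two points changes by at most
  the integral of \<open>K * norm (x - x') / r\<close>. In the proof this is the monotonicity in
  \<open>r\<close> of the difference plus \<open>K * D * ln r\<close>.\<close>

lemma a_log_lipschitz:
  assumes K: "\<And>r x x' i. 0 < r \<Longrightarrow> \<bar>b r x i - b r x' i\<bar> \<le> K * norm (x - x') / r"
    and K1: "\<And>x x' i. \<bar>a 1 x i - a 1 x' i\<bar> \<le> K' * norm (x - x')" and s: "0 < s" "s \<le> 1"
  shows "\<bar>a s x i - a s x' i\<bar> \<le> (K' + K * ln (1 / s)) * norm (x - x')"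
proof -
  have half: "a s x i - a s x' i \<le> (K' + K * ln (1 / s)) * norm (x - x')" for x x'
  proof -
    define D where "D = norm (x - x')"
    have "a s x i - a s x' i + K * D * ln s \<le> a 1 x i - a 1 x' i + K * D * ln 1"
    proof (rule DERIV_nonneg_imp_nondecreasing[OF s(2)])
      fix r assume r: "s \<le> r" "r \<le> 1"
      then have r0: "0 < r" using s by simp
      have "((\<lambda>r. a r x i - a r x' i + K * D * ln r) has_real_derivative (b r x i - b r x' i + K * D * (1 / r))) (at r)"
        using r0 by (intro DERIV_add DERIV_diff a_scale_derivative DERIV_cmult) (auto intro!: derivative_eq_intros)
      moreover have "0 \<le> b r x i - b r x' i + K * D * (1 / r)"
        using K[OF r0, of x i x'] by (simp add: D_def abs_le_iff)
      ultimately show "\<exists>y. ((\<lambda>r. a r x i - a r x' i + K * D * ln r) has_real_derivative y) (at r) \<and> 0 \<le> y" by blast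
    qed
    then show ?thesis using K1[of x i x'] s by (simp add: D_def ln_div abs_le_iff algebra_simps)
  qed
  show ?thesis using half[of x x'] half[of x' x] by (simp add: abs_le_iff norm_minus_commute)
qed

section \<open>The mollified field, its Jacobian entries \<open>m\<close>, and the log-Lipschitz
  bound\<close>

definition m :: "real \<Rightarrow> 'd \<Rightarrow> 'd \<Rightarrow> real ^ 'd \<Rightarrow> real" where
  "m r i j x = conv (partial j \<eta>) r (\<lambda>y. G y $ i) x / (r * (r ^ CARD('d) * mass TYPE('d)))"

lemma a_has_grad:
  assumes "0 < r"
  shows "has_grad (\<lambda>x. a r x i / mass TYPE('d)) (\<lambda>j. m r i j)"
proof -
  have "has_grad (\<lambda>x. (1 / (r ^ CARD('d) * mass TYPE('d))) * conv \<eta> r (\<lambda>y. G y $ i) x)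
     (\<lambda>j x. 0 * conv \<eta> r (\<lambda>y. G y $ i) x + (1 / (r ^ CARD('d) * mass TYPE('d))) * ((1 / r) * conv (partial j \<eta>) r (\<lambda>y. G y $ i) x))"
    by (rule has_grad_mult[OF has_grad_const conv_has_grad[OF ball_kernel_\<eta> G_L1 assms]])
  then show ?thesis by (simp add: a_def m_def[abs_def] mult_ac)
qed

text \<open>\<open>G\<close> may be unbounded, but its oscillation on balls of radius
  \<open>r \<le> 1\<close> is bounded, and since the differentiated kernels have mean zero the value
  \<open>G x\<close> can be subtracted.\<close>

lemma m_bounded:
  assumes r: "0 < r" "r \<le> 1"
  obtains K where "\<And>i j x. \<bar>m r i j x\<bar> \<le> K"
proof -
  obtain W where W: "0 < W" "\<And>x y. norm (x - y) \<le> 1 \<Longrightarrow> norm (G x - G y) \<le> W"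
    by (rule uniformly_continuous_oscillation[OF G_uniformly_continuous]) blast
  have "\<exists>B. 0 < B \<and> (\<forall>z. \<bar>partial j \<eta> z\<bar> \<le> B)" for j :: 'd
    using kernel_bounded[OF kernel_partial[OF ball_kernel_\<eta>]] by metis
  then obtain B where B: "\<And>j. 0 < B j" "\<And>j z. \<bar>partial j \<eta> z\<bar> \<le> B (j :: 'd)" by metis
  define Q where "Q = r * (r ^ CARD('d) * mass TYPE('d))"
  have Q: "0 < Q" using r mass_pos[where 'd = 'd] by (simp add: Q_def)
  define H where "H j = 2 * (W * B j) * (unit_ball_vol (real CARD('d)) * r ^ CARD('d)) / Q" for j
  have H: "0 \<le> H j" for j using W B(1)[of j] Q r by (simp add: H_def less_imp_le)
  have "\<bar>m r i j x\<bar> \<le> (\<Sum>j\<in>UNIV. H j)" for i j x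
  proof -
    have c1: "L1_loc (\<lambda>_ :: real ^ 'd. G x $ i)" by (intro L1_loc_continuous continuous_intros)
    have "conv (partial j \<eta>) r (\<lambda>y. G y $ i - G x $ i) x = conv (partial j \<eta>) r (\<lambda>y. G y $ i) x - conv (partial j \<eta>) r (\<lambda>y. G x $ i * 1) x"
      using conv_diff[OF kernel_partial[OF ball_kernel_\<eta>] r(1) G_L1 c1] by simp
    also have "conv (partial j \<eta>) r (\<lambda>y. G x $ i * 1) x = 0"
      unfolding conv_cmult conv_partial_one[OF ball_kernel_\<eta> r(1)] by simp
    finally have eq: "conv (partial j \<eta>) r (\<lambda>y. G y $ i) x = conv (partial j \<eta>) r (\<lambda>y. G y $ i - G x $ i) x" by simp
    have "\<bar>conv (partial j \<eta>) r (\<lambda>y. G y $ i - G x $ i) x\<bar> \<le> 2 * (W * B j) * (unit_ball_vol (real CARD('d)) * r ^ CARD('d))"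
    proof (rule conv_abs_le[OF kernel_partial[OF ball_kernel_\<eta>] _ r(1) B(2)])
      show "L1_loc (\<lambda>y. G y $ i - G x $ i)" by (intro L1_loc_continuous continuous_on_diff G_continuous continuous_on_const)
      fix y assume "y \<in> cball x r"
      then have "norm (y - x) \<le> 1" using r by (simp add: dist_norm norm_minus_commute)
      then show "\<bar>G y $ i - G x $ i\<bar> \<le> W" using component_le_norm_cart[of "G y - G x" i] W(2)[of y x] by simp
    qed
    then have "\<bar>m r i j x\<bar> \<le> H j"
      unfolding m_def eq H_def Q_def[symmetric] using Q by (simp add: divide_right_mono)
    also have "\<dots> \<le> (\<Sum>j\<in>UNIV. H j)" using H by (intro member_le_sum) auto
    finally show ?thesis .
  qed
  then show ?thesis by (rule that)
qed

definition field_approx :: "real \<Rightarrow> real ^ 'd \<Rightarrow> real ^ 'd" where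
  "field_approx r x = (\<chi> i. a r x i / mass TYPE('d))"

definition field_approx' :: "real \<Rightarrow> real ^ 'd \<Rightarrow> real ^ 'd \<Rightarrow> real ^ 'd" where
  "field_approx' r x h = (\<chi> i. \<Sum>j\<in>UNIV. h $ j * m r i j x)"

lemma field_approx_derivative:
  assumes "0 < r" shows "(field_approx r has_derivative field_approx' r x) (at x)"
proof -
  have "((\<lambda>x. field_approx r x $ i) has_derivative (\<lambda>h. field_approx' r x h $ i)) (at x)" for i
    using a_has_grad[OF assms, of i] by (simp add: has_grad_def field_approx_def field_approx'_def)
  then show ?thesis
    unfolding has_derivative_componentwise_within[of "field_approx r"] by (auto simp: Basis_vec_def inner_axis)
qed

lemma matrix_field_approx': "matrix (field_approx' r x) = (\<chi> i j. m r i j x)"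
proof -
  have "(\<Sum>k\<in>UNIV. (if k = j then 1 else 0) * m r i k x) = m r i j x" for i j
  proof -
    have "(\<Sum>k\<in>UNIV. (if k = j then 1 else 0) * m r i k x) = (\<Sum>k\<in>UNIV. if k = j then m r i k x else 0)"
      by (intro sum.cong) auto
    then show ?thesis by simp
  qed
  then show ?thesis by (simp add: matrix_def field_approx'_def axis_def vec_eq_iff)
qed

lemma norm_vec_le: "(\<And>i. \<bar>v $ i\<bar> \<le> c) \<Longrightarrow> norm (v :: real ^ 'd) \<le> CARD('d) * (c :: real)"
  using norm_le_l1_cart[of v] sum_mono[of UNIV "\<lambda>i. \<bar>v $ i\<bar>" "\<lambda>i. c"] by simp

lemma field_approx_lipschitz:
  assumes r: "0 < r" "r \<le> 1"
  obtains K where "\<And>x y. norm (field_approx r x - field_approx r y) \<le> K * norm (x - y)"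
    "\<And>x y i. \<bar>a r x i - a r y i\<bar> \<le> K * norm (x - y)"
proof -
  obtain K where K: "\<And>i j x. \<bar>m r i j x\<bar> \<le> K" using m_bounded[OF r] by metis
  define c where "c = mass TYPE('d)"
  have c: "0 < c" using mass_pos by (simp add: c_def)
  have comp: "\<bar>a r x i / c - a r y i / c\<bar> \<le> CARD('d) * K * norm (x - y)" for x y i
    unfolding c_def by (rule smooth_lipschitz[OF a_has_grad[OF r(1)] K])
  have K0: "0 \<le> K" using K[of undefined undefined 0] by simp
  define Q where "Q = CARD('d) * (CARD('d) * K) + c * (CARD('d) * K)"
  show ?thesis
  proof (rule that[of Q])
    fix x y
    have "norm (field_approx r x - field_approx r y) \<le> CARD('d) * (CARD('d) * K * norm (x - y))"
      using comp by (intro norm_vec_le) (simp add: field_approx_def c_def)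
    also have "\<dots> \<le> Q * norm (x - y)" using K0 c by (simp add: Q_def algebra_simps)
    finally show "norm (field_approx r x - field_approx r y) \<le> Q * norm (x - y)" .
    fix i
    have "\<bar>a r x i - a r y i\<bar> = c * \<bar>a r x i / c - a r y i / c\<bar>"
      using c by (simp add: diff_divide_distrib[symmetric])
    also have "\<dots> \<le> c * (CARD('d) * K * norm (x - y))" using comp c by (intro mult_left_mono) auto
    also have "\<dots> \<le> Q * norm (x - y)" using K0 by (simp add: Q_def algebra_simps)
    finally show "\<bar>a r x i - a r y i\<bar> \<le> Q * norm (x - y)" .
  qed
qed

lemma field_approx_close:
  obtains K where "0 < K" "\<And>r x. 0 < r \<Longrightarrow> norm (field_approx r x - G x) \<le> K * r"
proof -
  obtain K where K: "0 < K" "\<And>r x i. 0 < r \<Longrightarrow> \<bar>b r x i\<bar> \<le> K" using b_bounds by metis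
  define c where "c = mass TYPE('d)"
  have c: "0 < c" using mass_pos by (simp add: c_def)
  have "norm (field_approx r x - G x) \<le> (CARD('d) * (K / c)) * r" if r: "0 < r" for r x
  proof -
    have "\<bar>(field_approx r x - G x) $ i\<bar> \<le> K / c * r" for i
    proof -
      have "(field_approx r x - G x) $ i = (a r x i - c * G x $ i) / c"
        using c by (simp add: field_approx_def c_def[symmetric] diff_divide_distrib)
      then show ?thesis using a_close[OF K(2) r, of x i] c by (simp add: c_def[symmetric] divide_right_mono)
    qed
    then have "norm (field_approx r x - G x) \<le> CARD('d) * (K / c * r)" by (rule norm_vec_le)
    then show ?thesis by simp
  qed
  moreover have "0 < CARD('d) * (K / c)" using K(1) c by simp
  ultimately show ?thesis by (intro that)
qed

text \<open>Triangle inequality through the mollified field, at the same scale \<open>r\<close> that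
  appears in the bound: two closeness errors \<open>K * r\<close> and one difference with
  logarithmic Lipschitz constant. \<open>CARD('d)\<close> passes from coordinates to the norm, and
  \<open>c\<close> is the mass of the mollifier.\<close>

lemma log_lipschitz: obtains C where "log_lipschitz_field G C"
proof -
  obtain K where K: "0 < K" "\<And>r x i. 0 < r \<Longrightarrow> \<bar>b r x i\<bar> \<le> K"
    "\<And>r x x' i. 0 < r \<Longrightarrow> \<bar>b r x i - b r x' i\<bar> \<le> K * norm (x - x') / r" using b_bounds by metis
  obtain K' where K': "\<And>x y i. \<bar>a 1 x i - a 1 y i\<bar> \<le> K' * norm (x - y)"
    using field_approx_lipschitz[of 1] by (metis zero_less_one order_refl)
  define c where "c = mass TYPE('d)"
  have c: "0 < c" using mass_pos by (simp add: c_def)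
  define C where "C = CARD('d) * ((2 * K + \<bar>K'\<bar>) / c)"
  have "0 < C" using K(1) c by (simp add: C_def)
  moreover have "norm (G x - G y) \<le> C * (r + (1 + ln (1 / r)) * norm (x - y))" if r: "0 < r" "r \<le> 1" for r x y
  proof -
    define D where "D = norm (x - y)"
    define l where "l = ln (1 / r)"
    have l: "0 \<le> l" "0 \<le> D" using r by (auto simp: l_def D_def)
    have "\<bar>(G x - G y) $ i\<bar> \<le> (2 * K + \<bar>K'\<bar>) / c * (r + (1 + l) * D)" for i
    proof -
      have "\<bar>c * G x $ i - c * G y $ i\<bar> \<le> \<bar>a r x i - c * G x $ i\<bar> + \<bar>a r y i - c * G y $ i\<bar> + \<bar>a r x i - a r y i\<bar>"
        by linarith
      also have "\<dots> \<le> K * r + K * r + (K' + K * l) * D"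
        using a_close[OF K(2) r(1), of x i] a_close[OF K(2) r(1), of y i] a_log_lipschitz[OF K(3) K' r, of x i y]
        unfolding c_def[symmetric] D_def l_def by linarith
      also have "\<dots> \<le> (2 * K + \<bar>K'\<bar>) * (r + (1 + l) * D)"
      proof -
        have "K' * D \<le> \<bar>K'\<bar> * D" using l by (intro mult_right_mono) auto
        moreover have "0 \<le> \<bar>K'\<bar> * r + \<bar>K'\<bar> * l * D + K * l * D + 2 * K * D" using l r K(1) by (intro add_nonneg_nonneg mult_nonneg_nonneg) auto
        ultimately show ?thesis by (simp add: algebra_simps)
      qed
      finally have "c * \<bar>(G x - G y) $ i\<bar> \<le> (2 * K + \<bar>K'\<bar>) * (r + (1 + l) * D)"
        using c by (simp add: right_diff_distrib[symmetric] abs_mult)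
      then show ?thesis using c by (simp add: field_simps)
    qed
    then have "norm (G x - G y) \<le> CARD('d) * ((2 * K + \<bar>K'\<bar>) / c * (r + (1 + l) * D))" by (rule norm_vec_le)
    then show ?thesis by (simp add: C_def D_def l_def)
  qed
  ultimately have "log_lipschitz_field G C" by unfold_locales
  then show ?thesis by (rule that)
qed

section \<open>The normalised averaging kernel and convergence of the divergences\<close>

definition N :: "real \<Rightarrow> real ^ 'd \<Rightarrow> real ^ 'd \<Rightarrow> real" where
  "N r x y = \<eta> ((1 / r) *\<^sub>R (x - y)) / (r ^ CARD('d) * mass TYPE('d))"

lemma N_nonneg: "0 < r \<Longrightarrow> 0 \<le> N r x y"
  using mass_pos[where 'd = 'd] by (simp add: N_def \<eta>_nonneg)

lemma N_commute: "N r x y = N r y x"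
proof -
  have "(1 / r) *\<^sub>R (x - y) = - ((1 / r) *\<^sub>R (y - x))" by (simp add: algebra_simps)
  then show ?thesis unfolding N_def by (simp only: \<eta>_even)
qed

lemma N_eq_0: "0 < r \<Longrightarrow> y \<notin> cball x r \<Longrightarrow> N r x y = 0"
  using kernel_scaled_eq_0[OF ball_kernel_\<eta>, of r y x] by (simp add: N_def)

lemma N_measurable [measurable (raw)]:
  "f \<in> borel_measurable S \<Longrightarrow> g \<in> borel_measurable S \<Longrightarrow> (\<lambda>z. N r (f z) (g z)) \<in> borel_measurable S"
  unfolding N_def
  by (intro borel_measurable_divide borel_measurable_const measurable_compose[OF _ \<eta>_measurable]) measurable

lemma N_integrable:
  assumes "L1_loc w" "0 < r"
  shows "integrable lebesgue (\<lambda>y. w y * N r x y)"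
  using conv_integrable[OF ball_kernel_\<eta> assms, of x] unfolding N_def times_divide_eq_right
  by (rule integrable_divide)

lemma N_conv: "(LINT y|lebesgue. w y * N r x y) = conv \<eta> r w x / (r ^ CARD('d) * mass TYPE('d))"
  unfolding N_def conv_def times_divide_eq_right by (rule integral_divide_zero)

lemma N_integral: assumes "0 < r" shows "(LINT y|lebesgue. N r x y) = 1"
proof -
  have "(LINT y|lebesgue. 1 * N r x y) = 1"
    unfolding N_conv conv_one[OF ball_kernel_\<eta> assms]
    using assms mass_pos[where 'd = 'd] by (simp add: mass_def)
  then show ?thesis by simp
qed

lemma N_nn_integral: assumes "0 < r" shows "(\<integral>\<^sup>+y. ennreal (N r x y) \<partial>lborel) = 1"
proof -
  have "L1_loc (\<lambda>_ :: real ^ 'd. 1)" by (intro L1_loc_continuous continuous_intros)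
  from N_integrable[OF this assms, of x] have "integrable lborel (\<lambda>y. N r x y)"
    by (subst (asm) integrable_completion) auto
  moreover have "(LINT y|lborel. N r x y) = 1"
    using N_integral[OF assms, of x] by (simp add: integral_completion)
  ultimately show ?thesis using N_nonneg[OF assms] by (simp add: nn_integral_eq_integral)
qed

text \<open>The divergence of the mollified field is an average of \<open>L\<close>; both the
  uniform bound and the \<open>L\<^sup>1\<close> convergence of the divergences follow from
  this.\<close>

lemma trace_field_approx':
  assumes r: "0 < r"
  shows "trace (matrix (field_approx' r x)) = (LINT y|lebesgue. L y * N r x y)"
proof -
  have "trace (matrix (field_approx' r x)) = (\<Sum>i\<in>UNIV. conv (partial i \<eta>) r (\<lambda>y. G y $ i) x) / (r * (r ^ CARD('d) * mass TYPE('d)))"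
    unfolding matrix_field_approx' by (simp add: trace_def m_def sum_divide_distrib)
  also have "\<dots> = conv \<eta> r L x / (r ^ CARD('d) * mass TYPE('d))"
    unfolding laplacian[OF ball_kernel_\<eta> r] using r by simp
  finally show ?thesis by (simp add: N_conv)
qed

lemma trace_field_approx'_bound:
  assumes r: "0 < r"
  shows "\<bar>trace (matrix (field_approx' r x))\<bar> \<le> M"
proof -
  have "L1_loc (\<lambda>_ :: real ^ 'd. 1)" by (intro L1_loc_continuous continuous_intros)
  from N_integrable[OF this r, of x] have i1: "integrable lebesgue (\<lambda>y. N r x y)" by simp
  have "\<bar>LINT y|lebesgue. L y * N r x y\<bar> \<le> (LINT y|lebesgue. \<bar>L y * N r x y\<bar>)" by (rule integral_abs_bound)
  also have "\<dots> \<le> (LINT y|lebesgue. M * N r x y)"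
  proof (rule integral_mono)
    show "integrable lebesgue (\<lambda>y. \<bar>L y * N r x y\<bar>)" by (intro integrable_abs N_integrable L_L1 r)
    show "integrable lebesgue (\<lambda>y. M * N r x y)" using i1 by simp
    show "\<bar>L y * N r x y\<bar> \<le> M * N r x y" for y
      using L_bound[of y] N_nonneg[OF r, of x y] by (simp add: abs_mult mult_right_mono)
  qed
  also have "\<dots> = M" using N_integral[OF r] by simp
  finally show ?thesis by (simp add: trace_field_approx'[OF r])
qed

lemma trace_field_approx'_diff:
  assumes r: "0 < r"
  shows "ennreal \<bar>trace (matrix (field_approx' r x)) - L x\<bar> \<le> (\<integral>\<^sup>+y. ennreal \<bar>L y - L x\<bar> * ennreal (N r x y) \<partial>lborel)"
proof -
  have "L1_loc (\<lambda>_ :: real ^ 'd. 1)" by (intro L1_loc_continuous continuous_intros)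
  from N_integrable[OF this r, of x] have i1: "integrable lebesgue (\<lambda>y. N r x y)" by simp
  have i2: "integrable lebesgue (\<lambda>y. L y * N r x y)" by (intro N_integrable L_L1 r)
  have i3: "integrable lborel (\<lambda>y. (L y - L x) * N r x y)"
  proof -
    have "integrable lebesgue (\<lambda>y. L y * N r x y - L x * N r x y)" using i1 i2 by (intro Bochner_Integration.integrable_diff) auto
    then show ?thesis by (subst (asm) integrable_completion) (auto simp: left_diff_distrib)
  qed
  have "trace (matrix (field_approx' r x)) - L x = (LINT y|lebesgue. L y * N r x y - L x * N r x y)"
    using i1 i2 N_integral[OF r, of x] by (simp add: trace_field_approx'[OF r])
  also have "\<dots> = (LINT y|lborel. (L y - L x) * N r x y)"
    by (subst integral_completion) (auto simp: left_diff_distrib)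
  finally have "ennreal \<bar>trace (matrix (field_approx' r x)) - L x\<bar> = ennreal (norm (LINT y|lborel. (L y - L x) * N r x y))" by simp
  also have "\<dots> \<le> (\<integral>\<^sup>+y. norm ((L y - L x) * N r x y) \<partial>lborel)" by (rule integral_norm_bound_ennreal[OF i3])
  also have "\<dots> = (\<integral>\<^sup>+y. ennreal \<bar>L y - L x\<bar> * ennreal (N r x y) \<partial>lborel)"
    using N_nonneg[OF r] by (intro nn_integral_cong) (simp add: abs_mult ennreal_mult)
  finally show ?thesis .
qed

text \<open>\<open>L\<close> is compared with a continuous \<open>g\<close> close to it in
  \<open>L\<^sup>1\<close>: the oscillation of \<open>g\<close> is uniformly small, and what remains
  is \<open>L - g\<close> at \<open>x\<close> and averaged around \<open>x\<close>. Each term gets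
  \<open>\<epsilon> / 3\<close>.\<close>

lemma trace_field_approx'_converges:
  assumes \<epsilon>: "0 < \<epsilon>"
  shows "\<exists>r0>0. \<forall>r. 0 < r \<longrightarrow> r \<le> r0 \<longrightarrow>
    (\<integral>\<^sup>+x. indicator (cball 0 R) x * ennreal \<bar>trace (matrix (field_approx' r x)) - L x\<bar> \<partial>lborel) \<le> ennreal \<epsilon>"
proof -
  define V where "V = measure lborel (cball (0 :: real ^ 'd) R)"
  have V: "emeasure lborel (cball (0 :: real ^ 'd) R) = ennreal V"
    unfolding V_def by (intro emeasure_eq_ennreal_measure) (use emeasure_lborel_cball_finite[of "0 :: real ^ 'd" R] in auto)
  have V0: "0 \<le> V" by (simp add: V_def)
  define \<omega> where "\<omega> = \<epsilon> / (3 * (V + 1))"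
  have \<omega>: "0 < \<omega>" using \<epsilon> V0 by (simp add: \<omega>_def)
  have "0 < \<epsilon> / 3" using \<epsilon> by simp
  \<comment> \<open>Averages at scale at most 1, centred in the ball of radius \<open>R\<close>, see
    only the ball of radius \<open>R + 1\<close>.\<close>
  then obtain g where g: "continuous_on UNIV g"
      "(\<integral>\<^sup>+x. indicator (cball 0 (R + 1)) x * ennreal \<bar>L x - g x\<bar> \<partial>lborel) \<le> ennreal (\<epsilon> / 3)"
    using integral_approx_continuous[OF L_measurable L_bound] by metis
  have [measurable]: "g \<in> borel_measurable borel" by (rule borel_measurable_continuous_onI[OF g(1)])
  have "uniformly_continuous_on (cball 0 (R + 1)) g"
    by (intro compact_uniformly_continuous continuous_on_subset[OF g(1)]) auto
  then obtain d where d: "0 < d" "\<And>x y. x \<in> cball 0 (R + 1) \<Longrightarrow> y \<in> cball 0 (R + 1) \<Longrightarrow> dist y x < d \<Longrightarrow> dist (g y) (g x) < \<omega>"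
    using \<omega> unfolding uniformly_continuous_on_def by metis
  have "(\<integral>\<^sup>+x. indicator (cball 0 R) x * ennreal \<bar>trace (matrix (field_approx' r x)) - L x\<bar> \<partial>lborel) \<le> ennreal \<epsilon>"
    if r: "0 < r" "r \<le> min 1 (d / 2)" for r
  proof -
    define p where "p x = indicator (cball (0 :: real ^ 'd) (R + 1)) x * ennreal \<bar>L x - g x\<bar>" for x
    have [measurable]: "p \<in> borel_measurable borel" unfolding p_def by measurable
    have pt: "indicator (cball 0 R) x * (ennreal \<bar>L y - L x\<bar> * ennreal (N r x y)) \<le>
       p y * ennreal (N r x y) + ennreal \<omega> * indicator (cball 0 R) x * ennreal (N r x y) + p x * ennreal (N r x y)" for x y
    proof (cases "x \<in> cball 0 R \<and> y \<in> cball x r")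
      case True
      then have n: "norm x \<le> R" "dist y x \<le> r" by (auto simp: dist_commute)
      have "norm y \<le> norm x + dist y x" using norm_triangle_sub[of y x] by (simp add: dist_norm)
      then have xy: "x \<in> cball 0 (R + 1)" "y \<in> cball 0 (R + 1)" using n r by auto
      have "dist y x < d" using n r d(1) by auto
      then have "\<bar>g y - g x\<bar> < \<omega>" using d(2)[OF xy] by (simp add: dist_real_def)
      then have "\<bar>L y - L x\<bar> \<le> \<bar>L y - g y\<bar> + \<omega> + \<bar>L x - g x\<bar>" by linarith
      then have "ennreal \<bar>L y - L x\<bar> \<le> ennreal (\<bar>L y - g y\<bar> + \<omega> + \<bar>L x - g x\<bar>)" by (rule ennreal_leI)
      then have "ennreal \<bar>L y - L x\<bar> \<le> p y + ennreal \<omega> + p x" using xy \<omega> by (simp add: p_def)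
      then have "ennreal \<bar>L y - L x\<bar> * ennreal (N r x y) \<le> (p y + ennreal \<omega> + p x) * ennreal (N r x y)"
        by (rule mult_right_mono) simp
      then show ?thesis using True by (simp add: distrib_right)
    next
      case False
      then have "indicator (cball 0 R) x * (ennreal \<bar>L y - L x\<bar> * ennreal (N r x y)) = 0"
        using N_eq_0[OF r(1), of y x] by (cases "x \<in> cball 0 R") auto
      then show ?thesis by (simp only: zero_le)
    qed
    have "(\<integral>\<^sup>+x. indicator (cball 0 R) x * ennreal \<bar>trace (matrix (field_approx' r x)) - L x\<bar> \<partial>lborel)
      \<le> (\<integral>\<^sup>+x. indicator (cball 0 R) x * (\<integral>\<^sup>+y. ennreal \<bar>L y - L x\<bar> * ennreal (N r x y) \<partial>lborel) \<partial>lborel)"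
      by (intro nn_integral_mono mult_left_mono trace_field_approx'_diff r) auto
    also have "\<dots> = (\<integral>\<^sup>+x. (\<integral>\<^sup>+y. indicator (cball 0 R) x * (ennreal \<bar>L y - L x\<bar> * ennreal (N r x y)) \<partial>lborel) \<partial>lborel)"
      by (intro nn_integral_cong nn_integral_cmult[symmetric]) measurable
    also have "\<dots> \<le> (\<integral>\<^sup>+x. (\<integral>\<^sup>+y. p y * ennreal (N r x y) + ennreal \<omega> * indicator (cball 0 R) x * ennreal (N r x y) + p x * ennreal (N r x y) \<partial>lborel) \<partial>lborel)"
      by (intro nn_integral_mono pt)
    also have "\<dots> = (\<integral>\<^sup>+x. ((\<integral>\<^sup>+y. p y * ennreal (N r x y) \<partial>lborel) + ennreal \<omega> * indicator (cball 0 R) x + p x) \<partial>lborel)"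
    proof (rule nn_integral_cong)
      fix x :: "real ^ 'd"
      have "(\<integral>\<^sup>+y. p y * ennreal (N r x y) + ennreal \<omega> * indicator (cball 0 R) x * ennreal (N r x y) + p x * ennreal (N r x y) \<partial>lborel)
        = (\<integral>\<^sup>+y. p y * ennreal (N r x y) \<partial>lborel) + (\<integral>\<^sup>+y. ennreal \<omega> * indicator (cball 0 R) x * ennreal (N r x y) \<partial>lborel) + (\<integral>\<^sup>+y. p x * ennreal (N r x y) \<partial>lborel)"
        by (simp add: nn_integral_add)
      also have "(\<integral>\<^sup>+y. ennreal \<omega> * indicator (cball 0 R) x * ennreal (N r x y) \<partial>lborel) = ennreal \<omega> * indicator (cball 0 R) x"
        by (subst nn_integral_cmult) (simp_all add: N_nn_integral[OF r(1)])
      also have "(\<integral>\<^sup>+y. p x * ennreal (N r x y) \<partial>lborel) = p x"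
        by (subst nn_integral_cmult) (simp_all add: N_nn_integral[OF r(1)])
      finally show "(\<integral>\<^sup>+y. p y * ennreal (N r x y) + ennreal \<omega> * indicator (cball 0 R) x * ennreal (N r x y) + p x * ennreal (N r x y) \<partial>lborel)
        = (\<integral>\<^sup>+y. p y * ennreal (N r x y) \<partial>lborel) + ennreal \<omega> * indicator (cball 0 R) x + p x" .
    qed
    also have "\<dots> = (\<integral>\<^sup>+x. (\<integral>\<^sup>+y. p y * ennreal (N r x y) \<partial>lborel) \<partial>lborel) + ennreal \<omega> * ennreal V + (\<integral>\<^sup>+x. p x \<partial>lborel)"
      by (simp add: nn_integral_add nn_integral_cmult V)
    \<comment> \<open>Tonelli and the symmetry of \<open>N\<close> in its two points: averaging
      preserves the integral of \<open>p\<close>.\<close>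
    also have "(\<integral>\<^sup>+x. (\<integral>\<^sup>+y. p y * ennreal (N r x y) \<partial>lborel) \<partial>lborel) = (\<integral>\<^sup>+y. (\<integral>\<^sup>+x. p y * ennreal (N r x y) \<partial>lborel) \<partial>lborel)"
      by (rule lborel_pair.Fubini'[symmetric]) measurable
    also have "\<dots> = (\<integral>\<^sup>+y. p y \<partial>lborel)"
    proof (rule nn_integral_cong)
      fix y :: "real ^ 'd"
      have "(\<integral>\<^sup>+x. p y * ennreal (N r x y) \<partial>lborel) = p y * (\<integral>\<^sup>+x. ennreal (N r x y) \<partial>lborel)"
        by (rule nn_integral_cmult) measurable
      also have "(\<integral>\<^sup>+x. ennreal (N r x y) \<partial>lborel) = 1"
        unfolding N_commute[of r _ y] by (rule N_nn_integral[OF r(1)])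
      finally show "(\<integral>\<^sup>+x. p y * ennreal (N r x y) \<partial>lborel) = p y" by simp
    qed
    also have "(\<integral>\<^sup>+y. p y \<partial>lborel) + ennreal \<omega> * ennreal V + (\<integral>\<^sup>+x. p x \<partial>lborel) \<le> ennreal (\<epsilon> / 3) + ennreal (\<epsilon> / 3) + ennreal (\<epsilon> / 3)"
    proof (intro add_mono)
      have "\<omega> * V \<le> \<epsilon> / 3" using \<epsilon> V0 by (simp add: \<omega>_def field_simps)
      then show "ennreal \<omega> * ennreal V \<le> ennreal (\<epsilon> / 3)" using \<omega> V0 by (simp add: ennreal_mult[symmetric] ennreal_leI)
    qed (use g(2) in \<open>simp_all add: p_def\<close>)
    also have "\<dots> = ennreal \<epsilon>" using \<epsilon> by (simp add: ennreal_plus[symmetric] del: ennreal_plus)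
    finally show ?thesis .
  qed
  then show ?thesis using d(1) by (intro exI[of _ "min 1 (d / 2)"]) auto
qed

lemma regularized_field_exists:
  obtains C A A' where "regularized_field G C A A' L M"
proof -
  obtain C where "log_lipschitz_field G C" using log_lipschitz by blast
  then interpret log_lipschitz_field G C .
  define \<rho> where "\<rho> n = 1 / (real n + 1)" for n :: nat
  have \<rho>: "0 < \<rho> n" "\<rho> n \<le> 1" for n by (auto simp: \<rho>_def)
  have \<rho>0: "\<exists>n0. \<forall>n\<ge>n0. \<rho> n \<le> e" if "0 < e" for e
  proof -
    obtain n0 :: nat where n0: "1 / e \<le> real n0" using real_arch_simple by blast
    have "\<rho> n \<le> e" if "n \<ge> n0" for n
    proof -
      have "1 / e \<le> real n + 1" using n0 that by linarith
      then show ?thesis using \<open>0 < e\<close> by (simp add: \<rho>_def field_simps)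
    qed
    then show ?thesis by blast
  qed
  have "regularized_field G C (\<lambda>n. field_approx (\<rho> n)) (\<lambda>n. field_approx' (\<rho> n)) L M"
  proof unfold_locales
    show "\<exists>n0. \<forall>n\<ge>n0. \<forall>z. norm (field_approx (\<rho> n) z - G z) \<le> e" if e: "0 < e" for e
    proof -
      obtain K where K: "0 < K" "\<And>r x. 0 < r \<Longrightarrow> norm (field_approx r x - G x) \<le> K * r" using field_approx_close by metis
      obtain n0 where n0: "\<And>n. n \<ge> n0 \<Longrightarrow> \<rho> n \<le> e / K" using \<rho>0[of "e / K"] e K(1) by auto
      have "norm (field_approx (\<rho> n) z - G z) \<le> e" if "n \<ge> n0" for n z
      proof -
        have "K * \<rho> n \<le> K * (e / K)" using n0[OF that] K(1) by (intro mult_left_mono) auto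
        then show ?thesis using K(2)[OF \<rho>(1), of n z] K(1) by simp
      qed
      then show ?thesis by blast
    qed
    show "\<exists>K. \<forall>x y. norm (field_approx (\<rho> n) x - field_approx (\<rho> n) y) \<le> K * norm (x - y)" for n
      using field_approx_lipschitz[OF \<rho>, of n] by metis
    show "(field_approx (\<rho> n) has_derivative field_approx' (\<rho> n) x) (at x)" for n x
      by (rule field_approx_derivative[OF \<rho>(1)])
    show "continuous_on UNIV (\<lambda>x. matrix (field_approx' (\<rho> n) x))" for n
    proof -
      have "continuous_on UNIV (\<lambda>x. m (\<rho> n) i j x)" for i j
      proof -
        have "continuous_on UNIV (conv (partial j \<eta>) (\<rho> n) (\<lambda>y. G y $ i))"
          using conv_has_grad[OF kernel_partial[OF ball_kernel_\<eta>] G_L1 \<rho>(1)] unfolding has_grad_def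
          by (intro continuous_at_imp_continuous_on ballI has_derivative_continuous) auto
        then show ?thesis unfolding m_def using \<rho>(1)[of n] mass_pos[where 'd = 'd] by (intro continuous_intros) auto
      qed
      then show ?thesis unfolding matrix_field_approx' by (intro continuous_on_vec_lambda)
    qed
    show "\<exists>K. \<forall>x. norm (matrix (field_approx' (\<rho> n) x)) \<le> K" for n
    proof -
      obtain K where K: "\<And>i j x. \<bar>m (\<rho> n) i j x\<bar> \<le> K" using m_bounded[OF \<rho>] by metis
      have "norm (matrix (field_approx' (\<rho> n) x)) \<le> CARD('d) * (CARD('d) * K)" for x
      proof -
        have row: "norm (matrix (field_approx' (\<rho> n) x) $ i) \<le> CARD('d) * K" for i
          using K by (intro norm_vec_le) (simp add: matrix_field_approx')
        have "norm (matrix (field_approx' (\<rho> n) x)) \<le> (\<Sum>i\<in>UNIV. norm (matrix (field_approx' (\<rho> n) x) $ i))"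
          unfolding norm_vec_def[of "matrix (field_approx' (\<rho> n) x)"] by (rule L2_set_le_sum) simp
        also have "\<dots> \<le> (\<Sum>i\<in>(UNIV :: 'd set). CARD('d) * K)" by (intro sum_mono row)
        finally show ?thesis by simp
      qed
      then show ?thesis by blast
    qed
    show "\<bar>trace (matrix (field_approx' (\<rho> n) x))\<bar> \<le> M" for n x
      by (rule trace_field_approx'_bound[OF \<rho>(1)])
    show "(\<lambda>n. \<integral>\<^sup>+x\<in>cball 0 R. ennreal \<bar>trace (matrix (field_approx' (\<rho> n) x)) - L x\<bar> \<partial>lborel) \<longlonglongrightarrow> 0" for R
    proof (rule order_tendstoI)
      fix e :: ennreal assume e: "0 < e"
      \<comment> \<open>\<open>e\<close> may be infinite, so a finite positive bound below it is
        extracted.\<close>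
      obtain q where q: "0 < q" "q < e" using dense[OF e] by blast
      have qt: "q < top" by (rule less_le_trans[OF q(2) top_greatest])
      define e' where "e' = enn2real q"
      have e'0: "0 < e'" unfolding e'_def enn2real_positive_iff using q(1) qt by (rule conjI)
      have e'e: "ennreal e' < e" unfolding e'_def ennreal_enn2real[OF qt] by (rule q(2))
      obtain r0 where r0: "0 < r0" "\<And>r. 0 < r \<Longrightarrow> r \<le> r0 \<Longrightarrow>
        (\<integral>\<^sup>+x. indicator (cball 0 R) x * ennreal \<bar>trace (matrix (field_approx' r x)) - L x\<bar> \<partial>lborel) \<le> ennreal e'"
        using trace_field_approx'_converges[OF e'0, of R] by blast
      obtain n0 where n0: "\<And>n. n \<ge> n0 \<Longrightarrow> \<rho> n \<le> r0" using \<rho>0[OF r0(1)] by blast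
      have "(\<integral>\<^sup>+x\<in>cball 0 R. ennreal \<bar>trace (matrix (field_approx' (\<rho> n) x)) - L x\<bar> \<partial>lborel) < e" if "n \<ge> n0" for n
        using le_less_trans[OF r0(2)[OF \<rho>(1) n0[OF that]] e'e] by (simp only: mult.commute)
      then show "\<forall>\<^sub>F n in sequentially. (\<integral>\<^sup>+x\<in>cball 0 R. ennreal \<bar>trace (matrix (field_approx' (\<rho> n) x)) - L x\<bar> \<partial>lborel) < e"
        unfolding eventually_sequentially by blast
    qed simp
  qed (use L_bound in auto)
  then show ?thesis by (rule that)
qed

text \<open>\<open>u\<close> is a representative fixed only up to null sets, so the potential is
  built as the limit of the mollified \<open>u\<close>, shifted to vanish at 0; their gradients are
  the mollified fields, which converge to \<open>G\<close> uniformly.\<close>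

lemma potential_exists:
  obtains U where "\<And>x. (U has_derivative (\<lambda>h. G x \<bullet> h)) (at x)"
proof -
  define \<rho> where "\<rho> n = 1 / (real n + 1)" for n :: nat
  have \<rho>: "0 < \<rho> n" for n by (auto simp: \<rho>_def)
  define v where "v n x = conv \<eta> (\<rho> n) u x / (\<rho> n ^ CARD('d) * mass TYPE('d))" for n x
  have vder: "(v n has_derivative (\<lambda>h. field_approx (\<rho> n) x \<bullet> h)) (at x)" for n x
  proof -
    define c where "c = 1 / (\<rho> n ^ CARD('d) * mass TYPE('d))"
    have "has_grad (\<lambda>x. c * conv \<eta> (\<rho> n) u x) (\<lambda>j x. 0 * conv \<eta> (\<rho> n) u x + c * ((1 / \<rho> n) * conv (partial j \<eta>) (\<rho> n) u x))"
      by (rule has_grad_mult[OF has_grad_const conv_has_grad[OF ball_kernel_\<eta> u_L1 \<rho>]])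
    moreover have eq: "(1 / \<rho> n) * conv (partial j \<eta>) (\<rho> n) u x = conv \<eta> (\<rho> n) (\<lambda>y. G y $ j) x" for j x
      using conv_weak_partial[OF grad ball_kernel_\<eta> \<rho>, of j n x] \<rho>[of n] by simp
    ultimately have "has_grad (\<lambda>x. c * conv \<eta> (\<rho> n) u x) (\<lambda>j x. c * conv \<eta> (\<rho> n) (\<lambda>y. G y $ j) x)"
      unfolding eq mult_zero_left add_0 by simp
    then have "((\<lambda>x. c * conv \<eta> (\<rho> n) u x) has_derivative (\<lambda>h. \<Sum>j\<in>UNIV. h $ j * (c * conv \<eta> (\<rho> n) (\<lambda>y. G y $ j) x))) (at x)"
      by (simp add: has_grad_def)
    moreover have "(\<lambda>h. \<Sum>j\<in>UNIV. h $ j * (c * conv \<eta> (\<rho> n) (\<lambda>y. G y $ j) x)) = (\<lambda>h. field_approx (\<rho> n) x \<bullet> h)"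
      by (rule ext) (simp add: inner_vec_def field_approx_def a_def c_def mult.commute)
    moreover have "(\<lambda>x. c * conv \<eta> (\<rho> n) u x) = v n" by (simp add: fun_eq_iff v_def c_def)
    ultimately show ?thesis by simp
  qed
  obtain K where K: "0 < K" "\<And>r x. 0 < r \<Longrightarrow> norm (field_approx r x - G x) \<le> K * r" using field_approx_close by metis
  have "\<exists>U. \<forall>x\<in>UNIV. (\<lambda>n. v n x - v n 0) \<longlonglongrightarrow> U x \<and> (U has_derivative (\<lambda>h. G x \<bullet> h)) (at x within UNIV)"
  proof (rule has_derivative_sequence[where f' = "\<lambda>n x h. field_approx (\<rho> n) x \<bullet> h" and ?x0.0 = 0 and l = 0])
    show "((\<lambda>x. v n x - v n 0) has_derivative (\<lambda>h. field_approx (\<rho> n) x \<bullet> h)) (at x within UNIV)" for n x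
      using has_derivative_diff[OF vder[of n x] has_derivative_const[of "v n 0"]] by simp
    fix e :: real assume e: "0 < e"
    obtain n0 :: nat where n0: "K / e \<le> real n0" using real_arch_simple by blast
    have "norm (field_approx (\<rho> n) x \<bullet> h - G x \<bullet> h) \<le> e * norm h" if "n \<ge> n0" for n x h
    proof -
      have "K / e \<le> real n + 1" using n0 that by linarith
      then have "K * \<rho> n \<le> e" using e by (simp add: \<rho>_def field_simps)
      then have "norm (field_approx (\<rho> n) x - G x) \<le> e" using K(2)[OF \<rho>, of n x] by simp
      then have "norm (field_approx (\<rho> n) x - G x) * norm h \<le> e * norm h" by (rule mult_right_mono) simp
      then show ?thesis using Cauchy_Schwarz_ineq2[of "field_approx (\<rho> n) x - G x" h] by (simp add: inner_diff_left)
    qed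
    then show "\<forall>\<^sub>F n in sequentially. \<forall>x\<in>UNIV. \<forall>h. norm (field_approx (\<rho> n) x \<bullet> h - G x \<bullet> h) \<le> e * norm h"
      unfolding eventually_sequentially by blast
  qed auto
  then show ?thesis using that by auto
qed

end

section \<open>The conductivity along the flow\<close>

lemma uniform_bound_compact_support:
  fixes f :: "'a::euclidean_space \<Rightarrow> real"
  assumes "continuous_on UNIV f" "\<And>x. R < norm x \<Longrightarrow> f x = 0"
  obtains B where "0 \<le> B" "\<And>x. \<bar>f x\<bar> \<le> B"
proof -
  have "compact (f ` cball 0 R)"
    by (intro compact_continuous_image continuous_on_subset[OF assms(1)]) auto
  then have "bounded (f ` cball 0 R)" by (rule compact_imp_bounded)
  then obtain B where B: "\<And>x. x \<in> cball 0 R \<Longrightarrow> \<bar>f x\<bar> \<le> B"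
    unfolding bounded_iff by (metis imageI real_norm_def)
  have "\<bar>f x\<bar> \<le> \<bar>B\<bar>" for x
    using B[of x] assms(2)[of x] by (cases "norm x \<le> R") auto
  then show ?thesis by (intro that[of "\<bar>B\<bar>"]) auto
qed

lemma test_function_derivative:
  fixes \<phi> :: "real ^ 'd \<Rightarrow> real"
  assumes "test_function \<phi>"
  shows "(\<phi> has_derivative (\<lambda>h. grad \<phi> x \<bullet> h)) (at x)"
proof -
  have "Ck 1 \<phi>" using assms by (simp add: test_function_def)
  then have "\<phi> differentiable (at x)" by simp
  then have d: "(\<phi> has_derivative frechet_derivative \<phi> (at x)) (at x)" by (simp add: frechet_derivative_works)
  have lin: "linear (frechet_derivative \<phi> (at x))" by (rule has_derivative_linear[OF d])
  have "frechet_derivative \<phi> (at x) h = grad \<phi> x \<bullet> h" for h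
  proof -
    have "frechet_derivative \<phi> (at x) h = frechet_derivative \<phi> (at x) (\<Sum>i\<in>UNIV. (h $ i) *s axis i 1)"
      by (simp add: basis_expansion)
    also have "\<dots> = (\<Sum>i\<in>UNIV. h $ i * frechet_derivative \<phi> (at x) (axis i 1))"
      by (simp add: linear_sum[OF lin] linear_cmul[OF lin] scalar_mult_eq_scaleR)
    finally show ?thesis by (simp add: grad_def partial_def inner_vec_def mult.commute)
  qed
  then have "frechet_derivative \<phi> (at x) = (\<lambda>h. grad \<phi> x \<bullet> h)" by (rule ext)
  with d show ?thesis by simp
qed

lemma test_function_grad_continuous:
  assumes "test_function \<phi>" shows "continuous_on UNIV (grad \<phi>)"
proof -
  have "Ck (Suc 0) \<phi>" using assms unfolding test_function_def by blast
  then have "\<And>i. continuous_on UNIV (partial i \<phi>)" by simp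
  then show ?thesis unfolding grad_def by (intro continuous_on_vec_lambda) simp
qed

lemma test_function_support:
  fixes \<phi> :: "real ^ 'd \<Rightarrow> real"
  assumes "test_function \<phi>"
  obtains R where "0 < R" "\<And>x. R < norm x \<Longrightarrow> \<phi> x = 0" "\<And>x. R < norm x \<Longrightarrow> grad \<phi> x = 0"
proof -
  have "bounded (closure {x. \<phi> x \<noteq> 0})"
    using assms compact_imp_bounded by (auto simp: test_function_def)
  then have "\<exists>R>0. \<forall>x\<in>closure {x. \<phi> x \<noteq> 0}. norm x \<le> R" by (simp only: bounded_pos)
  then obtain R where R: "0 < R" "\<forall>x\<in>closure {x. \<phi> x \<noteq> 0}. norm x \<le> R" by (elim exE conjE)
  have z: "\<phi> x = 0" if "R < norm x" for x
  proof (rule ccontr)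
    assume "\<phi> x \<noteq> 0"
    then have "x \<in> closure {x. \<phi> x \<noteq> 0}" by (intro subsetD[OF closure_subset]) simp
    with R(2) have "norm x \<le> R" by (rule bspec)
    with that show False by simp
  qed
  have gz: "grad \<phi> x = 0" if x: "R < norm x" for x
  proof -
    have "(\<phi> has_derivative (\<lambda>_. 0)) (at x)"
    proof (rule has_derivative_transform_within_open[where f = "\<lambda>_. 0" and s = "- cball 0 R"])
      show "open (- cball (0 :: real ^ 'd) R)" by (intro open_Compl closed_cball)
    qed (use x z in simp_all)
    then have "(\<lambda>h. grad \<phi> x \<bullet> h) = (\<lambda>_. 0)"
      by (rule has_derivative_unique[OF test_function_derivative[OF assms]])
    then have "grad \<phi> x \<bullet> grad \<phi> x = 0" by (rule fun_cong)
    then show ?thesis by simp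
  qed
  show ?thesis by (rule that[OF R(1) z gz])
qed

section \<open>Null sets and invariant densities under the flow\<close>

context regularized_field begin

text \<open>The transport formula as an identity of measures, the form that extends it from
  nonnegative to real integrands.\<close>

lemma density_exp_Lint_distr: "distr (density lborel (\<lambda>x. ennreal (exp (Lint t x)))) borel (flow t) = lborel"
proof (rule measure_eqI)
  fix S assume "S \<in> sets (distr (density lborel (\<lambda>x. ennreal (exp (Lint t x)))) borel (flow t))"
  then have [measurable]: "S \<in> sets borel" by simp
  have [measurable]: "flow t -` S \<in> sets borel" using measurable_sets[of "flow t" borel borel S] by simp
  have "emeasure (distr (density lborel (\<lambda>x. ennreal (exp (Lint t x)))) borel (flow t)) S
    = (\<integral>\<^sup>+x. ennreal (exp (Lint t x)) * indicator (flow t -` S) x \<partial>lborel)"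
    by (subst emeasure_distr) (auto simp: emeasure_density)
  also have "\<dots> = (\<integral>\<^sup>+x. indicator S (flow t x) * ennreal (exp (Lint t x)) \<partial>lborel)"
    by (simp add: indicator_vimage mult.commute)
  also have "\<dots> = (\<integral>\<^sup>+x. indicator S x \<partial>lborel)" by (rule nn_integral_flow) measurable
  finally show "emeasure (distr (density lborel (\<lambda>x. ennreal (exp (Lint t x)))) borel (flow t)) S = emeasure lborel S" by simp
qed simp

lemma integral_flow:
  fixes h :: "real ^ 'd \<Rightarrow> real"
  assumes [measurable]: "h \<in> borel_measurable borel"
  shows "(LINT x|lborel. h (flow t x) * exp (Lint t x)) = (LINT x|lborel. h x)"
proof -
  have "(LINT x|lborel. h x) = (LINT x|distr (density lborel (\<lambda>x. ennreal (exp (Lint t x)))) borel (flow t). h x)"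
    by (simp add: density_exp_Lint_distr)
  also have "\<dots> = (LINT x|density lborel (\<lambda>x. ennreal (exp (Lint t x))). h (flow t x))"
    by (rule integral_distr) auto
  also have "\<dots> = (LINT x|lborel. exp (Lint t x) *\<^sub>R h (flow t x))"
    by (rule integral_density) auto
  finally show ?thesis by (simp add: mult.commute)
qed

text \<open>The weight \<open>exp (Lint t x)\<close> is positive everywhere, so preimages of null
  sets under the flow are null.\<close>

lemma AE_flow:
  assumes "AE x in lborel. P x"
  shows "AE x in lborel. P (flow t x)"
proof -
  obtain S where S: "\<And>x. x \<in> space lborel - S \<Longrightarrow> P x" "S \<in> null_sets lborel" by (rule AE_E3[OF assms]) blast
  then have [measurable]: "S \<in> sets borel" by auto
  have "(\<integral>\<^sup>+x. indicator S (flow t x) * ennreal (exp (Lint t x)) \<partial>lborel) = 0"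
    using nn_integral_flow[of "indicator S" t] S(2) by auto
  then have "AE x in lborel. indicator S (flow t x) * ennreal (exp (Lint t x)) = 0"
    by (subst (asm) nn_integral_0_iff_AE) auto
  then show ?thesis
    by eventually_elim (use S(1) in \<open>auto simp: indicator_def split: if_splits\<close>)
qed

text \<open>Fubini in time and point. As a result, changing a function on a null set does not affect
  its time integrals along almost every trajectory.\<close>

lemma AE_flow_time:
  assumes "AE x in lborel. P x"
  shows "AE x in lborel. AE s in lborel. P (flow s x)"
proof -
  obtain S where S: "\<And>x. x \<in> space lborel - S \<Longrightarrow> P x" "S \<in> null_sets lborel" by (rule AE_E3[OF assms]) blast
  then have [measurable]: "S \<in> sets borel" by auto
  have "AE x in lborel. x \<notin> S" by (rule AE_not_in[OF S(2)])
  then have "AE x in lborel. flow s x \<notin> S" for s by (rule AE_flow)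
  then have "AE s in lborel. AE x in lborel. flow s x \<notin> S" by simp
  moreover have "{p \<in> space (lborel \<Otimes>\<^sub>M lborel). flow (fst p) (snd p) \<notin> S} \<in> sets (lborel \<Otimes>\<^sub>M lborel)"
    by measurable
  ultimately have "AE x in lborel. AE s in lborel. flow s x \<notin> S"
    by (subst (asm) lborel_pair.AE_commute) auto
  then show ?thesis
    by eventually_elim (use S(1) in \<open>auto elim!: eventually_mono\<close>)
qed

text \<open>Pairing with \<open>\<phi> (flow t x)\<close> is constant in \<open>t\<close>; its derivative at \<open>t = 0\<close> is the weak form
  of the equation.\<close>

lemma invariant_density_solves:
  assumes [measurable]: "\<sigma> \<in> borel_measurable borel"
    and loc: "\<And>R. \<exists>S. AE x in lborel. x \<in> cball 0 R \<longrightarrow> \<bar>\<sigma> x\<bar> \<le> S"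
    and inv: "\<And>t. AE x in lborel. \<sigma> x = \<sigma> (flow t x) * exp (Lint t x)"
    and \<phi>: "test_function \<phi>"
  shows "(LINT x|lborel. \<sigma> x * (G x \<bullet> grad \<phi> x)) = 0"
proof -
  have c\<phi>: "continuous_on UNIV \<phi>"
    by (intro continuous_at_imp_continuous_on ballI has_derivative_continuous[OF test_function_derivative[OF \<phi>]])
  have cg: "continuous_on UNIV (\<lambda>x. grad \<phi> x \<bullet> G x)"
    by (intro continuous_intros test_function_grad_continuous[OF \<phi>] continuous)
  have [measurable]: "\<phi> \<in> borel_measurable borel" "(\<lambda>x. grad \<phi> x \<bullet> G x) \<in> borel_measurable borel"
    by (auto intro: borel_measurable_continuous_onI c\<phi> cg)
  obtain R where R: "0 < R" "\<And>x. R < norm x \<Longrightarrow> \<phi> x = 0" "\<And>x. R < norm x \<Longrightarrow> grad \<phi> x = 0"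
    by (rule test_function_support[OF \<phi>]) blast
  obtain B where B: "0 \<le> B" "\<And>x. \<bar>\<phi> x\<bar> \<le> B"
    by (rule uniform_bound_compact_support[OF c\<phi> R(2)]) auto
  obtain B' where B': "0 \<le> B'" "\<And>x. \<bar>grad \<phi> x \<bullet> G x\<bar> \<le> B'"
    by (rule uniform_bound_compact_support[OF cg, of R]) (use R(3) in auto)
  \<comment> \<open>Flowing for a time at most 1 from the ball that carries \<open>\<phi>\<close>
    stays within this radius, so by reversing time \<open>K\<close> contains every point whose
    trajectory meets the support within that time.\<close>
  obtain R1 where R1: "\<And>x t. x \<in> cball 0 R \<Longrightarrow> \<bar>t\<bar> \<le> 1 \<Longrightarrow> norm (flow t x) \<le> R1"
    by (rule flow_image_bounded[of R 1]) blast
  define K where "K = cball (0 :: real ^ 'd) R1"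
  have [measurable]: "K \<in> sets borel" by (simp add: K_def)
  have fin: "emeasure lborel K < \<infinity>" unfolding K_def by (rule emeasure_lborel_cball_finite)
  have out: "\<phi> (flow t x) = 0" if "x \<notin> K" "\<bar>t\<bar> \<le> 1" for t x
  proof (rule ccontr)
    assume "\<phi> (flow t x) \<noteq> 0"
    then have "flow t x \<in> cball 0 R" using R(2)[of "flow t x"] by (cases "R < norm (flow t x)") auto
    from R1[OF this, of "- t"] show False using that by (simp add: K_def)
  qed
  obtain S where S: "AE x in lborel. x \<in> K \<longrightarrow> \<bar>\<sigma> x\<bar> \<le> S" using loc[of R1] unfolding K_def by blast
  have dom: "integrable lborel (\<lambda>x. c * indicator K x :: real)" for c
    using fin by (intro integrable_mult_right integrable_real_indicator) auto
  have der: "((\<lambda>t. \<phi> (flow t x)) has_real_derivative (grad \<phi> (flow t x) \<bullet> G (flow t x))) (at t)" for t x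
  proof -
    have "((\<lambda>t. \<phi> (flow t x)) has_derivative (\<lambda>h. grad \<phi> (flow t x) \<bullet> (h *\<^sub>R G (flow t x)))) (at t)"
      using has_derivative_compose[OF flow_has_vector_derivative[of x t, unfolded has_vector_derivative_def] test_function_derivative[OF \<phi>]] .
    moreover have "(\<lambda>h. grad \<phi> (flow t x) \<bullet> (h *\<^sub>R G (flow t x))) = (*) (grad \<phi> (flow t x) \<bullet> G (flow t x))"
      by (rule ext) simp
    ultimately show ?thesis by (simp add: has_field_derivative_def)
  qed
  have int: "integrable lborel (\<lambda>x. \<sigma> x * \<phi> (flow t x))" if t: "\<bar>t\<bar> \<le> 1" for t
  proof (rule Bochner_Integration.integrable_bound[OF dom[of "S * B"]])
    show "AE x in lborel. norm (\<sigma> x * \<phi> (flow t x)) \<le> norm (S * B * indicator K x)"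
      using S
    proof eventually_elim
      case (elim x)
      show ?case
      proof (cases "x \<in> K")
        case True
        then have "\<bar>\<sigma> x\<bar> * \<bar>\<phi> (flow t x)\<bar> \<le> S * B" using elim B by (intro mult_mono) auto
        then show ?thesis using True by (simp add: abs_mult[symmetric])
      next
        case False then show ?thesis using out[OF False t] by simp
      qed
    qed
  qed measurable
  \<comment> \<open>The relation satisfied by \<open>\<sigma>\<close> supplies exactly the weight of
    the transport formula.\<close>
  have const: "(LINT x|lborel. \<sigma> x * \<phi> (flow t x)) = (LINT x|lborel. \<sigma> x * \<phi> x)" for t
  proof -
    have "(LINT x|lborel. \<sigma> x * \<phi> (flow t x)) = (LINT x|lborel. (\<sigma> (flow t x) * \<phi> (flow t x)) * exp (Lint t x))"
      using inv[of t] by (intro integral_cong_AE) (auto elim!: eventually_mono)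
    also have "\<dots> = (LINT x|lborel. \<sigma> x * \<phi> x)"
      by (rule integral_flow[of "\<lambda>x. \<sigma> x * \<phi> x"]) measurable
    finally show ?thesis .
  qed
  define \<tau> where "\<tau> n = 1 / (real n + 1)" for n :: nat
  have \<tau>: "0 < \<tau> n" "\<bar>\<tau> n\<bar> \<le> 1" for n by (auto simp: \<tau>_def)
  have \<tau>0: "\<tau> \<longlonglongrightarrow> 0"
    unfolding \<tau>_def[abs_def] using LIMSEQ_inverse_real_of_nat by (simp add: inverse_eq_divide add.commute)
  have lim: "(\<lambda>n. LINT x|lborel. \<sigma> x * ((\<phi> (flow (\<tau> n) x) - \<phi> x) / \<tau> n)) \<longlonglongrightarrow> (LINT x|lborel. \<sigma> x * (grad \<phi> x \<bullet> G x))"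
  proof (rule integral_dominated_convergence[where w = "\<lambda>x. S * B' * indicator K x"])
    show "integrable lborel (\<lambda>x. S * B' * indicator K x)" by (rule dom)
    show "AE x in lborel. (\<lambda>n. \<sigma> x * ((\<phi> (flow (\<tau> n) x) - \<phi> x) / \<tau> n)) \<longlonglongrightarrow> \<sigma> x * (grad \<phi> x \<bullet> G x)"
    proof (rule AE_I2)
      fix x
      have "((\<lambda>h. (\<phi> (flow (0 + h) x) - \<phi> (flow 0 x)) / h) \<longlongrightarrow> grad \<phi> (flow 0 x) \<bullet> G (flow 0 x)) (at 0)"
        using der[of x 0] unfolding DERIV_def .
      then have "((\<lambda>h. (\<phi> (flow h x) - \<phi> x) / h) \<longlongrightarrow> grad \<phi> x \<bullet> G x) (at 0)" by simp
      moreover have "filterlim \<tau> (at 0) sequentially"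
        unfolding filterlim_at using \<tau>0 \<tau>(1) by (auto simp: less_imp_neq[symmetric] intro!: always_eventually)
      ultimately have "(\<lambda>n. (\<phi> (flow (\<tau> n) x) - \<phi> x) / \<tau> n) \<longlonglongrightarrow> grad \<phi> x \<bullet> G x"
        by (rule filterlim_compose)
      then show "(\<lambda>n. \<sigma> x * ((\<phi> (flow (\<tau> n) x) - \<phi> x) / \<tau> n)) \<longlonglongrightarrow> \<sigma> x * (grad \<phi> x \<bullet> G x)"
        by (intro tendsto_intros)
    qed
    show "AE x in lborel. norm (\<sigma> x * ((\<phi> (flow (\<tau> n) x) - \<phi> x) / \<tau> n)) \<le> S * B' * indicator K x" for n
      using S
    proof eventually_elim
      case (elim x)
      show ?case
      proof (cases "x \<in> K")
        case True
        \<comment> \<open>The mean value theorem along the trajectory bounds all difference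
          quotients by \<open>B'\<close>, which provides the majorant for dominated
          convergence.\<close>
        obtain z where z: "\<phi> (flow (\<tau> n) x) - \<phi> (flow 0 x) = (\<tau> n - 0) * (grad \<phi> (flow z x) \<bullet> G (flow z x))"
          using MVT2[OF \<tau>(1)[of n], of "\<lambda>t. \<phi> (flow t x)" "\<lambda>t. grad \<phi> (flow t x) \<bullet> G (flow t x)"] der by blast
        then have "(\<phi> (flow (\<tau> n) x) - \<phi> x) / \<tau> n = grad \<phi> (flow z x) \<bullet> G (flow z x)" using \<tau>(1)[of n] by simp
        then have "\<bar>(\<phi> (flow (\<tau> n) x) - \<phi> x) / \<tau> n\<bar> \<le> B'" using B'(2) by simp
        then have "\<bar>\<sigma> x\<bar> * \<bar>(\<phi> (flow (\<tau> n) x) - \<phi> x) / \<tau> n\<bar> \<le> S * B'" using elim True by (intro mult_mono) auto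
        then show ?thesis using True by (simp only: real_norm_def abs_mult) simp
      next
        case False then show ?thesis using out[OF False \<tau>(2)[of n]] out[OF False, of 0] by simp
      qed
    qed
  qed measurable
  have z: "(LINT x|lborel. \<sigma> x * ((\<phi> (flow (\<tau> n) x) - \<phi> x) / \<tau> n)) = 0" for n
  proof -
    have "(LINT x|lborel. \<sigma> x * ((\<phi> (flow (\<tau> n) x) - \<phi> x) / \<tau> n)) = (LINT x|lborel. (\<sigma> x * \<phi> (flow (\<tau> n) x) - \<sigma> x * \<phi> (flow 0 x)) / \<tau> n)"
      by (simp add: right_diff_distrib)
    also have "\<dots> = ((LINT x|lborel. \<sigma> x * \<phi> (flow (\<tau> n) x)) - (LINT x|lborel. \<sigma> x * \<phi> (flow 0 x))) / \<tau> n"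
      unfolding integral_divide_zero using int[OF \<tau>(2)[of n]] int[of 0] by simp
    also have "\<dots> = 0" using const[of "\<tau> n"] by simp
    finally show ?thesis .
  qed
  have "(\<lambda>n. 0) \<longlonglongrightarrow> (LINT x|lborel. \<sigma> x * (grad \<phi> x \<bullet> G x))" using lim unfolding z .
  then have "(LINT x|lborel. \<sigma> x * (grad \<phi> x \<bullet> G x)) = 0" by (simp add: LIMSEQ_const_iff)
  then show ?thesis by (simp add: inner_commute)
qed

end

section \<open>Crossing times of the zero level and the conductivity\<close>

locale regularized_gradient_field = regularized_field G C A A' L M
  for G :: "real ^ 'd \<Rightarrow> real ^ 'd" and C A A' L M +
  fixes U :: "real ^ 'd \<Rightarrow> real" and c :: real
  assumes potential: "\<And>x. (U has_derivative (\<lambda>h. G x \<bullet> h)) (at x)"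
    and c_pos: "0 < c" and G_lower: "\<And>x. c \<le> norm (G x)"
begin

lemma U_continuous: "continuous_on S U"
  by (intro continuous_at_imp_continuous_on ballI has_derivative_continuous[OF potential])

lemma U_flow_derivative: "((\<lambda>t. U (flow t x)) has_real_derivative (norm (G (flow t x)))\<^sup>2) (at t)"
proof -
  have "((\<lambda>t. U (flow t x)) has_derivative (\<lambda>h. G (flow t x) \<bullet> (h *\<^sub>R G (flow t x)))) (at t)"
    using has_derivative_compose[OF flow_has_vector_derivative[of x t, unfolded has_vector_derivative_def] potential] .
  moreover have "(\<lambda>h. G (flow t x) \<bullet> (h *\<^sub>R G (flow t x))) = (*) ((norm (G (flow t x)))\<^sup>2)"
    by (rule ext) (simp add: power2_norm_eq_inner)
  ultimately show ?thesis by (simp add: has_field_derivative_def)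
qed

lemma U_flow_increase:
  assumes "s < t" shows "c\<^sup>2 * (t - s) \<le> U (flow t x) - U (flow s x)"
proof -
  obtain z where z: "U (flow t x) - U (flow s x) = (t - s) * (norm (G (flow z x)))\<^sup>2"
    using MVT2[OF assms, of "\<lambda>t. U (flow t x)" "\<lambda>t. (norm (G (flow t x)))\<^sup>2"] U_flow_derivative by blast
  have "c\<^sup>2 \<le> (norm (G (flow z x)))\<^sup>2" using G_lower c_pos by (intro power_mono) auto
  then have "(t - s) * c\<^sup>2 \<le> (t - s) * (norm (G (flow z x)))\<^sup>2" using assms by (intro mult_left_mono) auto
  then show ?thesis using z by (simp add: mult.commute)
qed

lemma U_flow_less: "s < t \<Longrightarrow> U (flow s x) < U (flow t x)"
  using U_flow_increase[of s t x] c_pos by (smt (verit) mult_pos_pos zero_less_power)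

lemma U_flow_zero: "\<exists>t. U (flow t x) = 0"
proof -
  define T where "T = \<bar>U x\<bar> / c\<^sup>2 + 1"
  have T: "0 < T" "\<bar>U x\<bar> \<le> c\<^sup>2 * T" using c_pos by (auto simp: T_def distrib_left add_nonneg_pos)
  have "c\<^sup>2 * T \<le> U (flow T x) - U x" using U_flow_increase[of 0 T x] T by simp
  then have "0 \<le> U (flow T x)" using T by linarith
  moreover have "c\<^sup>2 * T \<le> U x - U (flow (- T) x)" using U_flow_increase[of "- T" 0 x] T by simp
  then have "U (flow (- T) x) \<le> 0" using T by linarith
  moreover have "continuous_on {- T..T} (\<lambda>t. U (flow t x))"
    by (intro continuous_at_imp_continuous_on ballI DERIV_isCont[OF U_flow_derivative])
  ultimately show ?thesis using IVT'[of "\<lambda>t. U (flow t x)" "- T" 0 T] T by auto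
qed

definition tau :: "real ^ 'd \<Rightarrow> real" where
  "tau x = (SOME t. U (flow t x) = 0)"

lemma U_tau: "U (flow (tau x) x) = 0"
  unfolding tau_def by (rule someI_ex[OF U_flow_zero])

lemma tau_unique: "U (flow t x) = 0 \<Longrightarrow> tau x = t"
  using U_tau[of x] U_flow_less[of t "tau x" x] U_flow_less[of "tau x" t x] by (cases t "tau x" rule: linorder_cases) auto

lemma tau_flow: "tau (flow t x) = tau x - t"
  by (rule tau_unique) (simp add: flow_add[symmetric] U_tau)

lemma tau_bound: "\<bar>tau x\<bar> \<le> \<bar>U x\<bar> / c\<^sup>2"
proof -
  have "c\<^sup>2 * \<bar>tau x\<bar> \<le> \<bar>U x\<bar>"
    using U_flow_increase[of 0 "tau x" x] U_flow_increase[of "tau x" 0 x] U_tau[of x]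
    by (cases "tau x" "0 :: real" rule: linorder_cases) auto
  then show ?thesis using c_pos by (simp add: field_simps)
qed

text \<open>\<open>U\<close> increases along trajectories, so \<open>y < tau x\<close> means that
  \<open>U\<close> is still negative at time \<open>y\<close>, which is an open condition on
  \<open>x\<close>.\<close>

lemma tau_measurable [measurable]: "tau \<in> borel_measurable borel"
proof (rule borel_measurableI_greater)
  fix y
  have "y < tau x \<longleftrightarrow> U (flow y x) < 0" for x
    using U_tau[of x] U_flow_less[of y "tau x" x] U_flow_less[of "tau x" y x]
    by (cases y "tau x" rule: linorder_cases) auto
  moreover have "open {x. U (flow y x) < 0}"
    by (intro open_Collect_less continuous_on_compose2[OF U_continuous[of UNIV]] continuous_intros) auto
  ultimately show "{x \<in> space borel. y < tau x} \<in> sets borel" by simp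
qed

definition sigma :: "real ^ 'd \<Rightarrow> real" where
  "sigma x = exp (Lint (tau x) x)"

lemma sigma_pos: "0 < sigma x"
  by (simp add: sigma_def)

lemma sigma_measurable [measurable]: "sigma \<in> borel_measurable borel"
  unfolding sigma_def by measurable

text \<open>\<open>x\<close> and \<open>flow t x\<close> reach the zero level at the same point,
  \<open>t\<close> time units apart, so the cocycle identity leaves only the exponent up to time
  \<open>t\<close>.\<close>

lemma sigma_flow: "sigma x / sigma (flow t x) = exp (Lint t x)"
  using Lint_add[of "tau x - t" t x] by (simp add: sigma_def tau_flow exp_diff[symmetric])

text \<open>On a ball the potential is bounded, hence so is the crossing time, and the exponent is
  at most \<open>M\<close> times it in absolute value.\<close>

lemma sigma_bounds:
  "\<exists>S. \<forall>x\<in>cball 0 R. sigma x \<le> S \<and> inverse (sigma x) \<le> S"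
proof -
  have "compact (U ` cball 0 R)" by (intro compact_continuous_image U_continuous compact_cball)
  then have "bounded (U ` cball 0 R)" by (rule compact_imp_bounded)
  then obtain S where S: "\<And>x. x \<in> cball 0 R \<Longrightarrow> \<bar>U x\<bar> \<le> S"
    unfolding bounded_iff by (metis imageI real_norm_def)
  have "sigma x \<le> exp (M * (S / c\<^sup>2)) \<and> inverse (sigma x) \<le> exp (M * (S / c\<^sup>2))" if x: "x \<in> cball 0 R" for x
  proof -
    have "\<bar>tau x\<bar> \<le> S / c\<^sup>2"
      using tau_bound[of x] S[OF x] c_pos by (meson divide_right_mono order_trans zero_le_power2)
    then have "M * \<bar>tau x\<bar> \<le> M * (S / c\<^sup>2)" using M_nonneg by (rule mult_left_mono)
    then have "\<bar>Lint (tau x) x\<bar> \<le> M * (S / c\<^sup>2)" using Lint_bound[of "tau x" x] by linarith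
    then show ?thesis by (simp add: sigma_def exp_minus[symmetric] abs_le_iff)
  qed
  then show ?thesis by blast
qed

section \<open>The flow in the almost everywhere sense, and integrals along it\<close>

lemma flow_gradient_flow:
  assumes M: "M = real_of_ereal (Linf_norm L0)"
  shows "gradient_flow G L0 flow"
  unfolding gradient_flow_def
proof (intro conjI allI)
  have "(\<lambda>(t, x). flow t x) \<in> borel_measurable borel" by (rule borel_measurable_continuous_onI[OF flow_continuous])
  then show "(\<lambda>(t, x). flow t x) \<in> borel_measurable lebesgue" by (rule measurable_lebesgueI)
  fix t
  have [measurable]: "flow t \<in> borel_measurable borel" by measurable
  show "flow t \<in> borel_measurable lebesgue" by (rule measurable_lebesgueI) fact
  have "(\<lambda>t. flow t x) C1_differentiable_on UNIV" for x
    unfolding C1_differentiable_on_def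
    by (intro exI[of _ "\<lambda>t. G (flow t x)"] conjI ballI flow_has_vector_derivative
        continuous_on_compose2[OF continuous[of UNIV]] continuous_intros) auto
  then show "AE x in lebesgue. (\<lambda>t. flow t x) C1_differentiable_on UNIV \<and>
        (\<forall>t. ((\<lambda>t. flow t x) has_vector_derivative G (flow t x)) (at t)) \<and> flow 0 x = x"
    using flow_has_vector_derivative by (intro AE_I2) simp
  show "AE x in lebesgue. \<forall>s. flow (s + t) x = flow s (flow t x)"
    by (intro AE_I2 allI flow_add)
  \<comment> \<open>The image density is the Jacobian of the inverse map, hence the time
    \<open>- t\<close>.\<close>
  have "distr lebesgue lborel (flow t) = density lborel (\<lambda>x. ennreal (exp (Lint (- t) x)))"
  proof (rule measure_eqI)
    fix S assume "S \<in> sets (distr lebesgue lborel (flow t))"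
    then have [measurable]: "S \<in> sets borel" by simp
    have [measurable]: "flow t -` S \<in> sets borel" using measurable_sets[of "flow t" borel borel S] by simp
    have "emeasure (distr lebesgue lborel (flow t)) S = emeasure lborel (flow t -` S)"
      using measurable_lebesgueI[of "flow t"] by (subst emeasure_distr) (auto simp: measurable_lborel2)
    also have "\<dots> = (\<integral>\<^sup>+x. indicator (flow t -` S) x \<partial>lborel)" by simp
    also have "\<dots> = (\<integral>\<^sup>+x. indicator (flow t -` S) (flow (- t) x) * ennreal (exp (Lint (- t) x)) \<partial>lborel)"
      by (rule nn_integral_flow[symmetric]) measurable
    also have "\<dots> = (\<integral>\<^sup>+x. ennreal (exp (Lint (- t) x)) * indicator S x \<partial>lborel)"
      by (simp add: indicator_vimage mult.commute)
    also have "\<dots> = emeasure (density lborel (\<lambda>x. ennreal (exp (Lint (- t) x)))) S"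
      by (simp add: emeasure_density)
    finally show "emeasure (distr lebesgue lborel (flow t)) S = emeasure (density lborel (\<lambda>x. ennreal (exp (Lint (- t) x)))) S" .
  qed simp
  moreover have "(\<lambda>x. exp (Lint (- t) x)) \<in> borel_measurable borel" by measurable
  moreover have "- \<bar>t\<bar> * M \<le> Lint (- t) x \<and> Lint (- t) x \<le> \<bar>t\<bar> * M" for x
    using Lint_bound[of "- t" x] by (simp add: abs_le_iff mult.commute)
  ultimately show "\<exists>r\<in>borel_measurable borel. distr lebesgue lborel (flow t) = density lborel (\<lambda>x. ennreal (r x)) \<and>
      (AE x in lborel. exp (- \<bar>t\<bar> * real_of_ereal (Linf_norm L0)) \<le> r x \<and> r x \<le> exp (\<bar>t\<bar> * real_of_ereal (Linf_norm L0)))"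
    unfolding M[symmetric] by (intro bexI[of _ "\<lambda>x. exp (Lint (- t) x)"] conjI) auto
qed

text \<open>For almost every \<open>x\<close> the curve is a classical solution from
  \<open>x\<close> for all times, so uniqueness for the field applies to each such
  \<open>x\<close>.\<close>

lemma gradient_flow_eq_flow:
  assumes "gradient_flow G L0 X"
  shows "AE x in lborel. \<forall>t. X t x = flow t x"
proof -
  have "AE x in lborel. (\<forall>t. ((\<lambda>t. X t x) has_vector_derivative G (X t x)) (at t)) \<and> X 0 x = x"
    using assms unfolding gradient_flow_def AE_completion_iff by (auto elim!: eventually_mono)
  then show ?thesis
  proof eventually_elim
    case (elim x)
    then have "X t x = flow t (X 0 x)" for t by (intro flow_unique) auto
    then show ?case using elim by simp
  qed
qed

text \<open>\<open>L0\<close> may be any function that agrees almost everywhere with the Borel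
  function \<open>L\<close>; measurability and integrability along almost every trajectory are
  inherited from \<open>L\<close>. The null set is found before \<open>t\<close> is chosen, so it
  serves all times at once.\<close>

lemma Lint_eq_integral:
  assumes "AE x in lborel. L0 x = L x"
  shows "AE x in lborel. \<forall>t. interval_lebesgue_integrable lebesgue 0 (ereal t) (\<lambda>s. L0 (flow s x)) \<and>
    (LINT s=0..ereal t|lebesgue. L0 (flow s x)) = Lint t x"
  using AE_flow_time[OF assms]
proof eventually_elim
  case (elim x)
  have m: "(\<lambda>s. L (flow s x)) \<in> borel_measurable borel" by measurable
  have ae: "AE s in lebesgue. L (flow s x) = L0 (flow s x)"
    unfolding AE_completion_iff using elim by (auto elim!: eventually_mono)
  have m0: "(\<lambda>s. L0 (flow s x)) \<in> borel_measurable lebesgue"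
    by (rule borel_measurable_AE[OF measurable_lebesgueI[OF m] ae])
  have S: "set_integrable lebesgue S (\<lambda>s. L0 (flow s x)) \<and> (LINT s:S|lebesgue. L0 (flow s x)) = (LINT s:S|lborel. L (flow s x))"
    if S: "S \<in> sets borel" and i: "set_integrable lborel S (\<lambda>s. L (flow s x))" for S
  proof -
    have ms: "(\<lambda>s. indicator S s *\<^sub>R L (flow s x)) \<in> borel_measurable lborel" using m S by measurable
    have ms0: "(\<lambda>s. indicator S s *\<^sub>R L0 (flow s x)) \<in> borel_measurable lebesgue"
      using S by (intro borel_measurable_scaleR m0 borel_measurable_indicator sets_completionI_sets) simp
    have aes: "AE s in lebesgue. indicator S s *\<^sub>R L (flow s x) = indicator S s *\<^sub>R L0 (flow s x)"
      using ae by (auto elim!: eventually_mono)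
    have "integrable lebesgue (\<lambda>s. indicator S s *\<^sub>R L (flow s x))"
      using i ms unfolding set_integrable_def by (simp only: integrable_completion)
    then have "integrable lebesgue (\<lambda>s. indicator S s *\<^sub>R L0 (flow s x))"
      using integrable_cong_AE[OF measurable_completion[OF ms] ms0 aes] by simp
    moreover have "(LINT s|lebesgue. indicator S s *\<^sub>R L0 (flow s x)) = (LINT s|lborel. indicator S s *\<^sub>R L (flow s x))"
      using integral_cong_AE[OF measurable_completion[OF ms] ms0 aes] integral_completion[OF ms] by simp
    ultimately show ?thesis by (simp add: set_integrable_def set_lebesgue_integral_def)
  qed
  have int: "set_integrable lborel (einterval (ereal a) (ereal b)) (\<lambda>s. L (flow s x))" if "a \<le> b" for a b
    using interval_integrable_bounded(1)[OF m, of M a b] L_bound that by (simp add: interval_lebesgue_integrable_def)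
  have "interval_lebesgue_integrable lebesgue (ereal 0) (ereal t) (\<lambda>s. L0 (flow s x)) \<and>
    (LINT s=ereal 0..ereal t|lebesgue. L0 (flow s x)) = Lint t x" for t
    \<comment> \<open>The two instances of \<open>S\<close> cover the two orientations of the
      interval.\<close>
    using S[OF _ int, of 0 t] S[OF _ int, of t 0]
    unfolding interval_lebesgue_integrable_def interval_lebesgue_integral_def Lint_def by auto
  then show ?case by (simp add: zero_ereal_def)
qed

text \<open>\<open>\<sigma>\<close> is Lebesgue measurable, whereas the transport formula speaks of
  Borel functions; a Borel representative \<open>\<rho>\<close> takes its place, and the relation
  carries over because the flow pulls null sets back to null sets.\<close>

lemma conductivity_solution_if_invariant:
  assumes \<sigma>: "Linf_loc \<sigma>" and inv: "\<And>t. AE x in lborel. \<sigma> x = \<sigma> (flow t x) * exp (Lint t x)"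
  shows "conductivity_solution \<sigma> G"
  unfolding conductivity_solution_def distr_div_def
proof (intro allI impI)
  fix \<phi> :: "real ^ 'd \<Rightarrow> real" assume \<phi>: "test_function \<phi>"
  have m: "\<sigma> \<in> borel_measurable lebesgue" using \<sigma> by (simp add: Linf_loc_def)
  then obtain \<rho> where \<rho>: "\<rho> \<in> borel_measurable lborel" "AE x in lborel. \<sigma> x = \<rho> x"
    using completion_ex_borel_measurable_real by blast
  have [measurable]: "\<rho> \<in> borel_measurable borel" using \<rho>(1) by simp
  have [measurable]: "grad \<phi> \<in> borel_measurable borel"
    by (rule borel_measurable_continuous_onI[OF test_function_grad_continuous[OF \<phi>]])
  have [measurable]: "G \<in> borel_measurable borel" by (rule borel_measurable_continuous_onI[OF continuous])
  have "(LINT x|lborel. \<rho> x * (G x \<bullet> grad \<phi> x)) = 0"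
  proof (rule invariant_density_solves[OF _ _ _ \<phi>])
    show "\<exists>S. AE x in lborel. x \<in> cball 0 R \<longrightarrow> \<bar>\<rho> x\<bar> \<le> S" for R
    proof -
      have "compact (cball (0 :: real ^ 'd) R)" by simp
      then obtain S where "AE x in lebesgue. x \<in> cball 0 R \<longrightarrow> \<bar>\<sigma> x\<bar> \<le> S"
        using \<sigma> unfolding Linf_loc_def by blast
      then have "AE x in lborel. x \<in> cball 0 R \<longrightarrow> \<bar>\<rho> x\<bar> \<le> S"
        unfolding AE_completion_iff using \<rho>(2) by eventually_elim simp
      then show ?thesis by blast
    qed
    show "AE x in lborel. \<rho> x = \<rho> (flow t x) * exp (Lint t x)" for t
      using \<rho>(2) AE_flow[OF \<rho>(2), of t] inv[of t] by eventually_elim simp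
  qed measurable
  moreover have "(LINT x|lebesgue. (\<sigma> x *\<^sub>R G x) \<bullet> grad \<phi> x) = (LINT x|lebesgue. \<rho> x * (G x \<bullet> grad \<phi> x))"
  proof (rule integral_cong_AE)
    show "(\<lambda>x. (\<sigma> x *\<^sub>R G x) \<bullet> grad \<phi> x) \<in> borel_measurable lebesgue"
      by (intro borel_measurable_inner borel_measurable_scaleR m measurable_lebesgueI) measurable
    show "(\<lambda>x. \<rho> x * (G x \<bullet> grad \<phi> x)) \<in> borel_measurable lebesgue"
      by (intro measurable_lebesgueI) measurable
    show "AE x in lebesgue. (\<sigma> x *\<^sub>R G x) \<bullet> grad \<phi> x = \<rho> x * (G x \<bullet> grad \<phi> x)"
      unfolding AE_completion_iff using \<rho>(2) by eventually_elim simp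
  qed
  moreover have "(LINT x|lebesgue. \<rho> x * (G x \<bullet> grad \<phi> x)) = (LINT x|lborel. \<rho> x * (G x \<bullet> grad \<phi> x))"
    by (rule integral_completion) measurable
  ultimately show "- (LINT x|lebesgue. (\<sigma> x *\<^sub>R G x) \<bullet> grad \<phi> x) = 0" by simp
qed

lemma sigma_Linf_loc: "Linf_loc sigma" "Linf_loc (\<lambda>x. inverse (sigma x))"
proof -
  have bound: "\<exists>S. AE x in lebesgue. x \<in> K \<longrightarrow> \<bar>f x\<bar> \<le> S" if K: "compact K" and f: "f = sigma \<or> f = (\<lambda>x. inverse (sigma x))" for K f
  proof -
    obtain R where "K \<subseteq> cball 0 R"
      using bounded_subset_ballD[OF compact_imp_bounded[OF K], of 0] subset_trans[OF _ ball_subset_cball] by blast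
    moreover obtain S where "\<forall>x\<in>cball 0 R. sigma x \<le> S \<and> inverse (sigma x) \<le> S" using sigma_bounds by blast
    ultimately have "\<bar>f x\<bar> \<le> S" if "x \<in> K" for x
      using f sigma_pos[of x] that by (auto simp: abs_of_pos)
    then show ?thesis by (intro exI[of _ S] AE_I2) auto
  qed
  have m: "sigma \<in> borel_measurable lebesgue" "(\<lambda>x. inverse (sigma x)) \<in> borel_measurable lebesgue"
    by (intro measurable_lebesgueI; measurable)+
  show "Linf_loc sigma"
    unfolding Linf_loc_def by (intro conjI allI impI m(1) bound disjI1 refl)
  show "Linf_loc (\<lambda>x. inverse (sigma x))"
    unfolding Linf_loc_def by (intro conjI allI impI m(2) bound disjI2 refl)
qed

end

section \<open>A bounded Borel representative of the Laplacian, and the conclusion\<close>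

lemma bounded_laplacian_exists:
  fixes u L :: "real ^ 'd \<Rightarrow> real"
  assumes "weak_gradient u G" "uniformly_continuous_on UNIV G" "weak_laplacian u L" "Linf L"
  obtains L' where "bounded_laplacian u G L' (real_of_ereal (Linf_norm L))" "AE x in lborel. L x = L' x"
proof -
  define M where "M = real_of_ereal (Linf_norm L)"
  have Lm: "L \<in> borel_measurable lebesgue" and fin: "Linf_norm L < \<infinity>" using assms(4) by (auto simp: Linf_def)
  have "AE x in lebesgue. ereal \<bar>L x\<bar> \<le> Linf_norm L"
    unfolding Linf_norm_def by (rule esssup_AE)
  then have "AE x in lebesgue. \<bar>L x\<bar> \<le> M"
  proof eventually_elim
    case (elim x)
    with fin show ?case unfolding M_def by (cases "Linf_norm L") auto
  qed
  then have LM: "AE x in lborel. \<bar>L x\<bar> \<le> M" by (simp add: AE_completion_iff)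
  \<comment> \<open>Lebesgue measure is not zero, so some point satisfies the bound, whence
    \<open>0 \<le> M\<close>.\<close>
  have "ae_filter (lborel :: (real ^ 'd) measure) \<noteq> bot"
    by (simp add: ae_filter_eq_bot_iff)
  then obtain x where "\<bar>L x\<bar> \<le> M" using eventually_happens'[OF _ LM] by blast
  then have M0: "0 \<le> M" by simp
  obtain L1 where L1: "L1 \<in> borel_measurable lborel" "AE x in lborel. L x = L1 x"
    using completion_ex_borel_measurable_real[OF Lm] by blast
  have L1m [measurable]: "L1 \<in> borel_measurable borel" using L1(1) by simp
  \<comment> \<open>Truncation at \<open>M\<close> changes \<open>L1\<close> on a null set only and
    makes the bound hold at every point.\<close>
  define L' where "L' x = max (- M) (min M (L1 x))" for x
  have LL': "AE x in lborel. L x = L' x"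
    using L1(2) LM by eventually_elim (auto simp: L'_def)
  obtain g h where gh: "\<And>i. weak_partial i u (g i)" "\<And>i. weak_partial i (g i) (h i)" "AE x in lebesgue. L x = (\<Sum>i\<in>UNIV. h i x)"
    using assms(3) unfolding weak_laplacian_def by blast
  have G: "weak_partial i u (\<lambda>x. G x $ i)" for i using assms(1) by (simp add: weak_gradient_def)
  have "bounded_laplacian u G L' M"
  proof
    show "weak_partial i u (\<lambda>x. G x $ i)" for i by (rule G)
    show "uniformly_continuous_on UNIV G" by fact
    show L'm: "L' \<in> borel_measurable borel" unfolding L'_def by measurable
    show L'M: "\<bar>L' x\<bar> \<le> M" for x using M0 by (auto simp: L'_def)
    fix \<theta> :: "real ^ 'd \<Rightarrow> real" and r x assume \<theta>: "ball_kernel \<theta>" and r: "0 < (r :: real)"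
    have h1: "L1_loc (h k)" for k using gh(2)[of k] by (simp add: weak_partial_def)
    \<comment> \<open>\<open>g k\<close> and the \<open>k\<close>-th component of \<open>G\<close>
      are both weak derivatives of \<open>u\<close>; they are compared through their convolutions,
      which equal the same convolution of \<open>u\<close>, so no pointwise identification is
      needed.\<close>
    have "conv (partial k \<theta>) r (\<lambda>y. G y $ k) x = r * conv \<theta> r (h k) x" for k
    proof -
      have k: "ball_kernel (partial k \<theta>)" by (rule kernel_partial[OF \<theta>])
      have "r * conv (partial k \<theta>) r (\<lambda>y. G y $ k) x = r * conv (partial k \<theta>) r (g k) x"
        by (rule trans[OF sym[OF conv_weak_partial[OF G k r]] conv_weak_partial[OF gh(1) k r]])
      then have "conv (partial k \<theta>) r (\<lambda>y. G y $ k) x = conv (partial k \<theta>) r (g k) x" using r by simp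
      also have "\<dots> = r * conv \<theta> r (h k) x" by (rule conv_weak_partial[OF gh(2) \<theta> r])
      finally show ?thesis .
    qed
    then have "(\<Sum>k\<in>UNIV. conv (partial k \<theta>) r (\<lambda>y. G y $ k) x) = r * (\<Sum>k\<in>UNIV. conv \<theta> r (h k) x)"
      by (simp add: sum_distrib_left)
    also have "(\<Sum>k\<in>UNIV. conv \<theta> r (h k) x) = (LINT y|lebesgue. (\<Sum>k\<in>UNIV. h k y * \<theta> ((1 / r) *\<^sub>R (x - y))))"
      unfolding conv_def by (rule Bochner_Integration.integral_sum[symmetric]) (rule conv_integrable[OF \<theta> h1 r])
    also have "\<dots> = conv \<theta> r L' x"
      unfolding conv_def
    proof (rule integral_cong_AE)
      show "(\<lambda>y. \<Sum>k\<in>UNIV. h k y * \<theta> ((1 / r) *\<^sub>R (x - y))) \<in> borel_measurable lebesgue"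
        by (intro borel_measurable_sum borel_measurable_integrable conv_integrable \<theta> h1 r)
      show "(\<lambda>y. L' y * \<theta> ((1 / r) *\<^sub>R (x - y))) \<in> borel_measurable lebesgue"
        by (intro borel_measurable_integrable conv_integrable \<theta> r L1_loc_bounded[OF L'm L'M])
      have "AE y in lebesgue. L y = L' y" using LL' by (simp add: AE_completion_iff)
      with gh(3) show "AE y in lebesgue. (\<Sum>k\<in>UNIV. h k y * \<theta> ((1 / r) *\<^sub>R (x - y))) = L' y * \<theta> ((1 / r) *\<^sub>R (x - y))"
        by eventually_elim (simp add: sum_distrib_right[symmetric])
    qed
    finally show "(\<Sum>k\<in>UNIV. conv (partial k \<theta>) r (\<lambda>y. G y $ k) x) = r * conv \<theta> r L' x" .
  qed
  then show ?thesis using LL' unfolding M_def by (rule that)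
qed

theorem theorem2p1:
  fixes u :: "real ^ 'd \<Rightarrow> real"
    and G :: "real ^ 'd \<Rightarrow> real ^ 'd"
    and L :: "real ^ 'd \<Rightarrow> real"
  assumes "W21_loc u"
    and "weak_gradient u G"
    and "uniformly_continuous_on UNIV G"
    and "weak_laplacian u L"
    and "Linf L"
    and "(INF x. norm (G x)) > 0"
  shows "gradient_flow_well_defined G L \<and>
    (\<exists>\<sigma>. (\<forall>x. \<sigma> x > 0) \<and> Linf_loc \<sigma> \<and> Linf_loc (\<lambda>x. inverse (\<sigma> x)) \<and>
       conductivity_solution \<sigma> G \<and>
       (\<forall>X. gradient_flow G L X \<longrightarrow>
         (\<forall>t. \<exists>E \<in> null_sets lebesgue. \<forall>x. x \<notin> E \<longrightarrow>
            interval_lebesgue_integrable lebesgue 0 (ereal t) (\<lambda>s. L (X s x)) \<and>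
            \<sigma> x / \<sigma> (X t x) = exp (LINT s=0..ereal t|lebesgue. L (X s x))))) \<and>
    (\<forall>\<sigma> X. (\<forall>x. \<sigma> x > 0) \<and> Linf_loc \<sigma> \<and> gradient_flow G L X \<and>
       (\<exists>E \<in> null_sets lebesgue. \<forall>t. \<forall>x. x \<notin> E \<longrightarrow>
          \<sigma> x / \<sigma> (X t x) = exp (LINT s=0..ereal t|lebesgue. L (X s x))) \<longrightarrow>
       conductivity_solution \<sigma> G)"
proof -
  define M where "M = real_of_ereal (Linf_norm L)"
  obtain L' where bl: "bounded_laplacian u G L' M" and LL': "AE x in lborel. L x = L' x"
    unfolding M_def by (rule bounded_laplacian_exists[OF assms(2-5)])
  obtain C A A' where rf: "regularized_field G C A A' L' M"
    by (rule bounded_laplacian.regularized_field_exists[OF bl])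
  obtain U :: "real ^ 'd \<Rightarrow> real" where U: "\<And>x. (U has_derivative (\<lambda>h. G x \<bullet> h)) (at x)"
  proof (rule bounded_laplacian.potential_exists[OF bl])
    fix U :: "real ^ 'd \<Rightarrow> real" assume "\<And>x. (U has_derivative (\<lambda>h. G x \<bullet> h)) (at x)"
    then show thesis by (rule that)
  qed
  have low: "(INF x. norm (G x)) \<le> norm (G x)" for x
    by (rule cINF_lower) (auto intro: bdd_belowI2[where m = 0])
  interpret regularized_gradient_field G C A A' L' M U "INF x. norm (G x)"
    by (intro regularized_gradient_field.intro regularized_gradient_field_axioms.intro rf U assms(6) low)
  \<comment> \<open>For almost every \<open>x\<close>, any flow \<open>X\<close> is the constructed
    one and its exponent is \<open>Lint\<close>, for all \<open>t\<close> simultaneously. The ratio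
    formula and the converse are both read off from this.\<close>
  have ae: "AE x in lborel. (\<forall>t. X t x = flow t x) \<and> (\<forall>t. interval_lebesgue_integrable lebesgue 0 (ereal t) (\<lambda>s. L (X s x)) \<and>
      (LINT s=0..ereal t|lebesgue. L (X s x)) = Lint t x)" if "gradient_flow G L X" for X
    using gradient_flow_eq_flow[OF that] Lint_eq_integral[OF LL'] by eventually_elim simp
  have well_defined: "gradient_flow_well_defined G L"
    unfolding gradient_flow_well_defined_def
  proof (intro conjI allI impI)
    show "\<exists>X. gradient_flow G L X" by (rule exI) (rule flow_gradient_flow[OF M_def])
    fix X Y assume XY: "gradient_flow G L X \<and> gradient_flow G L Y"
    from XY have "AE x in lborel. \<forall>t. X t x = flow t x" "AE x in lborel. \<forall>t. Y t x = flow t x"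
      by (auto intro: gradient_flow_eq_flow)
    then have "AE x in lborel. \<forall>t. X t x = Y t x" by eventually_elim simp
    then show "AE x in lebesgue. \<forall>t. X t x = Y t x" by (simp add: AE_completion_iff)
  qed
  have solution: "conductivity_solution sigma G"
  proof (rule conductivity_solution_if_invariant[OF sigma_Linf_loc(1)])
    fix t
    show "AE x in lborel. sigma x = sigma (flow t x) * exp (Lint t x)"
    proof (rule AE_I2)
      fix x
      have "sigma (flow t x) \<noteq> 0" using sigma_pos[of "flow t x"] by simp
      then show "sigma x = sigma (flow t x) * exp (Lint t x)"
        using sigma_flow[of x t] by (simp only: divide_eq_eq) simp
    qed
  qed
  have formula: "\<exists>E \<in> null_sets lebesgue. \<forall>x. x \<notin> E \<longrightarrow>
      interval_lebesgue_integrable lebesgue 0 (ereal t) (\<lambda>s. L (X s x)) \<and>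
      sigma x / sigma (X t x) = exp (LINT s=0..ereal t|lebesgue. L (X s x))" if X: "gradient_flow G L X" for X t
  proof -
    have "AE x in lebesgue. interval_lebesgue_integrable lebesgue 0 (ereal t) (\<lambda>s. L (X s x)) \<and>
      sigma x / sigma (X t x) = exp (LINT s=0..ereal t|lebesgue. L (X s x))"
      unfolding AE_completion_iff using ae[OF X]
    proof eventually_elim
      case (elim x)
      then have "X t x = flow t x" by (rule conjE) (erule spec)
      moreover have "interval_lebesgue_integrable lebesgue 0 (ereal t) (\<lambda>s. L (X s x)) \<and>
          (LINT s=0..ereal t|lebesgue. L (X s x)) = Lint t x"
        using conjunct2[OF elim] by (rule spec)
      ultimately show ?case by (simp only: sigma_flow)
    qed
    then show ?thesis by (rule AE_E3) auto
  qed
  have converse: "conductivity_solution \<sigma> G"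
    if pos: "\<forall>x. \<sigma> x > 0" and \<sigma>: "Linf_loc \<sigma>" and X: "gradient_flow G L X"
      and E: "E \<in> null_sets lebesgue" "\<forall>t. \<forall>x. x \<notin> E \<longrightarrow> \<sigma> x / \<sigma> (X t x) = exp (LINT s=0..ereal t|lebesgue. L (X s x))" for \<sigma> X E
  proof (rule conductivity_solution_if_invariant[OF \<sigma>])
    fix t
    have "AE x in lborel. x \<notin> E" using AE_not_in[OF E(1)] by (simp add: AE_completion_iff)
    then show "AE x in lborel. \<sigma> x = \<sigma> (flow t x) * exp (Lint t x)"
      using ae[OF X]
    proof eventually_elim
      case (elim x)
      have "X t x = flow t x" "(LINT s=0..ereal t|lebesgue. L (X s x)) = Lint t x"
        by (rule spec[OF conjunct1[OF elim(2)]], rule conjunct2[OF spec[OF conjunct2[OF elim(2)]]])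
      with E(2)[rule_format, OF elim(1), of t] have "\<sigma> x / \<sigma> (flow t x) = exp (Lint t x)" by (simp only:)
      then show ?case using pos[rule_format, of "flow t x"] by (simp add: divide_eq_eq mult.commute split: if_splits)
    qed
  qed
  show ?thesis
  proof (intro conjI allI impI exI[of _ sigma])
    show "gradient_flow_well_defined G L" by (rule well_defined)
    show "sigma x > 0" for x by (rule sigma_pos)
    show "Linf_loc sigma" "Linf_loc (\<lambda>x. inverse (sigma x))" by (rule sigma_Linf_loc)+
    show "conductivity_solution sigma G" by (rule solution)
    show "\<exists>E \<in> null_sets lebesgue. \<forall>x. x \<notin> E \<longrightarrow>
        interval_lebesgue_integrable lebesgue 0 (ereal t) (\<lambda>s. L (X s x)) \<and>
        sigma x / sigma (X t x) = exp (LINT s=0..ereal t|lebesgue. L (X s x))" if "gradient_flow G L X" for X t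
      by (rule formula[OF that])
    fix \<sigma> X
    assume H: "(\<forall>x. \<sigma> x > 0) \<and> Linf_loc \<sigma> \<and> gradient_flow G L X \<and>
        (\<exists>E \<in> null_sets lebesgue. \<forall>t. \<forall>x. x \<notin> E \<longrightarrow>
          \<sigma> x / \<sigma> (X t x) = exp (LINT s=0..ereal t|lebesgue. L (X s x)))"
    from H have "\<exists>E \<in> null_sets lebesgue. \<forall>t. \<forall>x. x \<notin> E \<longrightarrow>
          \<sigma> x / \<sigma> (X t x) = exp (LINT s=0..ereal t|lebesgue. L (X s x))" by (elim conjE)
    then obtain E where E: "E \<in> null_sets lebesgue"
      "\<forall>t. \<forall>x. x \<notin> E \<longrightarrow> \<sigma> x / \<sigma> (X t x) = exp (LINT s=0..ereal t|lebesgue. L (X s x))" ..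
    show "conductivity_solution \<sigma> G"
      by (rule converse[OF conjunct1[OF H] conjunct1[OF conjunct2[OF H]] conjunct1[OF conjunct2[OF conjunct2[OF H]]] E])
  qed
qed

end
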